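(* Let $\{f_{a,b}\}$ be a family of circle maps in Class $\mathcal{N}$, with corresponding family of lifts $\{F_{a,b}\}$. Then for every rational number $\omega$, the Arnold tongue $A_\omega$ has on each side (left and right) an arc of its boundary at whose points the boundary of zero-width rotation interval for the family, i.e. the boundary in the $(a,b)$ parameter plane of the set of parameters for which $Rot(F_{a,b})$ is a single point, is not locally connected.
   Context: A degree-one lift is a continuous $F:\mathbb{R}\to\mathbb{R}$ with $F(x+1)=F(x)+1$ for all $x$; it is a lift of a degree-one circle map $f$ of $\mathbb{R}/\mathbb{Z}$. Its rotation set $Rot(F)$ is the set of all values $\lim_{m\to\infty}\frac{F^m(x)-x}{m}$ over those $x\in\mathbb{R}$ for which the limit exists; it is a single point or a nondegenerate closed interval. Its lower and upper monotone bounds are $F_l(x)=\inf\{F(y)\mid y\ge x\}$ and $F_u(x)=\sup\{F(y)\mid y\le x\}$. Class $\mathcal{B}$: lifts $F$ of degree-one circle maps that are $C^3$, piecewise strictly monotone, have at most two critical points (per fundamental domain $[0,1)$), both turning points when there are two, and have negative Schwarzian derivative $S(F)=\frac{F'''}{F'}-\frac32\left(\frac{F''}{F'}\right)^2$ (where defined) when they have two critical points. Class $\mathcal{N}$: two-parameter families of circle maps $\{f_{a,b}\}$ (with $a\in\mathbb{R}$ and $b$ real) having a corresponding family of lifts $\{F_{a,b}\}$ such that (i) each $F_{a,b}$ is in Class $\mathcal{B}$; (ii) $F_{a,b}$ and $\frac{d}{dx}F_{a,b}$ depend continuously on $(a,b)$; (iii) $a$ is a translation parameter: $F_{a,b}=F_{0,b}+a$;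 (iv) the Hausdorff distance $\Delta$ between (the graphs of) the upper and lower monotone bounds of $F_{a,b}$ is a nondecreasing function of $b$ such that the value $0$ can be attained and the value $1$ can be exceeded. The critical line is the horizontal line $b=\max\{b\mid\Delta=0\}$. On it $F_{a,b}$ has a unique critical point in $[0,1)$, and above it $F_{a,b}$ has two. When $F_{a,b}$ has two turning points per fundamental domain, with maximum at $C$ and minimum at $K$, the origin is chosen so that $0\le C<K<1$; with $K^-$ the closest point below $K$ with the same image as $K$ and $C^+$ the closest point above $C$ with the same image as $C$, one assumes $0<K^-\le C\le K\le C^+<1$ when $0\le\Delta<1$ (all four points being equal to the unique critical point on the critical line). The Arnold tongue $A_\omega$ is the set of parameters $(a,b)$ such that $\omega\in Rot(F_{a,b})$. For each $b$ its intersection with the horizontal line at height $b$ is a closed interval of values of $a$; the left (respectively right) side of the boundary of $A_\omega$ consists of the left (respectively right) endpoints of these intervals.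
   Formalization: Read literally, Class N is empty: some b has F(C)-F(K)=1, where Δ<1 yet C^+=K^-+1, so 0<K^- and C^+<1 cannot both hold. The inequalities 0<K^-≤C≤K≤C^+<1 are therefore required only when Δ<1 and also F(C)<F(K)+1. *)

theory Defs
  imports "HOL-Analysis.Analysis"
begin

section \<open>Lifts of degree-one circle maps\<close>

text \<open>The circle is the unit circle of the complex plane, with covering map
  \<open>x \<mapsto> cis (2 * pi * x)\<close>; the values of \<open>f\<close> off the unit circle play no role.\<close>

definition degree_one_lift :: "(real \<Rightarrow> real) \<Rightarrow> bool" where
  "degree_one_lift F \<longleftrightarrow> continuous_on UNIV F \<and> (\<forall>x. F (x + 1) = F x + 1)"

definition is_lift_of :: "(real \<Rightarrow> real) \<Rightarrow> (complex \<Rightarrow> complex) \<Rightarrow> bool" where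
  "is_lift_of F f \<longleftrightarrow> degree_one_lift F \<and> (\<forall>x. f (cis (2 * pi * x)) = cis (2 * pi * F x))"

definition Rot :: "(real \<Rightarrow> real) \<Rightarrow> real set" where
  "Rot F = {r. \<exists>x. (\<lambda>m. ((F ^^ m) x - x) / real m) \<longlonglongrightarrow> r}"

definition lower_bound :: "(real \<Rightarrow> real) \<Rightarrow> real \<Rightarrow> real" where
  "lower_bound F x = Inf (F ` {x..})"

definition upper_bound :: "(real \<Rightarrow> real) \<Rightarrow> real \<Rightarrow> real" where
  "upper_bound F x = Sup (F ` {..x})"

text \<open>For a degree-one lift, \<open>upper_bound F - lower_bound F\<close> is bounded, so both suprema below
  are taken over bounded sets when this is applied to the graphs of the two bounds.\<close>

definition hausdorff_distance :: "'a::metric_space set \<Rightarrow> 'a set \<Rightarrow> real" where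
  "hausdorff_distance A B = max (SUP x\<in>A. infdist x B) (SUP y\<in>B. infdist y A)"

definition graph_of :: "(real \<Rightarrow> real) \<Rightarrow> (real \<times> real) set" where
  "graph_of g = {(x, g x) | x. True}"

definition bounds_distance :: "(real \<Rightarrow> real) \<Rightarrow> real" where
  "bounds_distance F = hausdorff_distance (graph_of (upper_bound F)) (graph_of (lower_bound F))"

section \<open>Class B\<close>

definition C3 :: "(real \<Rightarrow> real) \<Rightarrow> bool" where
  "C3 F \<longleftrightarrow> (\<forall>k<3. (deriv ^^ k) F differentiable_on UNIV) \<and> continuous_on UNIV ((deriv ^^ 3) F)"

definition critical_points :: "(real \<Rightarrow> real) \<Rightarrow> real set" where
  "critical_points F = {x \<in> {0..<1}. deriv F x = 0}"

definition turning_max :: "(real \<Rightarrow> real) \<Rightarrow> real \<Rightarrow> bool" where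
  "turning_max F c \<longleftrightarrow>
     (\<exists>e>0. strict_mono_on {c - e..c} F \<and> strict_antimono_on {c..c + e} F)"

definition turning_min :: "(real \<Rightarrow> real) \<Rightarrow> real \<Rightarrow> bool" where
  "turning_min F c \<longleftrightarrow>
     (\<exists>e>0. strict_antimono_on {c - e..c} F \<and> strict_mono_on {c..c + e} F)"

text \<open>Finitely many breakpoints in one fundamental domain suffice, by periodicity of \<open>F x - x\<close>.\<close>

definition piecewise_strictly_monotone :: "(real \<Rightarrow> real) \<Rightarrow> bool" where
  "piecewise_strictly_monotone F \<longleftrightarrow>
     (\<exists>P. finite P \<and>
        (\<forall>s t. 0 \<le> s \<and> s < t \<and> t \<le> 1 \<and> {s<..<t} \<inter> P = {} \<longrightarrow>
           strict_mono_on {s..t} F \<or> strict_antimono_on {s..t} F))"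

definition schwarzian :: "(real \<Rightarrow> real) \<Rightarrow> real \<Rightarrow> real" where
  "schwarzian F x =
     (deriv ^^ 3) F x / deriv F x - 3 / 2 * ((deriv ^^ 2) F x / deriv F x)\<^sup>2"

definition class_B :: "(real \<Rightarrow> real) \<Rightarrow> bool" where
  "class_B F \<longleftrightarrow>
     degree_one_lift F \<and> C3 F \<and> piecewise_strictly_monotone F \<and>
     finite (critical_points F) \<and> card (critical_points F) \<le> 2 \<and>
     (card (critical_points F) = 2 \<longrightarrow>
        (\<forall>c\<in>critical_points F. turning_max F c \<or> turning_min F c) \<and>
        (\<forall>x. deriv F x \<noteq> 0 \<longrightarrow> schwarzian F x < 0))"

section \<open>Class N\<close>

definition critical_height :: "(real \<Rightarrow> real \<Rightarrow> real \<Rightarrow> real) \<Rightarrow> real" where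
  "critical_height F = (GREATEST b. bounds_distance (F 0 b) = 0)"

definition left_preimage :: "(real \<Rightarrow> real) \<Rightarrow> real \<Rightarrow> real" where
  "left_preimage F K = (GREATEST y. y < K \<and> F y = F K)"

definition right_preimage :: "(real \<Rightarrow> real) \<Rightarrow> real \<Rightarrow> real" where
  "right_preimage F C = (LEAST y. C < y \<and> F y = F C)"

text \<open>The choice of origin. Let \<open>C\<close> be the maximum and \<open>K\<close> the minimum. If \<open>F C = F K + 1\<close> then
  \<open>right_preimage F C = left_preimage F K + 1\<close>, so no choice of origin puts both points strictly
  between 0 and 1; yet the Hausdorff distance of the graphs is still less than 1 there. The
  condition \<open>F C < F K + 1\<close> is what makes the requirement on these points satisfiable.
  On the critical line all four points coincide with the unique critical point.\<close>

definition normalized_origin :: "(real \<Rightarrow> real \<Rightarrow> real \<Rightarrow> real) \<Rightarrow> bool" where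
  "normalized_origin F \<longleftrightarrow>
     (\<forall>a. \<exists>c. critical_points (F a (critical_height F)) = {c} \<and> 0 < c) \<and>
     (\<forall>a. \<forall>b>critical_height F. \<exists>C K.
        critical_points (F a b) = {C, K} \<and> 0 \<le> C \<and> C < K \<and> K < 1 \<and>
        turning_max (F a b) C \<and> turning_min (F a b) K \<and>
        (bounds_distance (F a b) < 1 \<and> F a b C < F a b K + 1 \<longrightarrow>
           0 < left_preimage (F a b) K \<and> left_preimage (F a b) K \<le> C \<and>
           K \<le> right_preimage (F a b) C \<and> right_preimage (F a b) C < 1))"

definition class_N ::
  "(real \<Rightarrow> real \<Rightarrow> complex \<Rightarrow> complex) \<Rightarrow> (real \<Rightarrow> real \<Rightarrow> real \<Rightarrow> real) \<Rightarrow> bool" where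
  "class_N f F \<longleftrightarrow>
     (\<forall>a b. is_lift_of (F a b) (f a b)) \<and>
     (\<forall>a b. class_B (F a b)) \<and>
     (\<forall>a b. uniform_limit UNIV (\<lambda>p. F (fst p) (snd p)) (F a b) (at (a, b))) \<and>
     (\<forall>a b. uniform_limit UNIV (\<lambda>p. deriv (F (fst p) (snd p))) (deriv (F a b)) (at (a, b))) \<and>
     (\<forall>a b x. F a b x = F 0 b x + a) \<and>
     (\<forall>a. mono (\<lambda>b. bounds_distance (F a b)) \<and>
          (\<exists>b. bounds_distance (F a b) = 0) \<and> (\<exists>b. bounds_distance (F a b) > 1)) \<and>
     normalized_origin F"

section \<open>Arnold tongues and zero-width rotation intervals\<close>

definition arnold_tongue :: "(real \<Rightarrow> real \<Rightarrow> real \<Rightarrow> real) \<Rightarrow> real \<Rightarrow> (real \<times> real) set" where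
  "arnold_tongue F \<omega> = {(a, b). \<omega> \<in> Rot (F a b)}"

definition tongue_left_side :: "(real \<Rightarrow> real \<Rightarrow> real \<Rightarrow> real) \<Rightarrow> real \<Rightarrow> (real \<times> real) set" where
  "tongue_left_side F \<omega> =
     {(a, b). (a, b) \<in> arnold_tongue F \<omega> \<and> (\<forall>a'. (a', b) \<in> arnold_tongue F \<omega> \<longrightarrow> a \<le> a')}"

definition tongue_right_side :: "(real \<Rightarrow> real \<Rightarrow> real \<Rightarrow> real) \<Rightarrow> real \<Rightarrow> (real \<times> real) set" where
  "tongue_right_side F \<omega> =
     {(a, b). (a, b) \<in> arnold_tongue F \<omega> \<and> (\<forall>a'. (a', b) \<in> arnold_tongue F \<omega> \<longrightarrow> a' \<le> a)}"

definition zero_width_set :: "(real \<Rightarrow> real \<Rightarrow> real \<Rightarrow> real) \<Rightarrow> (real \<times> real) set" where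
  "zero_width_set F = {(a, b). \<exists>r. Rot (F a b) = {r}}"

definition not_locally_connected_at :: "(real \<times> real) set \<Rightarrow> real \<times> real \<Rightarrow> bool" where
  "not_locally_connected_at S p \<longleftrightarrow> p \<in> S \<and> \<not> locally_connected_at p (top_of_set S)"

end

theory Submission
  imports Defs
begin

text \<open>Write \<open>U\<close> and \<open>L\<close> for the upper and lower bounds of a lift; \<open>Rot F\<close> has endpoints
  \<open>rotation L\<close> and \<open>rotation U\<close>. Two facts make the boundary of the zero-width set comb-like.

  Above the critical line an irrational rotation number forces positive width. Otherwise \<open>F\<close>
  is semiconjugate to an irrational rotation and the interval between the two critical values is
  wandering; at a record minimum of its iterates' lengths the negative Schwarzian derivative
  leaves definite space around it, which the density of the backward orbit of the critical points
  forbids. So on the zero-width set the rotation number is rational, hence constant on connected sets.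

  On the other hand, just outside a tongue \<open>A_{p/q}\<close> and close to the critical line there are
  zero-width parameters: choose \<open>a\<close> so that the maximum is periodic for \<open>U\<close> with rotation
  number a Farey neighbour \<open>p'/q'\<close> of \<open>p/q\<close>. The gaps of this orbit have total length 1, so
  the passage from the critical value back to the critical region has distortion bounded
  independently of \<open>q'\<close>, while \<open>F\<close> is nearly flat between its critical points. Thus \<open>L\<close>
  has rotation number \<open>p'/q'\<close> too. These parameters accumulate at the side of the tongue
  with rotation numbers different from \<open>p/q\<close>.\<close>

section \<open>Rotation numbers of monotone lifts\<close>

text \<open>Zero-width parameters outside the tongue must be turned into frontier points. When
  \<open>a\<close> moves from such a parameter towards the tongue, the rotation number of
  \<open>U\<close> rises continuously and takes an irrational value before it reaches \<omega>. The
  width is positive there, so the segment in between meets the frontier at a rotation number below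
  \<omega>.

  The Farey construction has to work with constants fixed before \<open>b\<close> and
  \<open>q'\<close>. Hence a period \<open>q'\<close> is split: the last \<open>q\<close> steps,
  with \<open>q\<close> fixed, are estimated by the crude factor \<open>\<Lambda> ^ q\<close>, and
  only the unbounded number \<open>q' - q\<close> of earlier steps needs bounded distortion. The
  neighbours of the maximum in its orbit stay at a definite distance because, at the critical
  height, the critical point is not periodic at the left end of the tongue.

  Only left sides are treated: the reflection of the line exchanges \<open>U\<close> with
  \<open>L\<close> and the right side with the left.\<close>

definition deg1 :: "(real \<Rightarrow> real) \<Rightarrow> bool" where
  "deg1 G \<longleftrightarrow> (\<forall>x. G (x + 1) = G x + 1)"

lemma deg1_add_of_int:
  assumes "deg1 G"
  shows "G (x + of_int m) = G x + of_int m"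
proof -
  have nat: "G (x + of_nat n) = G x + of_nat n" for n x
  proof (induction n)
    case (Suc n)
    have "G (x + of_nat (Suc n)) = G ((x + of_nat n) + 1)"
      by (simp add: algebra_simps)
    then show ?case
      using assms Suc by (simp add: deg1_def)
  qed simp
  show ?thesis
  proof (cases "m \<ge> 0")
    case True
    then show ?thesis
      using nat[of x "nat m"] by simp
  next
    case False
    then have "G x = G (x + of_int m + of_nat (nat (- m)))"
      by simp
    also have "\<dots> = G (x + of_int m) - of_int m"
      using nat[of "x + of_int m" "nat (- m)"] False by simp
    finally show ?thesis by simp
  qed
qed

lemma deg1_diff_of_int: "deg1 G \<Longrightarrow> G (x - of_int m) = G x - of_int m"
  using deg1_add_of_int[of G x "- m"] by simp

lemma deg1_funpow: "deg1 G \<Longrightarrow> deg1 (G ^^ n)"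
  by (induction n) (auto simp: deg1_def)

text \<open>Only the larger map has to be monotone here, and only the smaller one in the next lemma;
  so a lift that is not monotone can be compared with both of its bounds.\<close>

lemma mono_le_funpow:
  fixes G H :: "real \<Rightarrow> real"
  assumes "mono H" "\<And>x. G x \<le> H x"
  shows "(G ^^ n) x \<le> (H ^^ n) x"
proof (induction n)
  case (Suc n)
  have "G ((G ^^ n) x) \<le> H ((G ^^ n) x)" by (rule assms)
  also have "\<dots> \<le> H ((H ^^ n) x)" using Suc assms by (simp add: monoD)
  finally show ?case by simp
qed simp

lemma mono_ge_funpow:
  fixes G H :: "real \<Rightarrow> real"
  assumes "mono G" "\<And>x. G x \<le> H x"
  shows "(G ^^ n) x \<le> (H ^^ n) x"
proof (induction n)
  case (Suc n)
  have "G ((G ^^ n) x) \<le> G ((H ^^ n) x)" using Suc assms by (simp add: monoD)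
  also have "\<dots> \<le> H ((H ^^ n) x)" by (rule assms)
  finally show ?case by simp
qed simp

lemma mono_funpow': "mono G \<Longrightarrow> mono (G ^^ n)" for G :: "real \<Rightarrow> real"
  by (induction n) (auto simp: mono_def)

text \<open>The translation number, as the supremum of the slopes \<open>m / n\<close> that the
  orbit of 0 has reached. No limit is presupposed; the error bound, and from it convergence, come
  from comparing slopes.\<close>

definition rotation :: "(real \<Rightarrow> real) \<Rightarrow> real" where
  "rotation G = Sup {of_int m / of_nat n | m n. n \<ge> 1 \<and> of_int m \<le> (G ^^ n) 0}"

lemma funpow_mult_ge:
  assumes "mono G" "deg1 G" "x + of_int m \<le> (G ^^ n) x"
  shows "x + of_int (int k * m) \<le> (G ^^ (n * k)) x"
proof (induction k)
  case (Suc k)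
  have "x + of_int (int (Suc k) * m) = (x + of_int m) + of_int (int k * m)"
    by (simp add: algebra_simps)
  also have "\<dots> \<le> (G ^^ n) x + of_int (int k * m)"
    using assms by simp
  also have "\<dots> = (G ^^ n) (x + of_int (int k * m))"
    using deg1_add_of_int[OF deg1_funpow[OF assms(2)], of n _ "int k * m"] by simp
  also have "\<dots> \<le> (G ^^ n) ((G ^^ (n * k)) x)"
    using Suc mono_funpow'[OF assms(1)] by (simp add: monoD)
  finally show ?case
    by (simp add: funpow_add)
qed simp

lemma funpow_mult_le:
  assumes "mono G" "deg1 G" "(G ^^ n) x \<le> x + of_int m"
  shows "(G ^^ (n * k)) x \<le> x + of_int (int k * m)"
proof (induction k)
  case (Suc k)
  have "(G ^^ (n * Suc k)) x = (G ^^ n) ((G ^^ (n * k)) x)"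
    by (simp add: funpow_add)
  also have "\<dots> \<le> (G ^^ n) (x + of_int (int k * m))"
    using Suc mono_funpow'[OF assms(1)] by (simp add: monoD)
  also have "\<dots> = (G ^^ n) x + of_int (int k * m)"
    using deg1_add_of_int[OF deg1_funpow[OF assms(2)], of n _ "int k * m"] by simp
  also have "\<dots> \<le> x + of_int m + of_int (int k * m)"
    using assms by simp
  finally show ?case
    by (simp add: algebra_simps)
qed simp

text \<open>A slope \<open>m' / n'\<close> of the set and the value at time \<open>n\<close> are
  compared at the common time \<open>n * n'\<close>. The error 1 comes from rounding
  \<open>(G ^^ n) 0\<close> to an integer.\<close>

lemma rotation_bound:
  assumes "mono G" "deg1 G" "n \<ge> 1"
  shows "\<bar>(G ^^ n) 0 - of_nat n * rotation G\<bar> \<le> 1"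
proof -
  let ?S = "{of_int m / of_nat n | m n. n \<ge> 1 \<and> of_int m \<le> (G ^^ n) 0} :: real set"
  have upper: "s \<le> ((G ^^ n) 0 + 1) / of_nat n" if "s \<in> ?S" "n \<ge> 1" for s n
  proof -
    obtain m' n' where s: "s = of_int m' / of_nat n'" "n' \<ge> 1" "of_int m' \<le> (G ^^ n') 0"
      using \<open>s \<in> ?S\<close> by auto
    have "of_int (int n * m') \<le> (G ^^ (n' * n)) 0"
      using funpow_mult_ge[OF assms(1,2), of 0 m' n' n] s by simp
    also have "\<dots> = (G ^^ (n * n')) 0" by (simp add: mult.commute)
    also have "\<dots> \<le> of_int (int n' * \<lceil>(G ^^ n) 0\<rceil>)"
      using funpow_mult_le[OF assms(1,2), of n 0 "\<lceil>(G ^^ n) 0\<rceil>" n'] by simp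
    also have "\<dots> \<le> of_nat n' * ((G ^^ n) 0 + 1)"
      using of_int_ceiling_le_add_one[of "(G ^^ n) 0"] by (simp add: mult_left_mono)
    finally have "of_nat n * of_int m' \<le> of_nat n' * ((G ^^ n) 0 + 1)" by simp
    then have "of_int m' / of_nat n' \<le> ((G ^^ n) 0 + 1) / of_nat n"
      using s(2) that(2) by (simp add: frac_le_eq divide_le_0_iff mult.commute field_split_simps)
    then show ?thesis using s(1) by simp
  qed
  have S1: "of_int \<lfloor>(G ^^ n) 0\<rfloor> / of_nat n \<in> ?S"
    using assms(3) by (intro CollectI exI[of _ "\<lfloor>(G ^^ n) 0\<rfloor>"] exI[of _ n]) auto
  have "rotation G \<le> ((G ^^ n) 0 + 1) / of_nat n"
    unfolding rotation_def using S1 upper[OF _ assms(3)] by (intro cSup_least) blast+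
  moreover have "of_int \<lfloor>(G ^^ n) 0\<rfloor> / of_nat n \<le> rotation G"
    unfolding rotation_def using S1 upper[OF _ assms(3)]
    by (intro cSup_upper) (auto intro!: bdd_aboveI)
  ultimately have "of_nat n * rotation G \<le> (G ^^ n) 0 + 1"
     "of_int \<lfloor>(G ^^ n) 0\<rfloor> \<le> of_nat n * rotation G"
    using assms(3) by (simp_all add: field_simps)
  then show ?thesis by linarith
qed

text \<open>\<open>x\<close> lies between consecutive integers, whose displacements equal that of 0;
  this costs one more unit.\<close>

lemma rotation_displacement:
  assumes "mono G" "deg1 G"
  shows "\<bar>(G ^^ n) x - x - of_nat n * rotation G\<bar> \<le> 2"
proof (cases "n \<ge> 1")
  case True
  have "(G ^^ n) 0 + of_int \<lfloor>x\<rfloor> = (G ^^ n) (of_int \<lfloor>x\<rfloor>)"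
       "(G ^^ n) 0 + of_int (\<lfloor>x\<rfloor> + 1) = (G ^^ n) (of_int (\<lfloor>x\<rfloor> + 1))"
    using deg1_add_of_int[OF deg1_funpow[OF assms(2)], where x=0] by (metis add.left_neutral)+
  moreover have "(G ^^ n) (of_int \<lfloor>x\<rfloor>) \<le> (G ^^ n) x" "(G ^^ n) x \<le> (G ^^ n) (of_int (\<lfloor>x\<rfloor> + 1))"
    by (auto intro!: monoD[OF mono_funpow'[OF assms(1)]])
  ultimately show ?thesis
    using rotation_bound[OF assms True] by (simp, linarith)
next
  case False
  then have "n = 0" by simp
  then show ?thesis by simp
qed

lemma rotation_tendsto:
  assumes "mono G" "deg1 G"
  shows "(\<lambda>n. ((G ^^ n) x - x) / real n) \<longlonglongrightarrow> rotation G"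
proof -
  have lim: "(\<lambda>n. 2 / real n) \<longlonglongrightarrow> 0"
    by (rule lim_const_over_n)
  have bound: "norm (((G ^^ n) x - x) / real n - rotation G) \<le> 2 / real n" if "n \<ge> 1" for n
  proof -
    have "((G ^^ n) x - x) / real n - rotation G = ((G ^^ n) x - x - real n * rotation G) / real n"
      using that by (simp add: field_simps)
    then show ?thesis
      using rotation_displacement[OF assms, of n x] that by (simp add: divide_right_mono)
  qed
  have "(\<lambda>n. ((G ^^ n) x - x) / real n - rotation G) \<longlonglongrightarrow> 0"
    by (rule Lim_null_comparison[OF eventually_sequentiallyI[of 1] lim]) (rule bound)
  then show ?thesis by (simp add: LIM_zero_iff)
qed

text \<open>One inequality at one point decides: repeated \<open>j\<close> times, a deficit would
  exceed the uniform displacement error 2.\<close>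

lemma rotation_ge:
  assumes "mono G" "deg1 G" "x + of_int m \<le> (G ^^ k) x"
  shows "of_int m \<le> real k * rotation G"
proof (rule ccontr)
  assume "\<not> ?thesis"
  then obtain j :: nat where j: "real j * (of_int m - real k * rotation G) > 2"
    using reals_Archimedean3[of "of_int m - real k * rotation G"] by auto
  have "x + of_int (int j * m) \<le> (G ^^ (k * j)) x"
    by (rule funpow_mult_ge[OF assms])
  moreover have "\<bar>(G ^^ (k * j)) x - x - of_nat (k * j) * rotation G\<bar> \<le> 2"
    by (rule rotation_displacement[OF assms(1,2)])
  ultimately show False using j by (simp add: algebra_simps)
qed

lemma rotation_le:
  assumes "mono G" "deg1 G" "(G ^^ k) x \<le> x + of_int m"
  shows "real k * rotation G \<le> of_int m"
proof (rule ccontr)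
  assume "\<not> ?thesis"
  then obtain j :: nat where j: "real j * (real k * rotation G - of_int m) > 2"
    using reals_Archimedean3[of "real k * rotation G - of_int m"] by auto
  have "(G ^^ (k * j)) x \<le> x + of_int (int j * m)"
    by (rule funpow_mult_le[OF assms])
  moreover have "\<bar>(G ^^ (k * j)) x - x - of_nat (k * j) * rotation G\<bar> \<le> 2"
    by (rule rotation_displacement[OF assms(1,2)])
  ultimately show False using j by (simp add: algebra_simps)
qed

lemma rotation_mono:
  assumes "mono G" "deg1 G" "mono H" "deg1 H" "\<And>x. G x \<le> H x"
  shows "rotation G \<le> rotation H"
proof (rule LIMSEQ_le[OF rotation_tendsto[OF assms(1,2)] rotation_tendsto[OF assms(3,4)]])
  show "\<exists>N. \<forall>n\<ge>N. ((G ^^ n) 0 - 0) / real n \<le> ((H ^^ n) 0 - 0) / real n"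
    using mono_le_funpow[OF assms(3,5)] by (auto intro!: divide_right_mono)
qed

lemma mono_add_const: "mono G \<Longrightarrow> mono (\<lambda>x. G x + a)" for G :: "real \<Rightarrow> real"
  by (auto simp: mono_def)

lemma deg1_add_const: "deg1 G \<Longrightarrow> deg1 (\<lambda>x. G x + a)"
  by (auto simp: deg1_def)

lemma rotation_add_mono:
  assumes "mono G" "deg1 G" "a \<le> a'"
  shows "rotation (\<lambda>x. G x + a) \<le> rotation (\<lambda>x. G x + a')"
  using assms by (intro rotation_mono mono_add_const deg1_add_const) auto

lemma funpow_add_of_int:
  assumes "deg1 G"
  shows "((\<lambda>x. G x + of_int k) ^^ n) x = (G ^^ n) x + of_int (int n * k)"
proof (induction n)
  case (Suc n)
  then show ?case using deg1_add_of_int[OF assms, of "(G ^^ n) x" "int n * k"]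
    by (simp add: algebra_simps)
qed simp

lemma rotation_add_of_int:
  assumes "mono G" "deg1 G"
  shows "rotation (\<lambda>x. G x + of_int k) = rotation G + of_int k"
proof -
  let ?H = "\<lambda>x. G x + of_int k"
  have "(\<lambda>n. ((G ^^ n) 0 - 0) / real n + of_int k) \<longlonglongrightarrow> rotation G + of_int k"
    by (intro tendsto_intros rotation_tendsto[OF assms])
  moreover have "\<forall>\<^sub>F n in sequentially. ((G ^^ n) 0 - 0) / real n + of_int k = ((?H ^^ n) 0 - 0) / real n"
    by (intro eventually_sequentiallyI[of 1]) (simp add: funpow_add_of_int[OF assms(2)] field_simps)
  ultimately have "(\<lambda>n. ((?H ^^ n) 0 - 0) / real n) \<longlonglongrightarrow> rotation G + of_int k"
    using tendsto_cong by fast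
  moreover have "(\<lambda>n. ((?H ^^ n) 0 - 0) / real n) \<longlonglongrightarrow> rotation ?H"
    using assms by (intro rotation_tendsto mono_add_const deg1_add_const)
  ultimately show ?thesis using LIMSEQ_unique by blast
qed

lemma continuous_on_funpow_translate:
  fixes G :: "real \<Rightarrow> real"
  assumes "continuous_on UNIV G" "continuous_on UNIV w" "continuous_on UNIV v"
  shows "continuous_on UNIV (\<lambda>a::real. ((\<lambda>x. G x + v a) ^^ n) (w a))"
proof (induction n)
  case (Suc n)
  show ?case
    by (simp, intro continuous_intros Suc assms(3) continuous_on_compose2[OF assms(1)]) auto
qed (use assms in simp)

text \<open>The error of the \<open>n\<close>-th approximation is at most \<open>1 / n\<close> for
  every \<open>a\<close>, so a uniform limit of continuous functions is at hand.\<close>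

lemma continuous_on_rotation_add:
  assumes "mono G" "deg1 G" "continuous_on UNIV G"
  shows "continuous_on UNIV (\<lambda>a. rotation (\<lambda>x. G x + a))"
proof (rule uniform_limit_theorem[where F=sequentially])
  let ?G = "\<lambda>a x. G x + a"
  show "\<forall>\<^sub>F n in sequentially. continuous_on UNIV (\<lambda>a. (?G a ^^ n) 0 / real n)"
    by (intro always_eventually allI)
       (auto intro!: continuous_intros continuous_on_funpow_translate[OF assms(3)] simp: divide_inverse)
  show "uniform_limit UNIV (\<lambda>n a. (?G a ^^ n) 0 / real n) (\<lambda>a. rotation (?G a)) sequentially"
  proof (rule uniform_limitI)
    fix e :: real assume "e > 0"
    then obtain N :: nat where N: "2 / e < real N" using reals_Archimedean2 by blast
    show "\<forall>\<^sub>F n in sequentially. \<forall>a\<in>UNIV. dist ((?G a ^^ n) 0 / real n) (rotation (?G a)) < e"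
    proof (intro eventually_sequentiallyI[of "max 1 N"] ballI)
      fix n a assume n: "max 1 N \<le> n"
      have "\<bar>(?G a ^^ n) 0 - real n * rotation (?G a)\<bar> \<le> 1"
        using n assms by (intro rotation_bound mono_add_const deg1_add_const) auto
      also have "1 < real n * e"
      proof -
        have "2 / e < real n" using N n by linarith
        then show ?thesis using \<open>e > 0\<close> by (simp add: field_simps)
      qed
      finally have "\<bar>(?G a ^^ n) 0 - real n * rotation (?G a)\<bar> < real n * e" .
      moreover have "(?G a ^^ n) 0 - real n * rotation (?G a) = real n * ((?G a ^^ n) 0 / real n - rotation (?G a))"
        using n by (simp add: field_simps)
      ultimately have "real n * \<bar>(?G a ^^ n) 0 / real n - rotation (?G a)\<bar> < real n * e"
        by (simp add: abs_mult)
      then show "dist ((?G a ^^ n) 0 / real n) (rotation (?G a)) < e"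
        using n by (simp add: dist_real_def)
    qed
  qed
qed simp

lemma rotation_attained:
  assumes "mono G" "deg1 G" "continuous_on UNIV G"
  shows "\<exists>a. rotation (\<lambda>x. G x + a) = r"
proof -
  define k where "k = \<lfloor>r - rotation G\<rfloor>"
  have "rotation (\<lambda>x. G x + of_int k) \<le> r" "r \<le> rotation (\<lambda>x. G x + of_int (k + 1))"
    unfolding rotation_add_of_int[OF assms(1,2)] k_def by linarith+
  then show ?thesis
    using IVT'[of "\<lambda>a. rotation (\<lambda>x. G x + a)" "of_int k" r "of_int (k + 1)"]
      continuous_on_subset[OF continuous_on_rotation_add[OF assms]] by auto
qed

section \<open>Monotone bounds\<close>

text \<open>Lipschitz rather than differentiable, because the monotone bounds inherit the former,
  with the same constant, but not the latter.\<close>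

definition lip_lift :: "real \<Rightarrow> (real \<Rightarrow> real) \<Rightarrow> bool" where
  "lip_lift \<Lambda> F \<longleftrightarrow> deg1 F \<and> (\<forall>x y. \<bar>F x - F y\<bar> \<le> \<Lambda> * \<bar>x - y\<bar>)"

text \<open>Conjugation by the reflection of the line. It exchanges upper and lower bounds, negates
  rotation numbers and turns the right side of a tongue into a left side.\<close>

definition flip :: "(real \<Rightarrow> real) \<Rightarrow> real \<Rightarrow> real" where
  "flip F x = - F (- x)"

lemma flip_flip [simp]: "flip (flip F) = F"
  by (simp add: flip_def fun_eq_iff)

lemma lip_lift_deg1: "lip_lift \<Lambda> F \<Longrightarrow> deg1 F"
  by (simp add: lip_lift_def)

lemma lip_lift_le: "lip_lift \<Lambda> F \<Longrightarrow> \<bar>F x - F y\<bar> \<le> \<Lambda> * \<bar>x - y\<bar>"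
  by (simp add: lip_lift_def)

lemma lip_lift_ge1:
  assumes "lip_lift \<Lambda> F"
  shows "\<Lambda> \<ge> 1"
proof -
  have "F (0 + 1) = F 0 + 1"
    using lip_lift_deg1[OF assms] unfolding deg1_def by blast
  then show ?thesis
    using lip_lift_le[OF assms, of 1 0] by simp
qed

lemma lip_lift_add: "lip_lift \<Lambda> F \<Longrightarrow> lip_lift \<Lambda> (\<lambda>x. F x + a)"
  by (auto simp: lip_lift_def deg1_def)

lemma deg1_flip:
  assumes "deg1 F" shows "deg1 (flip F)"
  unfolding deg1_def flip_def
proof
  fix x
  have "F (- x - of_int 1) = F (- x) - of_int 1"
    by (rule deg1_diff_of_int[OF assms])
  then show "- F (- (x + 1)) = - F (- x) + 1" by simp
qed

lemma lip_lift_flip: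
  assumes "lip_lift \<Lambda> F" shows "lip_lift \<Lambda> (flip F)"
proof -
  have "\<bar>flip F x - flip F y\<bar> \<le> \<Lambda> * \<bar>x - y\<bar>" for x y
    using lip_lift_le[OF assms, of "-y" "-x"] by (simp add: flip_def)
  then show ?thesis using deg1_flip[OF lip_lift_deg1[OF assms]] by (simp add: lip_lift_def)
qed

lemma lip_lift_continuous:
  assumes "lip_lift \<Lambda> F" shows "continuous_on S F"
proof -
  have "\<Lambda>-lipschitz_on UNIV F"
    using lip_lift_le[OF assms] lip_lift_ge1[OF assms]
    by (intro lipschitz_onI) (auto simp: dist_real_def)
  then show ?thesis
    using continuous_on_subset lipschitz_on_continuous_on by blast
qed

lemma flip_funpow: "(flip F ^^ n) x = - (F ^^ n) (- x)"
  by (induction n) (auto simp: flip_def)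

lemma mono_flip: "mono G \<Longrightarrow> mono (flip G)"
  by (auto simp: mono_def flip_def)

lemma rotation_flip:
  assumes "mono G" "deg1 G"
  shows "rotation (flip G) = - rotation G"
proof -
  have "(\<lambda>n. - (((G ^^ n) 0 - 0) / real n)) \<longlonglongrightarrow> - rotation G"
    by (intro tendsto_minus rotation_tendsto assms)
  moreover have "(\<lambda>n. ((flip G ^^ n) 0 - 0) / real n) \<longlonglongrightarrow> rotation (flip G)"
    by (intro rotation_tendsto mono_flip deg1_flip assms)
  ultimately show ?thesis
    by (intro LIMSEQ_unique) (auto simp: flip_funpow)
qed

lemma deg1_attains_max:
  assumes "continuous_on UNIV F" "deg1 F"
  shows "\<exists>y\<in>{x - 1..x}. \<forall>z\<le>x. F z \<le> F y"
proof -
  have "\<exists>y\<in>{x - 1..x}. \<forall>z\<in>{x - 1..x}. F z \<le> F y"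
    using continuous_on_subset[OF assms(1)] by (intro continuous_attains_sup) auto
  then obtain y where y: "y \<in> {x - 1..x}" "\<forall>z\<in>{x - 1..x}. F z \<le> F y" by blast
  have "F z \<le> F y" if "z \<le> x" for z
  proof -
    define m where "m = \<lfloor>x - z\<rfloor>"
    have "z + of_int m \<in> {x - 1..x}" unfolding m_def by (auto, linarith+)
    then have "F (z + of_int m) \<le> F y" using y by blast
    moreover have "of_int m \<ge> (0::real)" unfolding m_def using that by simp
    ultimately show ?thesis using deg1_add_of_int[OF assms(2), of z m] by simp
  qed
  then show ?thesis using y by blast
qed

lemma upper_bound_attained:
  assumes "lip_lift \<Lambda> F"
  shows "\<exists>y\<in>{x - 1..x}. upper_bound F x = F y \<and> (\<forall>z\<le>x. F z \<le> F y)"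
proof -
  obtain y where y: "y \<in> {x - 1..x}" "\<forall>z\<le>x. F z \<le> F y"
    using deg1_attains_max[OF lip_lift_continuous lip_lift_deg1] assms by blast
  then have "upper_bound F x = F y"
    unfolding upper_bound_def by (intro cSup_eq_maximum) auto
  then show ?thesis using y by blast
qed

lemma upper_bound_ge: "lip_lift \<Lambda> F \<Longrightarrow> z \<le> x \<Longrightarrow> F z \<le> upper_bound F x"
  using upper_bound_attained[of \<Lambda> F x] by force

lemma upper_bound_eqI: "lip_lift \<Lambda> F \<Longrightarrow> (\<And>z. z \<le> x \<Longrightarrow> F z \<le> F x) \<Longrightarrow> upper_bound F x = F x"
  using upper_bound_attained[of \<Lambda> F x] by (auto intro!: order_antisym)

lemma mono_upper_bound:
  assumes "lip_lift \<Lambda> F"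
  shows "mono (upper_bound F)"
proof (rule monoI)
  fix x y :: real assume "x \<le> y"
  obtain z where "z \<le> x" "upper_bound F x = F z"
    using upper_bound_attained[OF assms, of x] by auto
  then show "upper_bound F x \<le> upper_bound F y"
    using upper_bound_ge[OF assms, of z y] \<open>x \<le> y\<close> by simp
qed

lemma lip_lift_upper_bound:
  assumes "lip_lift \<Lambda> F"
  shows "lip_lift \<Lambda> (upper_bound F)"
proof -
  have shift: "upper_bound F y \<le> upper_bound F x + \<Lambda> * (y - x)" if xy: "x \<le> y" for x y
  proof -
    obtain z where z: "z \<le> y" "upper_bound F y = F z"
      using upper_bound_attained[OF assms, of y] by auto
    have "F z \<le> F (z - (y - x)) + \<Lambda> * \<bar>z - (z - (y - x))\<bar>"
      using lip_lift_le[OF assms, of z "z - (y - x)"] by linarith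
    also have "\<bar>z - (z - (y - x))\<bar> = y - x" using xy by simp
    also have "F (z - (y - x)) \<le> upper_bound F x"
      using z(1) by (intro upper_bound_ge[OF assms]) simp
    finally show ?thesis using z by simp
  qed
  have lip: "\<bar>upper_bound F x - upper_bound F y\<bar> \<le> \<Lambda> * \<bar>x - y\<bar>" for x y
    using shift[of x y] shift[of y x] monoD[OF mono_upper_bound[OF assms], of x y]
      monoD[OF mono_upper_bound[OF assms], of y x]
    by (cases "x \<le> y") auto
  have "upper_bound F (x + 1) = upper_bound F x + 1" for x
  proof (rule order_antisym)
    obtain z where z: "z \<le> x + 1" "upper_bound F (x + 1) = F z"
      using upper_bound_attained[OF assms, of "x + 1"] by auto
    have "F (z - 1) \<le> upper_bound F x" using z by (intro upper_bound_ge[OF assms]) simp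
    then show "upper_bound F (x + 1) \<le> upper_bound F x + 1"
      using z deg1_diff_of_int[OF lip_lift_deg1[OF assms], of z 1] by simp
    obtain z where z: "z \<le> x" "upper_bound F x = F z"
      using upper_bound_attained[OF assms, of x] by auto
    have "F (z + 1) \<le> upper_bound F (x + 1)" using z by (intro upper_bound_ge[OF assms]) simp
    then show "upper_bound F x + 1 \<le> upper_bound F (x + 1)"
      using z deg1_add_of_int[OF lip_lift_deg1[OF assms], of z 1] by simp
  qed
  then show ?thesis using lip by (simp add: lip_lift_def deg1_def)
qed

lemma lower_bound_flip: "lower_bound F = flip (upper_bound (flip F))"
proof
  fix x
  have "flip F ` {..- x} = uminus ` F ` {x..}"
  proof (intro equalityI subsetI)
    fix v assume "v \<in> flip F ` {..- x}"
    then obtain y where "y \<le> - x" "v = - F (- y)" by (auto simp: flip_def)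
    then show "v \<in> uminus ` F ` {x..}" by (auto intro!: image_eqI[of _ _ "- y"])
  next
    fix v assume "v \<in> uminus ` F ` {x..}"
    then obtain y where "y \<ge> x" "v = - F y" by auto
    then show "v \<in> flip F ` {..- x}" by (intro image_eqI[of _ _ "- y"]) (auto simp: flip_def)
  qed
  then show "lower_bound F x = flip (upper_bound (flip F)) x"
    by (simp add: lower_bound_def upper_bound_def flip_def Inf_real_def)
qed

lemma lower_bound_le:
  assumes "lip_lift \<Lambda> F" "x \<le> z" shows "lower_bound F x \<le> F z"
  using upper_bound_ge[OF lip_lift_flip[OF assms(1)], of "-z" "-x"] assms(2)
  by (simp add: lower_bound_flip) (simp add: flip_def)

lemma lower_bound_eqI:
  assumes "lip_lift \<Lambda> F" "\<And>z. x \<le> z \<Longrightarrow> F x \<le> F z" shows "lower_bound F x = F x"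
proof -
  have "upper_bound (flip F) (- x) = flip F (- x)"
    using assms(2) by (intro upper_bound_eqI[OF lip_lift_flip[OF assms(1)]]) (auto simp: flip_def)
  then show ?thesis by (simp add: lower_bound_flip) (simp add: flip_def)
qed

lemma mono_lower_bound: "lip_lift \<Lambda> F \<Longrightarrow> mono (lower_bound F)"
  unfolding lower_bound_flip by (intro mono_flip mono_upper_bound[OF lip_lift_flip])

lemma lip_lift_lower_bound: "lip_lift \<Lambda> F \<Longrightarrow> lip_lift \<Lambda> (lower_bound F)"
  unfolding lower_bound_flip by (intro lip_lift_flip lip_lift_upper_bound)

lemma lower_le_upper: "lip_lift \<Lambda> F \<Longrightarrow> lower_bound F x \<le> upper_bound F x"
  using lower_bound_le[of \<Lambda> F x x] upper_bound_ge[of \<Lambda> F x x] by simp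

lemma rotation_lower_flip:
  assumes "lip_lift \<Lambda> F"
  shows "rotation (lower_bound F) = - rotation (upper_bound (flip F))"
  unfolding lower_bound_flip
  using assms by (intro rotation_flip mono_upper_bound lip_lift_deg1 lip_lift_upper_bound lip_lift_flip)

lemma upper_bound_add:
  assumes "lip_lift \<Lambda> F"
  shows "upper_bound (\<lambda>x. F x + a) = (\<lambda>x. upper_bound F x + a)"
proof
  fix x
  obtain y where "y \<in> {x - 1..x}" "upper_bound F x = F y" "\<forall>z\<le>x. F z \<le> F y"
    using upper_bound_attained[OF assms, of x] by blast
  then show "upper_bound (\<lambda>x. F x + a) x = upper_bound F x + a"
    unfolding upper_bound_def[of "\<lambda>x. F x + a"] by (intro cSup_eq_maximum) auto
qed

lemma flip_add: "flip (\<lambda>x. F x + a) = (\<lambda>x. flip F x - a)"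
  by (auto simp: flip_def)

lemma lower_bound_add:
  assumes "lip_lift \<Lambda> F"
  shows "lower_bound (\<lambda>x. F x + a) = (\<lambda>x. lower_bound F x + a)"
  using upper_bound_add[OF lip_lift_flip[OF assms], of "-a"]
  by (simp only: lower_bound_flip flip_add diff_conv_add_uminus) (simp add: flip_def)

lemma upper_bound_close:
  assumes "lip_lift \<Lambda> F" "lip_lift \<Lambda>' F'" "\<And>x. F' x \<le> F x + d"
  shows "upper_bound F' x \<le> upper_bound F x + d"
proof -
  obtain y where "y \<le> x" "upper_bound F' x = F' y"
    using upper_bound_attained[OF assms(2), of x] by auto
  then show ?thesis
    using upper_bound_ge[OF assms(1), of y x] assms(3)[of y] by simp
qed

text \<open>Take the leftmost \<open>x\<close> with \<open>v \<le> upper_bound F x\<close>. The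
  supremum is attained at some \<open>y \<le> x\<close>, and \<open>y < x\<close> would contradict
  minimality. Such points allow backward orbits common to \<open>F\<close> and its upper
  bound.\<close>

lemma upper_bound_surj_tight:
  assumes "lip_lift \<Lambda> F"
  shows "\<exists>x. upper_bound F x = v \<and> F x = v"
proof -
  let ?U = "upper_bound F"
  note U = lip_lift_upper_bound[OF assms]
  define S where "S = {x. v \<le> ?U x}"
  have cont: "continuous_on UNIV ?U" by (rule lip_lift_continuous[OF U])
  have eq: "?U (of_int m) = ?U 0 + of_int m" for m
    using deg1_add_of_int[OF lip_lift_deg1[OF U], of 0 m] by simp
  have "closed S"
    unfolding S_def by (intro closed_Collect_le continuous_intros cont)
  have ne: "S \<noteq> {}"
    using eq[of "\<lceil>v - ?U 0\<rceil>"] unfolding S_def by (auto intro!: exI[of _ "of_int \<lceil>v - ?U 0\<rceil>"]) linarith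
  have bdd: "bdd_below S"
  proof (rule bdd_belowI)
    fix x assume "x \<in> S"
    show "of_int (\<lfloor>v - ?U 0\<rfloor> - 1) \<le> x"
    proof (rule ccontr)
      assume "\<not> ?thesis"
      then have "?U x \<le> ?U (of_int (\<lfloor>v - ?U 0\<rfloor> - 1))"
        by (intro monoD[OF mono_upper_bound[OF assms]]) simp
      also have "\<dots> < v" unfolding eq by simp linarith
      finally show False using \<open>x \<in> S\<close> by (simp add: S_def)
    qed
  qed
  define x where "x = Inf S"
  have "x \<in> S" unfolding x_def using ne bdd \<open>closed S\<close> by (rule closed_contains_Inf)
  have low: "?U y < v" if "y < x" for y
    using cInf_lower[OF _ bdd, of y] that unfolding x_def S_def by fastforce
  have "?U x \<le> v"
  proof (rule ccontr)
    assume "\<not> ?thesis"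
    then have d: "0 < (?U x - v) / \<Lambda>" using lip_lift_ge1[OF assms] by simp
    \<comment> \<open>Going left by the excess divided by \<Lambda> still leaves the value at least
      \<open>v\<close>.\<close>
    define y where "y = x - (?U x - v) / \<Lambda>"
    have "?U x - ?U y \<le> \<Lambda> * \<bar>x - y\<bar>"
      using lip_lift_le[OF U, of x y] by linarith
    also have "\<dots> = ?U x - v" using d lip_lift_ge1[OF assms] by (simp add: y_def zero_less_divide_iff)
    finally show False using low[of y] d by (simp add: y_def)
  qed
  then have x: "?U x = v" using \<open>x \<in> S\<close> by (simp add: S_def)
  obtain y where y: "y \<le> x" "?U x = F y"
    using upper_bound_attained[OF assms, of x] by auto
  have "v \<le> ?U y"
    using upper_bound_ge[OF assms, of y y] x y by simp
  then have "y = x" using low[of y] y by linarith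
  then show ?thesis using x y by auto
qed

text \<open>Compactness yields an orbit of \<open>F\<close> that is also an orbit of its upper
  bound: the points whose first \<open>n\<close> steps agree form decreasing closed sets, nonempty
  because an agreeing orbit segment can be built backwards from any end point.\<close>

lemma rotation_upper_in_Rot:
  assumes "lip_lift \<Lambda> F"
  shows "rotation (upper_bound F) \<in> Rot F"
proof -
  let ?U = "upper_bound F"
  note U = lip_lift_upper_bound[OF assms]
  have contU: "continuous_on UNIV (?U ^^ i)" for i
  proof (induction i)
    case (Suc i)
    then show ?case
      using continuous_on_compose2[OF lip_lift_continuous[OF U, of UNIV] Suc] by (simp add: comp_def)
  qed (simp add: id_def)
  have contU': "continuous_on UNIV (\<lambda>x. ?U ((?U ^^ i) x))" "continuous_on UNIV (\<lambda>x. F ((?U ^^ i) x))" for i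
    using continuous_on_compose2[OF lip_lift_continuous[OF U, of UNIV] contU[of i]]
      continuous_on_compose2[OF lip_lift_continuous[OF assms, of UNIV] contU[of i]] by auto
  define A where "A n = {x. \<forall>i<n. ?U ((?U ^^ i) x) = F ((?U ^^ i) x)}" for n
  have ex: "\<exists>x\<in>A n. (?U ^^ n) x = v" for n v
  proof (induction n arbitrary: v)
    case (Suc n)
    obtain w where w: "?U w = v" "F w = v" using upper_bound_surj_tight[OF assms] by blast
    obtain x where "x \<in> A n" "(?U ^^ n) x = w" using Suc by blast
    then show ?case using w by (intro bexI[of _ x]) (auto simp: A_def less_Suc_eq)
  qed (simp add: A_def)
  define B where "B n = A n \<inter> {0..1}" for n
  have "B n \<noteq> {}" for n
  proof -
    obtain x where x: "x \<in> A n" using ex by blast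
    have "x - of_int \<lfloor>x\<rfloor> \<in> A n"
      using x deg1_diff_of_int[OF deg1_funpow[OF lip_lift_deg1[OF U]]]
        deg1_diff_of_int[OF lip_lift_deg1[OF U]] deg1_diff_of_int[OF lip_lift_deg1[OF assms]]
      by (simp add: A_def)
    then have "x - of_int \<lfloor>x\<rfloor> \<in> B n"
      unfolding B_def by (auto, linarith)
    then show ?thesis by blast
  qed
  moreover have "compact (B n)" for n
  proof -
    have "A n = (\<Inter>i\<in>{..<n}. {x. ?U ((?U ^^ i) x) = F ((?U ^^ i) x)})"
      by (auto simp: A_def)
    then have "closed (A n)"
      by (auto intro!: closed_INT closed_Collect_eq contU')
    then show ?thesis unfolding B_def by (intro closed_Int_compact) auto
  qed
  moreover have "B n \<subseteq> B m" if "m \<le> n" for m n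
    using that unfolding A_def B_def by auto
  ultimately have "\<Inter> (range B) \<noteq> {}"
    by (intro compact_nest) blast+
  then obtain x where x: "x \<in> B n" for n by blast
  have tight: "?U ((?U ^^ i) x) = F ((?U ^^ i) x)" for i
    using x[of "Suc i"] unfolding A_def B_def by auto
  have "(F ^^ n) x = (?U ^^ n) x" for n
    by (induction n) (auto simp: tight)
  then have "(\<lambda>m. ((F ^^ m) x - x) / real m) \<longlonglongrightarrow> rotation ?U"
    using rotation_tendsto[OF mono_upper_bound[OF assms] lip_lift_deg1[OF U], of x] by simp
  then show ?thesis
    unfolding Rot_def by blast
qed

lemma Rot_flip: "r \<in> Rot (flip F) \<longleftrightarrow> - r \<in> Rot F"
proof -
  have "- r \<in> Rot F" if "r \<in> Rot (flip F)" for r F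
  proof -
    from that obtain x where "(\<lambda>m. ((flip F ^^ m) x - x) / real m) \<longlonglongrightarrow> r"
      unfolding Rot_def by auto
    from tendsto_minus[OF this] have "(\<lambda>m. ((F ^^ m) (- x) - (- x)) / real m) \<longlonglongrightarrow> - r"
      by (simp add: flip_funpow minus_divide_left algebra_simps)
    then show ?thesis unfolding Rot_def by blast
  qed
  from this[of r F] this[of "- r" "flip F"] show ?thesis by auto
qed

lemma rotation_lower_in_Rot:
  assumes "lip_lift \<Lambda> F"
  shows "rotation (lower_bound F) \<in> Rot F"
  using rotation_upper_in_Rot[OF lip_lift_flip[OF assms]]
  by (simp add: Rot_flip rotation_lower_flip[OF assms])

lemma Rot_le_upper:
  assumes "lip_lift \<Lambda> F" "r \<in> Rot F"
  shows "r \<le> rotation (upper_bound F)"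
proof -
  obtain x where x: "(\<lambda>m. ((F ^^ m) x - x) / real m) \<longlonglongrightarrow> r"
    using assms unfolding Rot_def by auto
  have "(F ^^ n) x \<le> (upper_bound F ^^ n) x" for n
    by (rule mono_le_funpow[OF mono_upper_bound[OF assms(1)]]) (simp add: upper_bound_ge[OF assms(1)])
  then show ?thesis
    by (intro LIMSEQ_le[OF x rotation_tendsto[of _ x]] mono_upper_bound[OF assms(1)]
        lip_lift_deg1[OF lip_lift_upper_bound[OF assms(1)]])
       (auto intro!: divide_right_mono)
qed

lemma Rot_ge_lower:
  assumes "lip_lift \<Lambda> F" "r \<in> Rot F"
  shows "rotation (lower_bound F) \<le> r"
  using Rot_le_upper[OF lip_lift_flip[OF assms(1)], of "- r"] assms
  by (simp add: Rot_flip rotation_lower_flip[OF assms(1)])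

lemma Rot_singleton_iff:
  assumes "lip_lift \<Lambda> F"
  shows "(\<exists>r. Rot F = {r}) \<longleftrightarrow> rotation (lower_bound F) = rotation (upper_bound F)"
proof
  assume "\<exists>r. Rot F = {r}"
  then show "rotation (lower_bound F) = rotation (upper_bound F)"
    using rotation_lower_in_Rot[OF assms] rotation_upper_in_Rot[OF assms] by auto
next
  assume eq: "rotation (lower_bound F) = rotation (upper_bound F)"
  have "Rot F = {rotation (upper_bound F)}"
    using Rot_le_upper[OF assms] Rot_ge_lower[OF assms] rotation_upper_in_Rot[OF assms] eq
    by (auto intro!: order_antisym)
  then show "\<exists>r. Rot F = {r}" by blast
qed

section \<open>Irrational rotation numbers\<close>

lemma irrational_orbit_dense:
  fixes \<rho> s t :: real
  assumes "\<rho> \<notin> \<rat>" "s < t"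
  obtains n :: nat and m :: int where "n \<ge> N" "s < real n * \<rho> + of_int m" "real n * \<rho> + of_int m < t"
proof -
  have "(t - s) / 2 > 0" using assms by simp
  \<comment> \<open>The target is shifted by \<open>N * \<rho>\<close>, so that adding
    \<open>N\<close> to the index found puts it beyond \<open>N\<close>.\<close>
  then obtain h k where hk: "k > 0" "\<bar>of_int k * \<rho> - of_int h - ((s + t) / 2 - real N * \<rho>)\<bar> < (t - s) / 2"
    using sequence_of_fractional_parts_is_dense[OF assms(1)] by metis
  have "real (N + nat k) * \<rho> + of_int (- h) = of_int k * \<rho> - of_int h + real N * \<rho>"
    using hk(1) by (simp add: algebra_simps)
  then show ?thesis
    using hk by (intro that[of "N + nat k" "- h"]) (auto simp: abs_less_iff field_simps)
qed

lemma irrational_orbit_neq: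
  fixes \<rho> :: real
  assumes "\<rho> \<notin> \<rat>" "n \<noteq> k"
  shows "real n * \<rho> + of_int m \<noteq> real k * \<rho> + of_int j"
proof
  assume "real n * \<rho> + of_int m = real k * \<rho> + of_int j"
  then have "\<rho> = (of_int j - of_int m) / (real n - real k)"
    using assms(2) by (simp add: field_simps)
  then have "\<rho> \<in> \<rat>" by simp
  then show False using assms by simp
qed

text \<open>The orbit of 0 and its integer translates are ordered like the orbit of the rotation by
  \<rho>: between two times \<open>F\<close> moves a point at most as far as the upper bound does
  and at least as far as the lower bound, and both have rotation number \<rho>. Extending this
  correspondence by suprema gives \<open>h\<close>; density of the rotation orbit makes it
  continuous and of degree one.\<close>

theorem irrational_semiconjugacy:
  assumes F: "lip_lift \<Lambda> F"
    and L: "rotation (lower_bound F) = \<rho>" and U: "rotation (upper_bound F) = \<rho>" and irr: "\<rho> \<notin> \<rat>"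
  obtains h where "mono h" "deg1 h" "continuous_on UNIV h" "\<And>x. h (F x) = h x + \<rho>"
proof -
  define V where "V n m = (F ^^ n) 0 + of_int m" for n and m :: int
  define v where "v n m = real n * \<rho> + of_int m" for n and m :: int
  note Um = mono_upper_bound[OF F] and Lm = mono_lower_bound[OF F]
  note Ud = lip_lift_deg1[OF lip_lift_upper_bound[OF F]] and Ld = lip_lift_deg1[OF lip_lift_lower_bound[OF F]]
  have FU: "(F ^^ n) x \<le> (upper_bound F ^^ n) x" for n x
    by (rule mono_le_funpow[OF Um]) (simp add: upper_bound_ge[OF F])
  have LF: "(lower_bound F ^^ n) x \<le> (F ^^ n) x" for n x
    by (rule mono_ge_funpow[OF Lm]) (simp add: lower_bound_le[OF F])
  have ord: "v n m \<le> v k j" if "V n m \<le> V k j" for n m k j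
  proof (cases "n \<le> k")
    case True
    define y where "y = (F ^^ n) 0"
    have "(F ^^ k) 0 = (F ^^ (k - n)) y"
      using True unfolding y_def by (metis add.commute comp_apply funpow_add le_add_diff_inverse)
    then have "y + of_int (m - j) \<le> (upper_bound F ^^ (k - n)) y"
      using that FU[of "k - n" y] by (simp add: V_def y_def)
    from rotation_ge[OF Um Ud this] show ?thesis
      using True U by (simp add: v_def of_nat_diff algebra_simps)
  next
    case False
    define y where "y = (F ^^ k) 0"
    have "(F ^^ n) 0 = (F ^^ (n - k)) y"
      using False unfolding y_def by (metis add.commute comp_apply funpow_add le_add_diff_inverse nat_le_linear)
    then have "(lower_bound F ^^ (n - k)) y \<le> y + of_int (j - m)"
      using that LF[of "n - k" y] by (simp add: V_def y_def)
    from rotation_le[OF Lm Ld this] show ?thesis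
      using False L by (simp add: v_def of_nat_diff algebra_simps)
  qed
  define h where "h x = Sup {v n m | n m. V n m \<le> x}" for x
  have ne: "{v n m | n m. V n m \<le> x} \<noteq> {}" for x
  proof -
    have "V 0 \<lfloor>x\<rfloor> \<le> x" by (simp add: V_def)
    then show ?thesis by blast
  qed
  have bdd: "bdd_above {v n m | n m. V n m \<le> x}" for x
  proof (rule bdd_aboveI)
    fix w assume "w \<in> {v n m | n m. V n m \<le> x}"
    then obtain n m where nm: "w = v n m" "V n m \<le> x" by blast
    have "V 0 \<lceil>x\<rceil> = of_int \<lceil>x\<rceil>" by (simp add: V_def)
    then have "V n m \<le> V 0 \<lceil>x\<rceil>" using nm(2) le_of_int_ceiling[of x] by linarith
    then show "w \<le> v 0 \<lceil>x\<rceil>" using ord nm by blast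
  qed
  have low: "v n m \<le> h x" if "V n m \<le> x" for n m x
    unfolding h_def using that by (intro cSup_upper bdd) blast
  have up: "h x \<le> v n m" if "x \<le> V n m" for n m x
    unfolding h_def using ne[of x] that ord by (intro cSup_least) (auto dest: order_trans)
  have hV: "h (V n m) = v n m" for n m
    using low[of n m "V n m"] up[of "V n m" n m] by simp
  have low': "V n m < x" if "v n m < h x" for n m x
    using up[of x n m] that by force
  have up': "x < V n m" if "h x < v n m" for n m x
    using low[of n m x] that by force
  have mono: "mono h"
    unfolding h_def by (intro monoI cSup_subset_mono ne bdd) (blast intro: order_trans)
  have V1: "V n (m + 1) = V n m + 1" and v1: "v n (m + 1) = v n m + 1" for n m
    by (auto simp: V_def v_def)
  have pick: "\<exists>n\<ge>N. \<exists>m. s < v n m \<and> v n m < t" if "s < t" for N s t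
    using irrational_orbit_dense[OF irr that, of N] unfolding v_def by metis
  have deg: "deg1 h"
    unfolding deg1_def
  proof
    fix x
    show "h (x + 1) = h x + 1"
    proof (rule ccontr)
      assume "h (x + 1) \<noteq> h x + 1"
      then consider "h (x + 1) < h x + 1" | "h x + 1 < h (x + 1)" by linarith
      then show False
      proof cases
        case 1
        then obtain n m where nm: "h (x + 1) < v n m" "v n m < h x + 1" using pick by blast
        then have "x + 1 < V n m" "V n (m - 1) < x"
          using up' low'[of n "m - 1" x] v1[of n "m - 1"] by auto
        then show False using V1[of n "m - 1"] by simp
      next
        case 2
        then obtain n m where nm: "h x + 1 < v n m" "v n m < h (x + 1)" using pick by blast
        then have "V n m < x + 1" "x < V n (m - 1)"
          using low' up'[of x n "m - 1"] v1[of n "m - 1"] by auto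
        then show False using V1[of n "m - 1"] by simp
      qed
    qed
  qed
  have cont: "continuous_on UNIV h"
    unfolding continuous_on_iff
  proof (intro ballI allI impI)
    fix x e :: real assume "e > 0"
    obtain n m where nm: "h x - e < v n m" "v n m < h x" using pick[of "h x - e" "h x" 0] \<open>e > 0\<close> by auto
    obtain k j where kj: "h x < v k j" "v k j < h x + e" using pick[of "h x" "h x + e" 0] \<open>e > 0\<close> by auto
    have x: "V n m < x" "x < V k j" using low'[OF nm(2)] up'[OF kj(1)] by auto
    show "\<exists>d>0. \<forall>x'\<in>UNIV. dist x' x < d \<longrightarrow> dist (h x') (h x) < e"
    proof (intro exI[of _ "min (x - V n m) (V k j - x)"] conjI ballI impI)
      fix y assume "dist y x < min (x - V n m) (V k j - x)"
      then have "V n m \<le> y" "y \<le> V k j" by (auto simp: dist_real_def)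
      then have "v n m \<le> h y" "h y \<le> v k j" using low up by blast+
      then show "dist (h y) (h x) < e" using nm kj by (auto simp: dist_real_def)
    qed (use x in auto)
  qed
  have FV: "F (V n m) = V (Suc n) m" for n m
    using deg1_add_of_int[OF lip_lift_deg1[OF F]] by (simp add: V_def)
  have FVn: "(F ^^ k) (V n m) = V (k + n) m" for k n m
    by (induction k) (auto simp: FV)
  have vk: "v (k + n) (m + j) = v n m + (real k * \<rho> + of_int j)" for k n m j
    by (simp add: v_def algebra_simps)
  \<comment> \<open>If \<open>F\<close> moved \<open>x\<close> too little, an orbit of \<open>lower_bound F\<close> started at \<open>x\<close> would return
    below \<open>x\<close> too late for the rotation number \<open>\<rho>\<close>.\<close>
  have semi: "h (F x) = h x + \<rho>" for x
  proof (rule ccontr)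
    assume "h (F x) \<noteq> h x + \<rho>"
    then consider "h (F x) < h x + \<rho>" | "h x + \<rho> < h (F x)" by linarith
    then show False
    proof cases
      case 1
      then obtain k j where kj: "h (F x) - \<rho> < v k j" "v k j < h x" using pick[of "h (F x) - \<rho>" "h x" 0] by auto
      have vS: "v (Suc k) j = v k j + \<rho>" by (simp add: v_def algebra_simps)
      have "F x < F (V k j)" using kj vS by (simp add: FV up')
      obtain n m where nm: "0 < v n m" "v n m < h x - v k j" "n \<ge> 1"
        using pick[of 0 "h x - v k j" 1] kj by auto
      obtain n' where n': "n = Suc n'" using nm by (cases n) auto
      have "V (n + k) (m + j) < x"
        using nm vk[of n k j m] by (intro low') (simp add: v_def algebra_simps)
      moreover have "(lower_bound F ^^ n) x \<le> (F ^^ n) (V k j)"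
      proof -
        have "(lower_bound F ^^ n) x = (lower_bound F ^^ n') (lower_bound F x)"
          by (simp add: n' funpow_swap1)
        also have "\<dots> \<le> (lower_bound F ^^ n') (F (V k j))"
          using lower_bound_le[OF F, of x x] \<open>F x < F (V k j)\<close>
          by (intro monoD[OF mono_funpow'[OF Lm]]) simp
        also have "\<dots> \<le> (F ^^ n') (F (V k j))" by (rule LF)
        finally show ?thesis by (simp add: n' funpow_swap1)
      qed
      moreover have "(F ^^ n) (V k j) + of_int m = V (n + k) (m + j)"
        unfolding FVn by (simp add: V_def)
      ultimately have "(lower_bound F ^^ n) x \<le> x + of_int (- m)" by simp
      from rotation_le[OF Lm Ld this] show False using nm(1) L by (simp add: v_def)
    next
      case 2
      then obtain k j where kj: "h x < v k j" "v k j < h (F x) - \<rho>" using pick[of "h x" "h (F x) - \<rho>" 0] by auto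
      have vS: "v (Suc k) j = v k j + \<rho>" by (simp add: v_def algebra_simps)
      have "F (V k j) < F x" using kj vS by (simp add: FV low')
      obtain n m where nm: "h x - v k j < v n m" "v n m < 0" "n \<ge> 1"
        using pick[of "h x - v k j" 0 1] kj by auto
      obtain n' where n': "n = Suc n'" using nm by (cases n) auto
      have "x < V (n + k) (m + j)"
        using nm vk[of n k j m] by (intro up') (simp add: v_def algebra_simps)
      moreover have "(F ^^ n) (V k j) \<le> (upper_bound F ^^ n) x"
      proof -
        have "(F ^^ n) (V k j) = (F ^^ n') (F (V k j))" by (simp add: n' funpow_swap1)
        also have "\<dots> \<le> (upper_bound F ^^ n') (F (V k j))" by (rule FU)
        also have "\<dots> \<le> (upper_bound F ^^ n') (upper_bound F x)"
          using upper_bound_ge[OF F, of x x] \<open>F (V k j) < F x\<close>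
          by (intro monoD[OF mono_funpow'[OF Um]]) simp
        finally show ?thesis by (simp add: n' funpow_swap1)
      qed
      moreover have "(F ^^ n) (V k j) + of_int m = V (n + k) (m + j)"
        unfolding FVn by (simp add: V_def)
      ultimately have "x + of_int (- m) \<le> (upper_bound F ^^ n) x" by simp
      from rotation_ge[OF Um Ud this] show False using nm(2) U by (simp add: v_def)
    qed
  qed
  show ?thesis by (rule that[OF mono deg cont semi])
qed

section \<open>Negative Schwarzian derivative\<close>

text \<open>\<open>\<phi>\<close> is \<open>1 / sqrt (G')\<close>, and \<open>\<phi>'' = - S(G) \<phi> / 2\<close>. In this form the chain rule
  for the Schwarzian needs no third derivatives of composites.\<close>

definition convex_distortion_on :: "(real \<Rightarrow> real) \<Rightarrow> real set \<Rightarrow> (real \<Rightarrow> real) \<Rightarrow> bool" where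
  "convex_distortion_on G I \<phi> \<longleftrightarrow> (\<exists>\<phi>' \<phi>''. \<forall>x\<in>I. \<phi> x > 0 \<and>
     (G has_real_derivative 1 / (\<phi> x)\<^sup>2) (at x) \<and> (\<phi> has_real_derivative \<phi>' x) (at x) \<and>
     (\<phi>' has_real_derivative \<phi>'' x) (at x) \<and> \<phi>'' x \<ge> 0)"

lemma convex_distortion_pos: "convex_distortion_on G I \<phi> \<Longrightarrow> x \<in> I \<Longrightarrow> \<phi> x > 0"
  by (auto simp: convex_distortion_on_def)

lemma convex_distortion_deriv:
  "convex_distortion_on G I \<phi> \<Longrightarrow> x \<in> I \<Longrightarrow> (G has_real_derivative 1 / (\<phi> x)\<^sup>2) (at x)"
  by (auto simp: convex_distortion_on_def)

lemma convex_distortion_convex: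
  assumes "convex_distortion_on G I \<phi>" "convex I"
  shows "convex_on I \<phi>"
proof -
  obtain \<phi>' \<phi>'' where "\<forall>x\<in>I. (\<phi> has_real_derivative \<phi>' x) (at x) \<and>
     (\<phi>' has_real_derivative \<phi>'' x) (at x) \<and> \<phi>'' x \<ge> 0"
    using assms(1) unfolding convex_distortion_on_def by blast
  then show ?thesis
    using assms(2) by (intro f''_ge0_imp_convex[of I \<phi> \<phi>' \<phi>'']) auto
qed

lemma convex_distortion_id: "convex_distortion_on (\<lambda>x. x) I (\<lambda>x. 1)"
  unfolding convex_distortion_on_def
  by (intro exI[of _ "\<lambda>x. 0"]) (auto intro!: derivative_eq_intros)

text \<open>Since \<open>H' = 1 / (\<psi> x)^2\<close>, the two cross terms in the second derivative
  of the product cancel and only nonnegative terms remain. So convexity passes to iterates.\<close>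

lemma convex_distortion_compose:
  assumes "convex_distortion_on G J \<phi>" "convex_distortion_on H I \<psi>" "H ` I \<subseteq> J"
  shows "convex_distortion_on (\<lambda>x. G (H x)) I (\<lambda>x. \<phi> (H x) * \<psi> x)"
proof -
  obtain \<phi>' \<phi>'' where \<phi>: "\<forall>x\<in>J. \<phi> x > 0 \<and>
     (G has_real_derivative 1 / (\<phi> x)\<^sup>2) (at x) \<and> (\<phi> has_real_derivative \<phi>' x) (at x) \<and>
     (\<phi>' has_real_derivative \<phi>'' x) (at x) \<and> \<phi>'' x \<ge> 0"
    using assms(1) unfolding convex_distortion_on_def by blast
  obtain \<psi>' \<psi>'' where \<psi>: "\<forall>x\<in>I. \<psi> x > 0 \<and>
     (H has_real_derivative 1 / (\<psi> x)\<^sup>2) (at x) \<and> (\<psi> has_real_derivative \<psi>' x) (at x) \<and>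
     (\<psi>' has_real_derivative \<psi>'' x) (at x) \<and> \<psi>'' x \<ge> 0"
    using assms(2) unfolding convex_distortion_on_def by blast
  show ?thesis
    unfolding convex_distortion_on_def
  proof (rule exI[of _ "\<lambda>x. \<phi>' (H x) / \<psi> x + \<phi> (H x) * \<psi>' x"],
      rule exI[of _ "\<lambda>x. \<phi>'' (H x) / (\<psi> x)^3 + \<phi> (H x) * \<psi>'' x"], intro ballI conjI)
    fix x assume x: "x \<in> I"
    then have Hx: "H x \<in> J" using assms(3) by blast
    have pos: "\<phi> (H x) > 0" "\<psi> x > 0" "\<phi>'' (H x) \<ge> 0" "\<psi>'' x \<ge> 0" using \<phi> \<psi> x Hx by auto
    have dH: "(H has_real_derivative 1 / (\<psi> x)\<^sup>2) (at x)" and d\<psi>: "(\<psi> has_real_derivative \<psi>' x) (at x)"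
      and d\<psi>': "(\<psi>' has_real_derivative \<psi>'' x) (at x)"
      using \<psi> x by auto
    have dG: "((\<lambda>x. G (H x)) has_real_derivative 1 / (\<phi> (H x))\<^sup>2 * (1 / (\<psi> x)\<^sup>2)) (at x)"
      and d\<phi>: "((\<lambda>x. \<phi> (H x)) has_real_derivative \<phi>' (H x) * (1 / (\<psi> x)\<^sup>2)) (at x)"
      and d\<phi>': "((\<lambda>x. \<phi>' (H x)) has_real_derivative \<phi>'' (H x) * (1 / (\<psi> x)\<^sup>2)) (at x)"
      using \<phi> Hx DERIV_chain2[OF _ dH] by blast+
    show "\<phi> (H x) * \<psi> x > 0" using pos by simp
    show "((\<lambda>x. G (H x)) has_real_derivative 1 / (\<phi> (H x) * \<psi> x)\<^sup>2) (at x)"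
      using dG by (simp add: power_mult_distrib)
    show "((\<lambda>x. \<phi> (H x) * \<psi> x) has_real_derivative \<phi>' (H x) / \<psi> x + \<phi> (H x) * \<psi>' x) (at x)"
      by (rule derivative_eq_intros d\<phi> d\<psi> refl)+ (use pos in \<open>simp add: field_simps power2_eq_square\<close>)
    show "((\<lambda>x. \<phi>' (H x) / \<psi> x + \<phi> (H x) * \<psi>' x) has_real_derivative
        \<phi>'' (H x) / (\<psi> x)^3 + \<phi> (H x) * \<psi>'' x) (at x)"
    proof -
      have "((\<lambda>x. \<phi>' (H x) / \<psi> x + \<phi> (H x) * \<psi>' x) has_real_derivative
        (\<phi>'' (H x) * (1 / (\<psi> x)\<^sup>2) * \<psi> x - \<phi>' (H x) * \<psi>' x) / (\<psi> x * \<psi> x) +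
        (\<phi>' (H x) * (1 / (\<psi> x)\<^sup>2) * \<psi>' x + \<psi>'' x * \<phi> (H x))) (at x)"
        using pos by (intro DERIV_add DERIV_divide DERIV_mult d\<phi> d\<phi>' d\<psi> d\<psi>') auto
      moreover have "(\<phi>'' (H x) * (1 / (\<psi> x)\<^sup>2) * \<psi> x - \<phi>' (H x) * \<psi>' x) / (\<psi> x * \<psi> x) +
        (\<phi>' (H x) * (1 / (\<psi> x)\<^sup>2) * \<psi>' x + \<psi>'' x * \<phi> (H x)) =
        \<phi>'' (H x) / (\<psi> x)^3 + \<phi> (H x) * \<psi>'' x"
        using pos by (simp add: field_simps power2_eq_square power3_eq_cube)
      ultimately show ?thesis by (rule DERIV_cong)
    qed
    show "0 \<le> \<phi>'' (H x) / (\<psi> x)^3 + \<phi> (H x) * \<psi>'' x"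
      using pos by simp
  qed
qed

lemma convex_distortion_flip:
  assumes "convex_distortion_on G I \<phi>"
  shows "convex_distortion_on (flip G) (uminus ` I) (\<lambda>x. \<phi> (- x))"
proof -
  obtain \<phi>' \<phi>'' where \<phi>: "\<forall>x\<in>I. \<phi> x > 0 \<and>
     (G has_real_derivative 1 / (\<phi> x)\<^sup>2) (at x) \<and> (\<phi> has_real_derivative \<phi>' x) (at x) \<and>
     (\<phi>' has_real_derivative \<phi>'' x) (at x) \<and> \<phi>'' x \<ge> 0"
    using assms(1) unfolding convex_distortion_on_def by blast
  show ?thesis
    unfolding convex_distortion_on_def
  proof (rule exI[of _ "\<lambda>x. - \<phi>' (- x)"], rule exI[of _ "\<lambda>x. \<phi>'' (- x)"], intro ballI conjI)
    fix x assume "x \<in> uminus ` I"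
    then have x: "- x \<in> I" by auto
    have m: "(uminus has_real_derivative - 1) (at x)" by (auto intro!: derivative_eq_intros)
    show "\<phi> (- x) > 0" "\<phi>'' (- x) \<ge> 0" using \<phi> x by auto
    have "((\<lambda>x. G (- x)) has_real_derivative 1 / (\<phi> (- x))\<^sup>2 * (- 1)) (at x)"
      using \<phi> x by (intro DERIV_chain2[OF _ m]) auto
    from DERIV_minus[OF this] show "(flip G has_real_derivative 1 / (\<phi> (- x))\<^sup>2) (at x)"
      by (simp add: flip_def[abs_def])
    have "((\<lambda>x. \<phi> (- x)) has_real_derivative \<phi>' (- x) * (- 1)) (at x)"
      using \<phi> x by (intro DERIV_chain2[OF _ m]) auto
    then show "((\<lambda>x. \<phi> (- x)) has_real_derivative - \<phi>' (- x)) (at x)" by simp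
    have "((\<lambda>x. \<phi>' (- x)) has_real_derivative \<phi>'' (- x) * (- 1)) (at x)"
      using \<phi> x by (intro DERIV_chain2[OF _ m]) auto
    from DERIV_minus[OF this] show "((\<lambda>x. - \<phi>' (- x)) has_real_derivative \<phi>'' (- x)) (at x)"
      by simp
  qed
qed

lemma neg_schwarzian_convex_distortion:
  assumes d1: "\<And>x. (F has_real_derivative F1 x) (at x)" and d2: "\<And>x. (F1 has_real_derivative F2 x) (at x)"
    and d3: "\<And>x. (F2 has_real_derivative F3 x) (at x)"
    and S: "\<And>x. F1 x \<noteq> 0 \<Longrightarrow> F3 x / F1 x - 3 / 2 * (F2 x / F1 x)\<^sup>2 < 0"
    and pos: "\<And>x. x \<in> I \<Longrightarrow> F1 x > 0"
  shows "convex_distortion_on F I (\<lambda>x. 1 / sqrt (F1 x))"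
  unfolding convex_distortion_on_def
proof (rule exI[of _ "\<lambda>x. - F2 x / (2 * F1 x * sqrt (F1 x))"],
    rule exI[of _ "\<lambda>x. - 1 / 2 * (F3 x / F1 x - 3 / 2 * (F2 x / F1 x)\<^sup>2) / sqrt (F1 x)"],
    intro ballI conjI)
  fix x assume x: "x \<in> I"
  then have p: "F1 x > 0" by (rule pos)
  then obtain s where s: "F1 x = s * s" "s > 0" "sqrt (F1 x) = s"
    by (metis real_sqrt_gt_zero real_sqrt_mult_self abs_of_pos)
  have ds: "((\<lambda>x. sqrt (F1 x)) has_real_derivative F2 x / (2 * s)) (at x)"
    using DERIV_chain2[OF DERIV_real_sqrt[OF p] d2] s by (simp add: field_simps)
  show "0 < 1 / sqrt (F1 x)" using p by simp
  show "(F has_real_derivative 1 / (1 / sqrt (F1 x))\<^sup>2) (at x)"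
    using d1[of x] p by (simp add: power_divide)
  show "((\<lambda>x. 1 / sqrt (F1 x)) has_real_derivative - F2 x / (2 * F1 x * sqrt (F1 x))) (at x)"
    by (rule derivative_eq_intros ds refl)+ (use s in \<open>auto simp: field_simps\<close>)
  show "((\<lambda>x. - F2 x / (2 * F1 x * sqrt (F1 x))) has_real_derivative
      - 1 / 2 * (F3 x / F1 x - 3 / 2 * (F2 x / F1 x)\<^sup>2) / sqrt (F1 x)) (at x)"
    by (rule derivative_eq_intros ds d2 d3 refl)+
      (use s in \<open>auto simp: field_simps power2_eq_square\<close>)
  show "0 \<le> - 1 / 2 * (F3 x / F1 x - 3 / 2 * (F2 x / F1 x)\<^sup>2) / sqrt (F1 x)"
    using less_imp_le[OF S[of x]] p by (intro divide_nonneg_pos mult_nonpos_nonpos) auto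
qed

text \<open>When the image of the middle interval is no longer than either neighbouring image, the
  two side lengths cannot have a small product. By the mean value theorem \<open>\<phi>\<close> is
  at most \<open>sqrt (l / X)\<close> somewhere left of \<open>u\<close> and at most
  \<open>sqrt ((z' - v) / X)\<close> somewhere right of \<open>v\<close>. If the claim failed,
  convexity would force \<open>\<phi> t < 2 * sqrt (l / X)\<close>, and \<open>G\<close> would rise
  on \<open>{u..u + 4 * l}\<close> by more than its whole rise \<open>X\<close> on
  \<open>{u..v}\<close>.\<close>

lemma koebe_space_left:
  assumes cd: "convex_distortion_on G {z<..<z'} \<phi>" and cont: "continuous_on {z..z'} G"
    and z: "z < u" "u < v" "v < z'"
    and left: "G v - G u \<le> G u - G z" and right: "G v - G u \<le> G z' - G v"
    and small: "4 * (u - z) < v - u"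
  shows "(v - u)\<^sup>2 \<le> 25 * (u - z) * (z' - v)"
proof (rule ccontr)
  assume "\<not> ?thesis"
  then have neg: "25 * (u - z) * (z' - v) < (v - u)\<^sup>2" by simp
  define X where "X = G v - G u"
  define l where "l = u - z"
  note pos = convex_distortion_pos[OF cd] and der = convex_distortion_deriv[OF cd]
  have mvt: "\<exists>s. a < s \<and> s < b \<and> G b - G a = (b - a) / (\<phi> s)\<^sup>2" if ab: "z \<le> a" "a < b" "b \<le> z'" for a b
  proof -
    have "\<exists>l s. a < s \<and> s < b \<and> (G has_real_derivative l) (at s) \<and> G b - G a = (b - a) * l"
    proof (rule MVT[OF ab(2)])
      show "continuous_on {a..b} G" using cont ab by (auto intro: continuous_on_subset)
      fix s assume "a < s" "s < b"
      then show "G differentiable (at s)"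
        using der[of s] ab by (auto simp: real_differentiable_def)
    qed
    then obtain l s where s: "a < s" "s < b" "(G has_real_derivative l) (at s)" "G b - G a = (b - a) * l" by blast
    then have "l = 1 / (\<phi> s)\<^sup>2" using der[of s] ab DERIV_unique by auto
    then show ?thesis using s by auto
  qed
  obtain t0 where t0: "u < t0" "t0 < v" "X = (v - u) / (\<phi> t0)\<^sup>2" using mvt[of u v] z unfolding X_def by auto
  have X0: "X > 0" using t0 z pos[of t0] by (simp)
  obtain s where s: "z < s" "s < u" "G u - G z = l / (\<phi> s)\<^sup>2" using mvt[of z u] z by (auto simp: l_def)
  obtain w where w: "v < w" "w < z'" "G z' - G v = (z' - v) / (\<phi> w)\<^sup>2" using mvt[of v z'] z by auto
  have ps: "\<phi> s > 0" "\<phi> w > 0" using pos s w z by auto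
  have l0: "l > 0" using z by (simp add: l_def)
  have s2: "(\<phi> s)\<^sup>2 \<le> l / X" proof -
    have "X \<le> l / (\<phi> s)\<^sup>2" using s left by (simp add: X_def)
    then show ?thesis using X0 ps by (simp add: field_simps)
  qed
  have w2: "(\<phi> w)\<^sup>2 \<le> (z' - v) / X" proof -
    have "X \<le> (z' - v) / (\<phi> w)\<^sup>2" using w right by (simp add: X_def)
    then show ?thesis using X0 ps by (simp add: field_simps)
  qed
  have bs: "\<phi> s \<le> sqrt (l / X)" using s2 ps by (simp add: real_le_rsqrt)
  have bw: "\<phi> w \<le> sqrt ((z' - v) / X)" using w2 ps by (simp add: real_le_rsqrt)
  \<comment> \<open>The negated claim as it is used below: the share of \<open>w\<close> in the
    convex combination stays under \<open>sqrt (l / X)\<close>. The factor 5 bounds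
    \<open>t - s\<close>, which is less than \<open>l + 4 * l\<close>; its square is the 25 of the
    statement.\<close>
  have k: "5 * l / (v - u) * sqrt ((z' - v) / X) < sqrt (l / X)"
  proof -
    have "(5 * l / (v - u) * sqrt ((z' - v) / X))\<^sup>2 = (l / X) * ((25 * l * (z' - v)) / (v - u)\<^sup>2)"
      using z X0 by (simp add: power_mult_distrib power_divide field_simps power2_eq_square)
    also have "\<dots> < (l / X) * 1"
      using neg l0 X0 z by (intro mult_strict_left_mono) (auto simp: l_def)
    finally have "(5 * l / (v - u) * sqrt ((z' - v) / X))\<^sup>2 < l / X" by simp
    then show ?thesis using real_less_rsqrt by blast
  qed
  obtain t where t: "u < t" "t < u + 4 * l" "G (u + 4 * l) - G u = 4 * l / (\<phi> t)\<^sup>2"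
    using mvt[of u "u + 4 * l"] z small l0 by (auto simp: l_def)
  have "v - u \<le> w - s" using s w by simp
  define lam where "lam = (t - s) / (w - s)"
  have ws: "w - s > 0" using s w z by simp
  have lam: "0 \<le> lam" "lam \<le> 5 * l / (v - u)" "lam \<le> 1"
  proof -
    show "0 \<le> lam" using s t ws by (simp add: lam_def)
    have "t - s \<le> 5 * l" using s t by (simp add: l_def)
    then show "lam \<le> 5 * l / (v - u)" unfolding lam_def
      using \<open>v - u \<le> w - s\<close> z s t by (intro frac_le) auto
    show "lam \<le> 1" unfolding lam_def using ws t w small by (simp add: l_def)
  qed
  have "\<phi> ((1 - lam) *\<^sub>R s + lam *\<^sub>R w) \<le> (1 - lam) * \<phi> s + lam * \<phi> w"
    using lam s w z by (intro convex_onD[OF convex_distortion_convex[OF cd]]) auto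
  moreover have "(1 - lam) *\<^sub>R s + lam *\<^sub>R w = t"
  proof -
    have "lam * (w - s) = t - s" using ws by (simp add: lam_def)
    then show ?thesis by (simp add: algebra_simps)
  qed
  ultimately have "\<phi> t \<le> (1 - lam) * \<phi> s + lam * \<phi> w" by simp
  also have "\<dots> \<le> sqrt (l / X) + 5 * l / (v - u) * sqrt ((z' - v) / X)"
  proof (rule add_mono)
    have "(1 - lam) * \<phi> s \<le> 1 * \<phi> s" using lam ps by (intro mult_right_mono) auto
    then show "(1 - lam) * \<phi> s \<le> sqrt (l / X)" using bs by simp
    show "lam * \<phi> w \<le> 5 * l / (v - u) * sqrt ((z' - v) / X)"
      using lam ps bw by (intro mult_mono) auto
  qed
  also have "\<dots> < 2 * sqrt (l / X)" using k by simp
  finally have "\<phi> t < 2 * sqrt (l / X)" .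
  moreover have pt: "\<phi> t > 0" using t z small by (intro pos) (auto simp: l_def)
  ultimately have "(\<phi> t)\<^sup>2 < (2 * sqrt (l / X))\<^sup>2" by (intro power_strict_mono) auto
  also have "\<dots> = 4 * l / X" using l0 X0 by (simp add: power_mult_distrib)
  finally have "X < 4 * l / (\<phi> t)\<^sup>2" using X0 pt by (simp add: field_simps)
  moreover obtain t' where "G v - G (u + 4 * l) = (v - (u + 4 * l)) / (\<phi> t')\<^sup>2"
    using mvt[of "u + 4 * l" v] z small l0 by (auto simp: l_def)
  moreover have "0 \<le> (v - (u + 4 * l)) / (\<phi> t')\<^sup>2"
    using small by (intro divide_nonneg_nonneg) (auto simp: l_def)
  ultimately show False using t unfolding X_def by linarith
qed

lemma koebe_space_right:
  assumes cd: "convex_distortion_on G {z<..<z'} \<phi>" and cont: "continuous_on {z..z'} G"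
    and z: "z < u" "u < v" "v < z'"
    and left: "G v - G u \<le> G u - G z" and right: "G v - G u \<le> G z' - G v"
    and small: "4 * (z' - v) < v - u"
  shows "(v - u)\<^sup>2 \<le> 25 * (u - z) * (z' - v)"
proof -
  have "(- u - (- v))\<^sup>2 \<le> 25 * (- v - (- z')) * (- z - (- u))"
  proof (rule koebe_space_left[of "flip G"])
    show "convex_distortion_on (flip G) {- z'<..<- z} (\<lambda>x. \<phi> (- x))"
      using convex_distortion_flip[OF cd] by simp
    show "continuous_on {- z'..- z} (flip G)"
      unfolding flip_def[abs_def]
      by (intro continuous_intros continuous_on_compose2[OF cont]) auto
  qed (use z left right small in \<open>auto simp: flip_def\<close>)
  then show ?thesis by (simp add: algebra_simps)
qed

section \<open>Bimodal lifts and their iterates\<close>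

lemma deg1_deriv_add_of_int:
  assumes F: "deg1 F" and d1: "\<And>x. (F has_real_derivative F1 x) (at x)"
  shows "F1 (x + of_int m) = F1 x"
proof -
  have "((\<lambda>x. F (x + of_int m)) has_real_derivative F1 (x + of_int m)) (at x)"
    using DERIV_shift[of F "F1 (x + of_int m)" x "of_int m"] d1 by simp
  then have "((\<lambda>x. F x + of_int m) has_real_derivative F1 (x + of_int m)) (at x)"
    by (simp add: deg1_add_of_int[OF F])
  moreover have "((\<lambda>x. F x + of_int m) has_real_derivative F1 x) (at x)"
    by (auto intro!: derivative_eq_intros d1)
  ultimately show ?thesis using DERIV_unique by blast
qed

text \<open>\<open>C\<close> is the maximum and \<open>K\<close> the minimum in one period. The
  derivatives are parameters, so that translates and reflections instantiate the locale with
  explicit formulas.\<close>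

locale bimodal_lift =
  fixes F F1 F2 F3 :: "real \<Rightarrow> real" and C K \<Lambda> :: real
  assumes lift: "lip_lift \<Lambda> F"
    and d1: "\<And>x. (F has_real_derivative F1 x) (at x)"
    and d2: "\<And>x. (F1 has_real_derivative F2 x) (at x)"
    and d3: "\<And>x. (F2 has_real_derivative F3 x) (at x)"
    and CK: "C < K" "K < C + 1"
    and crit: "F1 C = 0" "F1 K = 0"
    and neg: "\<And>x. C < x \<Longrightarrow> x < K \<Longrightarrow> F1 x < 0"
    and pos: "\<And>x. K < x \<Longrightarrow> x < C + 1 \<Longrightarrow> F1 x > 0"
    and schw: "\<And>x. F1 x \<noteq> 0 \<Longrightarrow> F3 x / F1 x - 3 / 2 * (F2 x / F1 x)\<^sup>2 < 0"
begin

lemma contF: "continuous_on S F"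
  by (rule lip_lift_continuous[OF lift])

lemma contF1: "continuous_on S F1"
  using d2 by (intro DERIV_continuous_on) (auto intro: has_field_derivative_at_within)

lemma F_int: "F (x + of_int m) = F x + of_int m"
  by (rule deg1_add_of_int[OF lip_lift_deg1[OF lift]])

lemma Fn_int: "(F ^^ n) (x + of_int m) = (F ^^ n) x + of_int m"
  by (rule deg1_add_of_int[OF deg1_funpow[OF lip_lift_deg1[OF lift]]])

lemma F1_int: "F1 (x + of_int m) = F1 x"
  by (rule deg1_deriv_add_of_int[OF lip_lift_deg1[OF lift] d1])

lemma F1_nonpos:
  assumes "F1 x \<le> 0"
  obtains m :: int where "C + of_int m \<le> x" "x \<le> K + of_int m"
proof -
  define m where "m = \<lfloor>x - C\<rfloor>"
  have m: "C \<le> x - of_int m" "x - of_int m < C + 1" unfolding m_def by linarith+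
  have "F1 (x - of_int m) \<le> 0" using assms F1_int[of "x - of_int m" m] by simp
  then have "x - of_int m \<le> K" using pos[of "x - of_int m"] m by force
  then show ?thesis using m by (intro that[of m]) auto
qed

lemma F1_zero:
  assumes "F1 x = 0"
  obtains m :: int where "x = C + of_int m \<or> x = K + of_int m"
proof -
  obtain m :: int where m: "C + of_int m \<le> x" "x \<le> K + of_int m"
    by (rule F1_nonpos[of x]) (simp add: assms)
  have "F1 (x - of_int m) = 0" using F1_int[of "x - of_int m" m] assms by simp
  then have "\<not> (C < x - of_int m \<and> x - of_int m < K)" using neg[of "x - of_int m"] by auto
  then show ?thesis using m by (intro that[of m]) auto
qed

lemma Fn_deriv: "((F ^^ n) has_real_derivative (\<Prod>i<n. F1 ((F ^^ i) x))) (at x)"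
proof (induction n)
  case 0
  then show ?case by (simp add: id_def)
next
  case (Suc n)
  have "((\<lambda>x. F ((F ^^ n) x)) has_real_derivative F1 ((F ^^ n) x) * (\<Prod>i<n. F1 ((F ^^ i) x))) (at x)"
    by (rule DERIV_chain2[OF d1 Suc])
  then show ?case by (simp add: comp_def mult.commute)
qed

lemma contFn: "continuous_on S (F ^^ n)"
  using Fn_deriv by (intro DERIV_continuous_on) (auto intro: has_field_derivative_at_within)

lemma Fn_strict_mono:
  assumes "a < b" "\<And>x i. a < x \<Longrightarrow> x < b \<Longrightarrow> i < n \<Longrightarrow> F1 ((F ^^ i) x) > 0"
  shows "(F ^^ n) a < (F ^^ n) b"
proof (rule DERIV_pos_imp_increasing_open[OF assms(1)])
  fix x assume "a < x" "x < b"
  then have "0 < (\<Prod>i<n. F1 ((F ^^ i) x))" using assms(2)[of x] by (intro prod_pos) auto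
  then show "\<exists>y. ((F ^^ n) has_real_derivative y) (at x) \<and> 0 < y" using Fn_deriv by blast
qed (rule contFn)

lemma Fn_distortion:
  assumes "\<And>x i. x \<in> I \<Longrightarrow> i < n \<Longrightarrow> F1 ((F ^^ i) x) > 0"
  shows "\<exists>\<phi>. convex_distortion_on (F ^^ n) I \<phi>"
  using assms
proof (induction n)
  case 0
  then show ?case using convex_distortion_id[of I] by (auto simp: id_def)
next
  case (Suc n)
  then obtain \<phi> where \<phi>: "convex_distortion_on (F ^^ n) I \<phi>" by fastforce
  have "convex_distortion_on F ((F ^^ n) ` I) (\<lambda>x. 1 / sqrt (F1 x))"
    using Suc.prems by (intro neg_schwarzian_convex_distortion[OF d1 d2 d3 schw]) auto
  from convex_distortion_compose[OF this \<phi>] show ?case by (auto simp: comp_def)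
qed

lemma F_CK: "F K < F C"
  using DERIV_neg_imp_decreasing_open[OF CK(1), of F] d1 neg contF by blast

end

section \<open>Semiconjugacy to an irrational rotation and its wandering fibre\<close>

locale irrational_bimodal_lift = bimodal_lift +
  fixes h :: "real \<Rightarrow> real" and \<rho> :: real
  assumes h_mono: "mono h" and h_deg: "deg1 h" and h_cont: "continuous_on UNIV h"
    and h_semi: "\<And>x. h (F x) = h x + \<rho>" and irr: "\<rho> \<notin> \<rat>"
begin

lemma h_int: "h (x + of_int m) = h x + of_int m"
  by (rule deg1_add_of_int[OF h_deg])

lemma h_Fn: "h ((F ^^ n) x) = h x + real n * \<rho>"
  by (induction n) (auto simp: h_semi algebra_simps)

lemma h_less: "h x < h y \<Longrightarrow> x < y"
  using monoD[OF h_mono, of y x] by force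

text \<open>The fold reverses the order of \<open>C\<close> and \<open>K\<close>, while
  \<open>h\<close> is monotone and turns \<open>F\<close> into a translation; so \<open>h\<close>
  has to collapse \<open>{C..K}\<close>.\<close>

lemma h_C_K: "h C = h K"
proof (rule order_antisym)
  show "h C \<le> h K" using CK by (intro monoD[OF h_mono]) simp
  have "h (F K) \<le> h (F C)" using F_CK by (intro monoD[OF h_mono]) simp
  then show "h K \<le> h C" by (simp add: h_semi)
qed

text \<open>The common value of \<open>h\<close> at the two critical values.\<close>

definition t1 where "t1 = h C + \<rho>"

text \<open>The fibre of \<open>h\<close> over \<open>t1\<close> is a compact interval
  \<open>{\<alpha>..\<beta>}\<close>. It contains both critical values, so it is
  nondegenerate.\<close>

lemma fiber: "\<exists>\<alpha> \<beta>. h \<alpha> = t1 \<and> h \<beta> = t1 \<and> \<alpha> \<le> F K \<and> F C \<le> \<beta> \<and>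
  (\<forall>x<\<alpha>. h x < t1) \<and> (\<forall>x>\<beta>. t1 < h x)"
proof -
  define S where "S = {x. h x = t1}"
  have S: "closed S" unfolding S_def using h_cont by (intro closed_Collect_eq) auto
  have FKS: "F K \<in> S" and FCS: "F C \<in> S" using h_C_K by (auto simp: S_def t1_def h_semi)
  have b: "x \<in> {F K - 1..F K + 1}" if "x \<in> S" for x
  proof -
    have "h (F K - 1) < h x" "h x < h (F K + 1)"
      using that FKS h_int[of "F K" "-1"] h_int[of "F K" 1] by (auto simp: S_def)
    then show ?thesis using h_less by force
  qed
  have bdd: "bdd_below S" "bdd_above S" using b by (meson atLeastAtMost_iff bdd_below.I bdd_above.I)+
  have in1: "Inf S \<in> S" and in2: "Sup S \<in> S"
    using closed_contains_Inf[OF _ bdd(1) S] closed_contains_Sup[OF _ bdd(2) S] FKS by auto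
  have "h x < t1" if "x < Inf S" for x
  proof -
    have "x \<notin> S" using cInf_lower[OF _ bdd(1), of x] that by force
    moreover have "h x \<le> h (Inf S)" using that by (intro monoD[OF h_mono]) simp
    ultimately show ?thesis using in1 by (auto simp: S_def)
  qed
  moreover have "t1 < h x" if "x > Sup S" for x
  proof -
    have "x \<notin> S" using cSup_upper[OF _ bdd(2), of x] that by force
    moreover have "h (Sup S) \<le> h x" using that by (intro monoD[OF h_mono]) simp
    ultimately show ?thesis using in2 by (auto simp: S_def)
  qed
  moreover have "Inf S \<le> F K" "F C \<le> Sup S"
    using cInf_lower[OF FKS bdd(1)] cSup_upper[OF FCS bdd(2)] by auto
  ultimately show ?thesis using in1 in2 unfolding S_def by blast
qed

lemma crit_h:
  assumes "F1 x \<le> 0"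
  obtains m :: int where "h x = h C + of_int m"
proof -
  obtain m :: int where m: "C + of_int m \<le> x" "x \<le> K + of_int m"
    by (rule F1_nonpos[of x]) (simp add: assms)
  have "h (C + of_int m) \<le> h x" "h x \<le> h (K + of_int m)" using m by (auto intro: monoD[OF h_mono])
  then show ?thesis using h_C_K by (intro that[of m]) (simp add: h_int)
qed

text \<open>A critical point met at a later time would bring the rotation orbit of
  \<open>h C\<close> back to \<open>h C\<close> modulo 1.\<close>

lemma fiber_regular:
  assumes "h x = t1 + real j * \<rho> + of_int m"
  shows "F1 ((F ^^ i) x) > 0"
proof (rule ccontr)
  assume "\<not> ?thesis"
  then obtain k :: int where "h ((F ^^ i) x) = h C + of_int k"
    using crit_h[of "(F ^^ i) x"] by (metis not_less)
  then have "real (Suc (i + j)) * \<rho> + of_int m = real 0 * \<rho> + of_int k"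
    using assms by (simp add: h_Fn t1_def algebra_simps)
  then show False using irrational_orbit_neq[OF irr, of "Suc (i + j)" 0 m k] by simp
qed

text \<open>The ends \<open>z\<close> and \<open>z'\<close> of the monotone branch of
  \<open>F ^^ n\<close> around the fibre pass through a minimum and a maximum, so their images are
  earlier iterates of critical values, up to integers. These lie in other fibres, and at a record
  time \<open>n\<close> the space on both sides of the fibre's image therefore exceeds
  \<open>\<mu> n\<close>. The space estimates then contradict that \<open>z\<close> and
  \<open>z'\<close> are within \<eta> of the fibre.\<close>

lemma contradiction: False
proof -
  obtain \<alpha> \<beta> where ab: "h \<alpha> = t1" "h \<beta> = t1" "\<alpha> \<le> F K" "F C \<le> \<beta>"
    and below: "\<And>x. x < \<alpha> \<Longrightarrow> h x < t1" and above: "\<And>x. x > \<beta> \<Longrightarrow> t1 < h x" using fiber by blast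
  have hFC: "h (F C) = t1" and hFK: "h (F K) = t1" using h_C_K by (auto simp: t1_def h_semi)
  have order: "\<alpha> < F C" "F K < \<beta>" "\<alpha> < \<beta>" using ab F_CK by auto
  have hfib: "h x = t1" if "\<alpha> \<le> x" "x \<le> \<beta>" for x
    using monoD[OF h_mono that(1)] monoD[OF h_mono that(2)] ab by simp
  have reg: "F1 ((F ^^ i) x) > 0" if "\<alpha> \<le> x" "x \<le> \<beta>" for x i
    using fiber_regular[of x 0 0 i] hfib[OF that] by simp
  have inc: "(F ^^ n) x < (F ^^ n) y" if "\<alpha> \<le> x" "x < y" "y \<le> \<beta>" for x y n
    using that by (intro Fn_strict_mono reg) auto
  \<comment> \<open>Two overlapping pieces of the fibre, each with one end at a critical value. The
    left end of a branch is a preimage of \<open>K\<close>, and the space there contains an iterate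
    of the piece measured by \<open>Y\<close>; the right end is a preimage of \<open>C\<close>, with
    an iterate of the piece measured by \<open>X\<close>.\<close>
  define X where "X j = (F ^^ j) (F C) - (F ^^ j) \<alpha>" for j
  define Y where "Y j = (F ^^ j) \<beta> - (F ^^ j) (F K)" for j
  define \<mu> where "\<mu> j = min (X j) (Y j)" for j
  have mu0: "\<mu> j > 0" for j
    unfolding \<mu>_def X_def Y_def using inc[of \<alpha> "F C" j] inc[of "F K" \<beta> j] ab order by auto
  \<comment> \<open>The rotation orbit of \<open>t1\<close> returns, modulo 1, just left of
    \<open>t1\<close>; the image of the piece at that time is squeezed between
    \<open>\<alpha> - e\<close> and \<alpha>.\<close>
  have small: "\<exists>j. \<mu> j < e" if "e > 0" for e
  proof -
    have "h (\<alpha> - e) < t1" using below[of "\<alpha> - e"] that by simp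
    then obtain j and m :: int where jm: "h (\<alpha> - e) - t1 < real j * \<rho> + of_int m" "real j * \<rho> + of_int m < 0"
      using irrational_orbit_dense[OF irr, of "h (\<alpha> - e) - t1" 0] by (metis diff_less_0_iff_less)
    have "h ((F ^^ j) \<alpha> + of_int m) = t1 + (real j * \<rho> + of_int m)"
      "h ((F ^^ j) (F C) + of_int m) = t1 + (real j * \<rho> + of_int m)"
      using ab hFC by (auto simp: h_int h_Fn)
    then have "\<alpha> - e < (F ^^ j) \<alpha> + of_int m" "(F ^^ j) (F C) + of_int m < \<alpha>"
      using jm ab h_less[of "\<alpha> - e" "(F ^^ j) \<alpha> + of_int m"] h_less[of "(F ^^ j) (F C) + of_int m" \<alpha>]
      by auto
    then have "X j < e" unfolding X_def by simp
    then show ?thesis unfolding \<mu>_def by (intro exI[of _ j]) simp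
  qed
  \<comment> \<open>The first time that \<mu> drops below its minimum over \<open>{..N}\<close> is a
    strict record later than \<open>N\<close>.\<close>
  have record_times: "\<exists>n>N. \<forall>j<n. \<mu> n < \<mu> j" for N
  proof -
    define e where "e = Min (\<mu> ` {..N})"
    have e: "e > 0" "\<And>j. j \<le> N \<Longrightarrow> e \<le> \<mu> j" unfolding e_def using mu0 by auto
    define n where "n = (LEAST j. \<mu> j < e)"
    have n: "\<mu> n < e" unfolding n_def using small[OF e(1)] by (rule LeastI_ex)
    have "e \<le> \<mu> j" if "j < n" for j
      using not_less_Least[of j "\<lambda>j. \<mu> j < e"] that unfolding n_def by simp
    moreover have "N < n" using n e(2)[of n] by force
    ultimately show ?thesis using n by (intro exI[of _ n]) force
  qed
  define B where "B = \<beta> - \<alpha> + 1"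
  \<comment> \<open>The entries with 8 provide the smallness hypotheses of the space estimates,
    those with \<open>50 * B\<close> contradict their conclusions. \<open>B\<close> bounds the
    length of the far side because \<open>\<eta> < 1\<close>.\<close>
  define \<eta> where "\<eta> = Min {1/2, (F C - \<alpha>) / 8, (\<beta> - F K) / 8, (F C - \<alpha>)\<^sup>2 / (50 * B), (\<beta> - F K)\<^sup>2 / (50 * B)}"
  have B: "B > 0" using order by (simp add: B_def)
  have eta0: "\<eta> > 0" unfolding \<eta>_def using order B by simp
  have "\<eta> \<le> 1/2" "\<eta> \<le> (F C - \<alpha>) / 8" "\<eta> \<le> (\<beta> - F K) / 8"
    "\<eta> \<le> (F C - \<alpha>)\<^sup>2 / (50 * B)" "\<eta> \<le> (\<beta> - F K)\<^sup>2 / (50 * B)"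
    unfolding \<eta>_def by (rule Min_le; simp)+
  then have "\<eta> < 1" "4 * \<eta> < F C - \<alpha>" "4 * \<eta> < \<beta> - F K"
    "\<eta> * (50 * B) \<le> (F C - \<alpha>)\<^sup>2" "\<eta> * (50 * B) \<le> (\<beta> - F K)\<^sup>2"
    using eta0 order B by (simp_all add: pos_le_divide_eq)
  moreover have "25 * \<eta> * B < \<eta> * (50 * B)" using eta0 B by simp
  ultimately have eta: "\<eta> < 1" "4 * \<eta> < F C - \<alpha>" "4 * \<eta> < \<beta> - F K"
    "25 * \<eta> * B < (F C - \<alpha>)\<^sup>2" "25 * \<eta> * B < (\<beta> - F K)\<^sup>2"
    by linarith+
  have contFi: "continuous_on S (\<lambda>x. F1 ((F ^^ i) x))" for S i
    by (rule continuous_on_compose2[OF contF1[of UNIV] contFn]) simp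
  \<comment> \<open>The index \<open>k\<close> is chosen so that a translate of \<open>K\<close>
    falls between the images of \<open>\<alpha> - \<eta>\<close> and \<alpha>;
    \<open>h (\<alpha> - \<eta>) < t1\<close> leaves room for it on the rotation side.\<close>
  have crit_left: "\<exists>k. \<exists>x. \<alpha> - \<eta> \<le> x \<and> x \<le> \<alpha> \<and> F1 ((F ^^ k) x) = 0"
  proof -
    have "h (\<alpha> - \<eta>) < t1" using below[of "\<alpha> - \<eta>"] eta0 by simp
    then obtain k and m :: int where km: "h C - t1 < real k * \<rho> + of_int m" "real k * \<rho> + of_int m < h C - h (\<alpha> - \<eta>)"
      using irrational_orbit_dense[OF irr, of "h C - t1" "h C - h (\<alpha> - \<eta>)" 0] by auto
    have hK: "h (K + of_int (- m)) = h C - of_int m" using h_C_K h_int[of K "- m"] by simp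
    have "(F ^^ k) (\<alpha> - \<eta>) < K + of_int (- m)"
      by (rule h_less, unfold hK h_Fn) (use km ab in linarith)
    moreover have "K + of_int (- m) < (F ^^ k) \<alpha>"
      by (rule h_less, unfold hK h_Fn) (use km ab in linarith)
    ultimately obtain x where "\<alpha> - \<eta> \<le> x" "x \<le> \<alpha>" "(F ^^ k) x = K + of_int (- m)"
      using IVT'[of "F ^^ k" "\<alpha> - \<eta>" "K + of_int (- m)" \<alpha>] eta0 contFn by force
    then show ?thesis using F1_int[of K "- m"] crit by (intro exI[of _ k] exI[of _ x]) simp
  qed
  have crit_right: "\<exists>k. \<exists>x. \<beta> \<le> x \<and> x \<le> \<beta> + \<eta> \<and> F1 ((F ^^ k) x) = 0"
  proof -
    have "t1 < h (\<beta> + \<eta>)" using above[of "\<beta> + \<eta>"] eta0 by simp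
    then obtain k and m :: int where km: "h C - h (\<beta> + \<eta>) < real k * \<rho> + of_int m" "real k * \<rho> + of_int m < h C - t1"
      using irrational_orbit_dense[OF irr, of "h C - h (\<beta> + \<eta>)" "h C - t1" 0] by auto
    have hK: "h (K + of_int (- m)) = h C - of_int m" using h_C_K h_int[of K "- m"] by simp
    have "(F ^^ k) \<beta> < K + of_int (- m)"
      by (rule h_less, unfold hK h_Fn) (use km ab in linarith)
    moreover have "K + of_int (- m) < (F ^^ k) (\<beta> + \<eta>)"
      by (rule h_less, unfold hK h_Fn) (use km ab in linarith)
    ultimately obtain x where "\<beta> \<le> x" "x \<le> \<beta> + \<eta>" "(F ^^ k) x = K + of_int (- m)"
      using IVT'[of "F ^^ k" \<beta> "K + of_int (- m)" "\<beta> + \<eta>"] eta0 contFn by force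
    then show ?thesis using F1_int[of K "- m"] crit by (intro exI[of _ k] exI[of _ x]) simp
  qed
  obtain k1 x1 where x1: "\<alpha> - \<eta> \<le> x1" "x1 \<le> \<alpha>" "F1 ((F ^^ k1) x1) = 0" using crit_left by blast
  obtain k2 x2 where x2: "\<beta> \<le> x2" "x2 \<le> \<beta> + \<eta>" "F1 ((F ^^ k2) x2) = 0" using crit_right by blast
  obtain n where n: "max k1 k2 < n" "\<And>j. j < n \<Longrightarrow> \<mu> n < \<mu> j" using record_times by blast
  define Z where "Z = (\<Union>i<n. {x. F1 ((F ^^ i) x) = 0})"
  have Zc: "closed Z" unfolding Z_def
    by (intro closed_UN ballI closed_Collect_eq contFi continuous_on_const finite_lessThan)
  define z where "z = Sup (Z \<inter> {\<alpha> - \<eta>..\<alpha>})"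
  define z' where "z' = Inf (Z \<inter> {\<beta>..\<beta> + \<eta>})"
  have x1Z: "x1 \<in> Z \<inter> {\<alpha> - \<eta>..\<alpha>}" and x2Z: "x2 \<in> Z \<inter> {\<beta>..\<beta> + \<eta>}" using x1 x2 n by (auto simp: Z_def)
  then have ne: "Z \<inter> {\<alpha> - \<eta>..\<alpha>} \<noteq> {}" "Z \<inter> {\<beta>..\<beta> + \<eta>} \<noteq> {}" by blast+
  have cl: "closed (Z \<inter> {\<alpha> - \<eta>..\<alpha>})" "closed (Z \<inter> {\<beta>..\<beta> + \<eta>})" using Zc by auto
  have bd: "bdd_above (Z \<inter> {\<alpha> - \<eta>..\<alpha>})" "bdd_below (Z \<inter> {\<beta>..\<beta> + \<eta>})" by auto
  have zin: "z \<in> Z" "\<alpha> - \<eta> \<le> z" "z \<le> \<alpha>"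
    using closed_contains_Sup[OF ne(1) bd(1) cl(1)] unfolding z_def by auto
  have zin': "z' \<in> Z" "\<beta> \<le> z'" "z' \<le> \<beta> + \<eta>"
    using closed_contains_Inf[OF ne(2) bd(2) cl(2)] unfolding z'_def by auto
  have regZ: "x \<notin> Z" if "\<alpha> \<le> x" "x \<le> \<beta>" for x
    using reg[OF that] unfolding Z_def by (auto simp: less_le)
  have zlt: "z < \<alpha>" "\<beta> < z'" using regZ[of \<alpha>] regZ[of \<beta>] zin zin' order by (auto simp: less_le)
  have noZ: "x \<notin> Z" if x: "z < x" "x < z'" for x
  proof
    assume "x \<in> Z"
    then consider "x < \<alpha>" | "x > \<beta>" using regZ[of x] by force
    then show False
    proof cases
      case 1
      then have "x \<le> z" unfolding z_def using x zin \<open>x \<in> Z\<close> by (intro cSup_upper bd) auto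
      then show False using x by simp
    next
      case 2
      then have "z' \<le> x" unfolding z'_def using x zin' \<open>x \<in> Z\<close> by (intro cInf_lower bd) auto
      then show False using x by simp
    qed
  qed
  have Tpos: "F1 ((F ^^ i) x) > 0" if x: "z < x" "x < z'" and i: "i < n" for x i
  proof (rule ccontr)
    assume "\<not> ?thesis"
    then have nx: "F1 ((F ^^ i) x) \<le> 0" by simp
    have pa: "F1 ((F ^^ i) \<alpha>) \<ge> 0" using reg[of \<alpha> i] order by simp
    have "\<exists>y. z < y \<and> y < z' \<and> F1 ((F ^^ i) y) = 0"
    proof (cases "x \<le> \<alpha>")
      case True
      obtain y where "x \<le> y" "y \<le> \<alpha>" "F1 ((F ^^ i) y) = 0" using IVT'[OF nx pa True contFi] by auto
      then show ?thesis using x order zlt by (intro exI[of _ y]) auto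
    next
      case False
      then have "\<alpha> \<le> x" by simp
      then obtain y where "\<alpha> \<le> y" "y \<le> x" "F1 ((F ^^ i) y) = 0" using IVT2'[OF nx pa _ contFi] by auto
      then show ?thesis using x order zlt by (intro exI[of _ y]) auto
    qed
    then show False using noZ i unfolding Z_def by blast
  qed
  have incl: "(F ^^ i) x < (F ^^ i) y" if "z \<le> x" "x < y" "y \<le> z'" "i \<le> n" for x y i
    using that by (intro Fn_strict_mono Tpos) auto
  have left: "\<mu> n < (F ^^ n) \<alpha> - (F ^^ n) z"
  proof -
    obtain i where i: "i < n" "F1 ((F ^^ i) z) = 0" using zin by (auto simp: Z_def)
    obtain m :: int where m: "(F ^^ i) z = C + of_int m \<or> (F ^^ i) z = K + of_int m" using F1_zero[OF i(2)] by blast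
    \<comment> \<open>Just right of a maximum \<open>F\<close> decreases, whereas all factors of the
      derivative are positive right of \<open>z\<close>.\<close>
    have "(F ^^ i) z \<noteq> C + of_int m"
    proof
      assume eq: "(F ^^ i) z = C + of_int m"
      define y where "y = (C + of_int m + min (K + of_int m) ((F ^^ i) \<alpha>)) / 2"
      have "C + of_int m < (F ^^ i) \<alpha>" using incl[of z \<alpha> i] eq i zlt order by simp
      then have y: "C + of_int m < y" "y < K + of_int m" "y < (F ^^ i) \<alpha>" using CK by (auto simp: y_def min_def)
      then obtain x where x: "z \<le> x" "x \<le> \<alpha>" "(F ^^ i) x = y"
        using IVT'[of "F ^^ i" z y \<alpha>, OF _ _ _ contFn] eq zlt by auto
      then have "x \<noteq> z" using y eq by auto
      then have "F1 y > 0" using Tpos[of x i] x i zlt order by auto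
      moreover have "F1 y < 0" using neg[of "y - of_int m"] y F1_int[of "y - of_int m" m] by simp
      ultimately show False by simp
    qed
    then have m: "(F ^^ i) z = K + of_int m" using m by simp
    define l where "l = n - Suc i"
    have nl: "n = l + Suc i" "l < n" using i by (auto simp: l_def)
    have "(F ^^ n) z = (F ^^ l) (F ((F ^^ i) z))" unfolding nl(1) funpow_add by simp
    then have Fz: "(F ^^ n) z = (F ^^ l) (F K) + of_int m" by (simp add: m F_int Fn_int)
    have "(F ^^ n) z < (F ^^ n) \<alpha>" using incl[of z \<alpha> n] zlt order by simp
    then have "h ((F ^^ n) z) \<le> h ((F ^^ n) \<alpha>)" by (intro monoD[OF h_mono]) simp
    then have "real l * \<rho> + of_int m \<le> real n * \<rho> + of_int 0" using ab hFK by (simp add: Fz h_int h_Fn)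
    moreover have "real l * \<rho> + of_int m \<noteq> real n * \<rho> + of_int 0"
      using nl by (intro irrational_orbit_neq[OF irr]) simp
    \<comment> \<open>Nonresonance makes the inequality strict, so the whole fibre image at time
      \<open>l\<close>, translated by \<open>m\<close>, lies left of the one at time
      \<open>n\<close>.\<close>
    ultimately have "h ((F ^^ l) \<beta> + of_int m) < h ((F ^^ n) \<alpha>)" using ab by (simp add: h_int h_Fn)
    then have "(F ^^ l) \<beta> + of_int m < (F ^^ n) \<alpha>" by (rule h_less)
    then have "Y l < (F ^^ n) \<alpha> - (F ^^ n) z" by (simp add: Fz Y_def)
    then show ?thesis using n(2)[OF nl(2)] by (simp add: \<mu>_def)
  qed
  have right: "\<mu> n < (F ^^ n) z' - (F ^^ n) \<beta>"
  proof -
    obtain i where i: "i < n" "F1 ((F ^^ i) z') = 0" using zin' by (auto simp: Z_def)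
    obtain m :: int where m: "(F ^^ i) z' = C + of_int m \<or> (F ^^ i) z' = K + of_int m" using F1_zero[OF i(2)] by blast
    have "(F ^^ i) z' \<noteq> K + of_int m"
    proof
      assume eq: "(F ^^ i) z' = K + of_int m"
      define y where "y = (K + of_int m + max (C + of_int m) ((F ^^ i) \<beta>)) / 2"
      have "(F ^^ i) \<beta> < K + of_int m" using incl[of \<beta> z' i] eq i zlt order by simp
      then have y: "C + of_int m < y" "y < K + of_int m" "(F ^^ i) \<beta> < y" using CK by (auto simp: y_def max_def)
      then obtain x where x: "\<beta> \<le> x" "x \<le> z'" "(F ^^ i) x = y"
        using IVT'[of "F ^^ i" \<beta> y z', OF _ _ _ contFn] eq zlt by auto
      then have "x \<noteq> z'" using y eq by auto
      then have "F1 y > 0" using Tpos[of x i] x i zlt order by auto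
      moreover have "F1 y < 0" using neg[of "y - of_int m"] y F1_int[of "y - of_int m" m] by simp
      ultimately show False by simp
    qed
    then have m: "(F ^^ i) z' = C + of_int m" using m by simp
    define l where "l = n - Suc i"
    have nl: "n = l + Suc i" "l < n" using i by (auto simp: l_def)
    have "(F ^^ n) z' = (F ^^ l) (F ((F ^^ i) z'))" unfolding nl(1) funpow_add by simp
    then have Fz: "(F ^^ n) z' = (F ^^ l) (F C) + of_int m" by (simp add: m F_int Fn_int)
    have "(F ^^ n) \<beta> < (F ^^ n) z'" using incl[of \<beta> z' n] zlt order by simp
    then have "h ((F ^^ n) \<beta>) \<le> h ((F ^^ n) z')" by (intro monoD[OF h_mono]) simp
    then have "real n * \<rho> + of_int 0 \<le> real l * \<rho> + of_int m" using ab hFC by (simp add: Fz h_int h_Fn)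
    moreover have "real l * \<rho> + of_int m \<noteq> real n * \<rho> + of_int 0"
      using nl by (intro irrational_orbit_neq[OF irr]) simp
    ultimately have "h ((F ^^ n) \<beta>) < h ((F ^^ l) \<alpha> + of_int m)" using ab by (simp add: h_int h_Fn)
    then have "(F ^^ n) \<beta> < (F ^^ l) \<alpha> + of_int m" by (rule h_less)
    then have "X l < (F ^^ n) z' - (F ^^ n) \<beta>" by (simp add: Fz X_def)
    then show ?thesis using n(2)[OF nl(2)] by (simp add: \<mu>_def)
  qed
  have "\<exists>\<phi>. convex_distortion_on (F ^^ n) {z<..<z'} \<phi>"
    by (rule Fn_distortion) (auto intro: Tpos)
  then obtain \<phi> where cd: "convex_distortion_on (F ^^ n) {z<..<z'} \<phi>" by blast
  have mono_n: "(F ^^ n) x \<le> (F ^^ n) y" if "\<alpha> \<le> x" "x \<le> y" "y \<le> \<beta>" for x y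
    using inc[of x y n] that by (cases "x = y") auto
  \<comment> \<open>The shorter piece becomes the middle interval: \<open>{\<alpha>..F C}\<close>
    has its small side at \<open>z\<close>, and \<open>{F K..\<beta>}\<close> has it at
    \<open>z'\<close>.\<close>
  show False
  proof (cases "X n \<le> Y n")
    case True
    then have "\<mu> n = X n" by (simp add: \<mu>_def)
    then have "(F C - \<alpha>)\<^sup>2 \<le> 25 * (\<alpha> - z) * (z' - F C)"
      using left right mono_n[of "F C" \<beta>] zlt order ab zin eta
      by (intro koebe_space_left[OF cd contFn]) (auto simp: X_def)
    also have "\<dots> \<le> 25 * \<eta> * B"
      using zlt zin zin' ab order eta eta0 by (intro mult_mono) (auto simp: B_def)
    finally show False using eta by simp
  next
    case False
    then have "\<mu> n = Y n" by (simp add: \<mu>_def)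
    then have "(\<beta> - F K)\<^sup>2 \<le> 25 * (F K - z) * (z' - \<beta>)"
      using left right mono_n[of \<alpha> "F K"] zlt order ab zin' eta
      by (intro koebe_space_right[OF cd contFn]) (auto simp: Y_def)
    also have "\<dots> = 25 * (z' - \<beta>) * (F K - z)" by (simp add: algebra_simps)
    also have "\<dots> \<le> 25 * \<eta> * B"
      using zlt zin zin' ab order eta eta0 by (intro mult_mono) (auto simp: B_def)
    finally show False using eta by simp
  qed
qed

end

theorem (in bimodal_lift) rotation_bounds_distinct:
  assumes "rotation (upper_bound F) \<notin> \<rat>"
  shows "rotation (lower_bound F) \<noteq> rotation (upper_bound F)"
proof
  assume "rotation (lower_bound F) = rotation (upper_bound F)"
  from irrational_semiconjugacy[OF lift this refl assms]
  obtain h where h: "mono h" "deg1 h" "continuous_on UNIV h" "\<And>x. h (F x) = h x + rotation (upper_bound F)" by blast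
  interpret irrational_bimodal_lift F F1 F2 F3 C K \<Lambda> h "rotation (upper_bound F)"
    using h assms by unfold_locales auto
  show False by (rule contradiction)
qed

section \<open>Monotone bounds and distortion of a bimodal lift\<close>

context bimodal_lift
begin

lemma F_increasing:
  assumes "K \<le> x" "x < y" "y \<le> C + 1"
  shows "F x < F y"
  using assms pos d1 by (intro DERIV_pos_imp_increasing_open[OF assms(2)] contF) (metis le_less_trans less_le_trans)

lemma F_increasing_left:
  assumes "K - 1 \<le> x" "x < y" "y \<le> C"
  shows "F x < F y"
  using F_increasing[of "x + 1" "y + 1"] assms F_int[of x 1] F_int[of y 1] by simp

lemma F_decreasing:
  assumes "C \<le> x" "x \<le> y" "y \<le> K"
  shows "F y \<le> F x"
proof (cases "x = y")
  case False
  then show ?thesis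
    using assms neg d1 DERIV_neg_imp_decreasing_open[of x y F] contF by (force intro: less_imp_le)
qed simp

lemma F_le_C:
  assumes "z \<le> C"
  shows "F z \<le> F C"
proof -
  define k where "k = \<lfloor>C - z\<rfloor>"
  define w where "w = z + of_int k"
  have w: "C - 1 < w" "w \<le> C" unfolding w_def k_def by linarith+
  have "F w \<le> F C"
  proof (cases "K - 1 \<le> w")
    case True
    then show ?thesis using F_increasing_left[of w C] w by (cases "w = C") auto
  next
    case False
    then have "F (w + 1) \<le> F C" using w by (intro F_decreasing) auto
    moreover have "F (w + 1) = F w + 1" using F_int[of w 1] by simp
    ultimately show ?thesis by simp
  qed
  moreover have "F w = F z + of_int k" by (simp add: w_def F_int)
  moreover have "k \<ge> 0" using assms by (simp add: k_def)
  ultimately show ?thesis by simp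
qed

lemma F_ge_K:
  assumes "K \<le> z"
  shows "F K \<le> F z"
proof -
  define k where "k = \<lfloor>z - K\<rfloor>"
  define w where "w = z - of_int k"
  have w: "K \<le> w" "w < K + 1" unfolding w_def k_def by linarith+
  have "F K \<le> F w"
  proof (cases "w \<le> C + 1")
    case True
    then show ?thesis using F_increasing[of K w] w by (cases "w = K") auto
  next
    case False
    then have "F K \<le> F (w - 1)" using w by (intro F_decreasing) auto
    moreover have "F (w - 1) = F w - 1" using F_int[of w "-1"] by simp
    ultimately show ?thesis by simp
  qed
  moreover have "F z = F w + of_int k" using F_int[of w k] by (simp add: w_def)
  moreover have "k \<ge> 0" using assms by (simp add: k_def)
  ultimately show ?thesis by simp
qed

lemma upper_C: "upper_bound F C = F C"
  by (rule upper_bound_eqI[OF lift F_le_C])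

text \<open>The upper bound is constant from \<open>C\<close> until the rising branch regains the
  height \<open>F C\<close>; past such a point the supremum is the current value.\<close>

lemma upper_eq:
  assumes "K \<le> n" "F C \<le> F n" "n \<le> x" "x \<le> C + 1"
  shows "upper_bound F x = F x"
proof (rule upper_bound_eqI[OF lift])
  have nx: "F n \<le> F x" using F_increasing[of n x] assms by (cases "n = x") auto
  fix z assume "z \<le> x"
  then consider "z \<le> C" | "C \<le> z" "z \<le> K" | "K \<le> z" by linarith
  then show "F z \<le> F x"
  proof cases
    case 1
    then show ?thesis using F_le_C[of z] nx assms by simp
  next
    case 2
    then show ?thesis using F_decreasing[of C z] nx assms by simp
  next
    case 3
    then show ?thesis using F_increasing[of z x] \<open>z \<le> x\<close> assms by (cases "z = x") auto
  qed
qed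

lemma lower_eq:
  assumes "n \<le> C" "F n \<le> F K" "x \<le> n" "K - 1 \<le> x"
  shows "lower_bound F x = F x"
proof (rule lower_bound_eqI[OF lift])
  have nx: "F x \<le> F n" using F_increasing_left[of x n] assms by (cases "n = x") auto
  fix z assume "x \<le> z"
  then consider "z \<le> C" | "C \<le> z" "z \<le> K" | "K \<le> z" by linarith
  then show "F x \<le> F z"
  proof cases
    case 1
    then show ?thesis using F_increasing_left[of x z] \<open>x \<le> z\<close> assms by (cases "z = x") auto
  next
    case 2
    then show ?thesis using F_decreasing[of z K] nx assms by simp
  next
    case 3
    then show ?thesis using F_ge_K[of z] nx assms by simp
  qed
qed

text \<open>The Lipschitz constant must not involve \<open>F2\<close>, which need not stay bounded as the parameter
  approaches the critical line; convexity of \<open>1 / sqrt F1\<close> takes its place.\<close>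

lemma log_lipschitz:
  assumes \<delta>: "\<delta> > 0" and r: "K < r - \<delta>" "s + \<delta> < C + 1"
    and m: "m > 0" "\<And>x. r - \<delta> \<le> x \<Longrightarrow> x \<le> s + \<delta> \<Longrightarrow> m \<le> F1 x \<and> F1 x \<le> \<Lambda>"
    and xy: "r \<le> x" "x \<le> s" "r \<le> y" "y \<le> s"
  shows "F1 x \<le> F1 y * exp (2 * (sqrt \<Lambda> / (sqrt m * \<delta>)) * \<bar>x - y\<bar>)"
proof -
  define \<phi> where "\<phi> x = 1 / sqrt (F1 x)" for x
  define W where "W = sqrt \<Lambda> / (sqrt m * \<delta>)"
  have conv: "convex_on {K<..<C + 1} \<phi>"
    unfolding \<phi>_def[abs_def]
    by (rule convex_distortion_convex[OF neg_schwarzian_convex_distortion[OF d1 d2 d3 schw]]) (auto intro: pos)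
  have \<phi>pos: "\<phi> z > 0" if "r - \<delta> \<le> z" "z \<le> s + \<delta>" for z
    using m(2)[OF that] m(1) by (simp add: \<phi>_def)
  have \<phi>up: "\<phi> z \<le> 1 / sqrt m" if "r - \<delta> \<le> z" "z \<le> s + \<delta>" for z
    using m(2)[OF that] m(1) by (simp add: \<phi>_def frac_le)
  have \<phi>low: "1 / sqrt \<Lambda> \<le> \<phi> z" if "r - \<delta> \<le> z" "z \<le> s + \<delta>" for z
    using m(2)[OF that] m(1) by (simp add: \<phi>_def frac_le)
  \<comment> \<open>The chord from \<open>u\<close> is extended by \<delta> beyond \<open>v\<close>,
    where \<open>\<phi>\<close> is still at most \<open>1 / sqrt m\<close>; convexity then limits
    the increase to slope \<open>1 / (sqrt m * \<delta>)\<close>. The lower bound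
    \<open>1 / sqrt \<Lambda>\<close> of \<open>\<phi>\<close> makes the estimate relative
    afterwards.\<close>
  have step: "\<phi> v \<le> \<phi> u + 1 / (sqrt m * \<delta>) * \<bar>u - v\<bar>" if uv: "r \<le> u" "u \<le> s" "r \<le> v" "v \<le> s" for u v
  proof (cases u v rule: linorder_cases)
    case less
    have lam: "0 \<le> (v - u) / (v - u + \<delta>)" "(v - u) / (v - u + \<delta>) \<le> 1" using less \<delta> by auto
    have "(1 - (v - u) / (v - u + \<delta>)) *\<^sub>R u + ((v - u) / (v - u + \<delta>)) *\<^sub>R (v + \<delta>) = v"
    proof -
      have "(v - u) / (v - u + \<delta>) * (v - u + \<delta>) = v - u" using less \<delta> by simp
      then show ?thesis by (simp only: real_scaleR_def) (simp only: algebra_simps)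
    qed
    then have "\<phi> v \<le> (1 - (v - u) / (v - u + \<delta>)) * \<phi> u + (v - u) / (v - u + \<delta>) * \<phi> (v + \<delta>)"
      using convex_onD[OF conv lam, of u "v + \<delta>"] uv \<delta> r by simp
    also have "\<dots> \<le> 1 * \<phi> u + (v - u) / \<delta> * (1 / sqrt m)"
      using uv less \<delta> \<phi>pos[of u] \<phi>pos[of "v + \<delta>"] \<phi>up[of "v + \<delta>"]
      by (intro add_mono mult_mono frac_le) auto
    finally show ?thesis using less by (simp add: mult.commute)
  next
    case greater
    have lam: "0 \<le> (u - v) / (u - v + \<delta>)" "(u - v) / (u - v + \<delta>) \<le> 1" using greater \<delta> by auto
    have "(1 - (u - v) / (u - v + \<delta>)) *\<^sub>R u + ((u - v) / (u - v + \<delta>)) *\<^sub>R (v - \<delta>) = v"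
    proof -
      have "(u - v) / (u - v + \<delta>) * (u - v + \<delta>) = u - v" using greater \<delta> by simp
      then show ?thesis by (simp only: real_scaleR_def) (simp only: algebra_simps)
    qed
    then have "\<phi> v \<le> (1 - (u - v) / (u - v + \<delta>)) * \<phi> u + (u - v) / (u - v + \<delta>) * \<phi> (v - \<delta>)"
      using convex_onD[OF conv lam, of u "v - \<delta>"] uv \<delta> r by simp
    also have "\<dots> \<le> 1 * \<phi> u + (u - v) / \<delta> * (1 / sqrt m)"
      using uv greater \<delta> \<phi>pos[of u] \<phi>pos[of "v - \<delta>"] \<phi>up[of "v - \<delta>"]
      by (intro add_mono mult_mono frac_le) auto
    finally show ?thesis using greater by (simp add: mult.commute)
  qed simp
  have in1: "r - \<delta> \<le> x" "x \<le> s + \<delta>" "r - \<delta> \<le> y" "y \<le> s + \<delta>" using xy \<delta> by auto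
  have L: "\<Lambda> > 0" using lip_lift_ge1[OF lift] by simp
  have "\<phi> y \<le> \<phi> x + 1 / (sqrt m * \<delta>) * \<bar>x - y\<bar>" by (rule step) (use xy in auto)
  also have "\<dots> = \<phi> x + (1 / sqrt \<Lambda>) * (W * \<bar>x - y\<bar>)" using L by (simp add: W_def)
  also have "\<dots> \<le> \<phi> x + \<phi> x * (W * \<bar>x - y\<bar>)"
    using \<phi>low[OF in1(1,2)] L m(1) \<delta> by (intro add_left_mono mult_right_mono) (auto simp: W_def)
  also have "\<dots> = \<phi> x * (1 + W * \<bar>x - y\<bar>)" by (simp add: algebra_simps)
  also have "\<dots> \<le> \<phi> x * exp (W * \<bar>x - y\<bar>)"
    using \<phi>pos[OF in1(1,2)] by (intro mult_left_mono exp_ge_add_one_self) auto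
  finally have "(\<phi> y)\<^sup>2 \<le> (\<phi> x * exp (W * \<bar>x - y\<bar>))\<^sup>2"
    using \<phi>pos[OF in1(3,4)] by (intro power_mono) auto
  then have "1 / F1 y \<le> 1 / F1 x * exp (2 * (W * \<bar>x - y\<bar>))"
    using m(1) m(2)[OF in1(1,2)] m(2)[OF in1(3,4)]
    by (simp add: \<phi>_def power_divide power_mult_distrib exp_double)
  then show ?thesis
    using m(1) m(2)[OF in1(1,2)] m(2)[OF in1(3,4)] by (simp add: W_def field_simps)
qed

text \<open>Reflection turns the minimum at \<open>K\<close> into a maximum at \<open>- K\<close>,
  hence the exchanged roles of the turning points.\<close>

lemma flip_bimodal:
  "bimodal_lift (flip F) (\<lambda>x. F1 (- x)) (\<lambda>x. - F2 (- x)) (\<lambda>x. F3 (- x)) (- K) (- C) \<Lambda>"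
proof
  have m: "(uminus has_real_derivative - 1) (at x)" for x :: real by (auto intro!: derivative_eq_intros)
  show "lip_lift \<Lambda> (flip F)" by (rule lip_lift_flip[OF lift])
  show "(flip F has_real_derivative F1 (- x)) (at x)" for x
    using DERIV_minus[OF DERIV_chain2[OF d1 m]] by (simp add: flip_def[abs_def])
  show "((\<lambda>x. F1 (- x)) has_real_derivative - F2 (- x)) (at x)" for x
    using DERIV_chain2[OF d2 m] by simp
  show "((\<lambda>x. - F2 (- x)) has_real_derivative F3 (- x)) (at x)" for x
    using DERIV_minus[OF DERIV_chain2[OF d3 m]] by simp
  show "0 < F1 (- x)" if "- C < x" "x < - K + 1" for x
    using pos[of "- x + 1"] F1_int[of "- x" 1] that by simp
  show "F3 (- x) / F1 (- x) - 3 / 2 * (- F2 (- x) / F1 (- x))\<^sup>2 < 0" if "F1 (- x) \<noteq> 0" for x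
    using schw[OF that] by (simp add: power2_eq_square)
qed (use CK crit neg in auto)

lemma add_bimodal: "bimodal_lift (\<lambda>x. F x + a) F1 F2 F3 C K \<Lambda>"
proof
  show "((\<lambda>x. F x + a) has_real_derivative F1 x) (at x)" for x
    by (auto intro!: derivative_eq_intros d1)
qed (use lip_lift_add[OF lift] d2 d3 CK crit neg pos schw in auto)

end

section \<open>Rational rotation numbers near a tongue\<close>

text \<open>A periodic orbit of a monotone lift with rotation number \<open>p' / q'\<close> is ordered like the
  integers: \<open>(U ^^ j) x + m\<close> has position \<open>j * p' + m * q'\<close>.\<close>

locale periodic_orbit =
  fixes U :: "real \<Rightarrow> real" and x0 :: real and p' :: int and q' :: nat
  assumes mono: "mono U" and deg: "deg1 U"
    and periodic: "(U ^^ q') x0 = x0 + of_int p'"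
    and coprime: "coprime p' (int q')" and q'_pos: "0 < q'"
begin

abbreviation orb where "orb j \<equiv> (U ^^ j) x0"

lemma orb_int: "(U ^^ k) (x + of_int m) = (U ^^ k) x + of_int m"
  by (rule deg1_add_of_int[OF deg1_funpow[OF deg]])

lemma orb_add: "(U ^^ k) (orb j) = orb (k + j)"
  by (simp add: funpow_add)

lemma orb_mult: "orb (k + r * q') = orb k + of_int (int r * p')"
proof (induction r)
  case (Suc r)
  have "orb (k + Suc r * q') = (U ^^ (k + r * q')) (orb q')"
    by (simp add: orb_add algebra_simps)
  also have "\<dots> = orb (k + r * q') + of_int p'" by (simp only: periodic orb_int)
  finally show ?case using Suc by (simp add: algebra_simps)
qed simp

text \<open>Coprimality makes \<open>q'\<close> divide \<open>j - k\<close>, so the two points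
  differ by whole periods.\<close>

lemma orb_eq:
  assumes "int j * p' + m * int q' = int k * p' + n * int q'"
  shows "orb j + of_int m = orb k + of_int n"
proof -
  have *: "orb j + of_int m = orb k + of_int n"
    if "k \<le> j" and eq: "int j * p' + m * int q' = int k * p' + n * int q'" for j k m n
  proof -
    have "p' * int (j - k) = int q' * (n - m)" using \<open>k \<le> j\<close> eq by (simp add: of_nat_diff algebra_simps)
    then have "int q' dvd p' * int (j - k)" by (metis dvd_triv_left)
    then have "int q' dvd int (j - k)" using coprime coprime_commute coprime_dvd_mult_right_iff by blast
    then have "q' dvd j - k" by (simp only: int_dvd_int_iff)
    then obtain r where "j - k = q' * r" unfolding dvd_def by blast
    then have r: "j = k + r * q'" using \<open>k \<le> j\<close> by (simp add: mult.commute)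
    then have "int q' * (int r * p' + m - n) = 0" using eq by (simp add: algebra_simps)
    then have "m = n - int r * p'" using q'_pos by simp
    then show ?thesis by (simp add: r orb_mult)
  qed
  show ?thesis using *[of k j m n] *[of j k n m] assms by (cases "k \<le> j") auto
qed

text \<open>Were the order reversed, \<open>t\<close> further steps would take \<open>orb k\<close>
  to a translate of \<open>x0\<close>. The resulting inequality at \<open>x0\<close>, iterated
  \<open>q'\<close> times, reverses the order of the positions too; only equal positions remain, and
  these mean equal points.\<close>

lemma orb_le:
  assumes "int j * p' + m * int q' \<le> int k * p' + n * int q'"
  shows "orb j + of_int m \<le> orb k + of_int n"
proof (rule ccontr)
  assume "\<not> ?thesis"
  then have gt: "orb k + of_int (n - m) < orb j" by simp
  define t where "t = k * q' - k"
  have t: "int t = int k * int q' - int k" "t + k = 0 + k * q'" using q'_pos by (auto simp: t_def of_nat_diff)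
  have "(U ^^ t) (orb k + of_int (n - m)) \<le> (U ^^ t) (orb j)"
    using gt by (intro monoD[OF mono_funpow'[OF mono]]) simp
  then have "x0 + of_int (int k * p' + n - m) \<le> orb (t + j)"
    by (simp only: orb_int orb_add t(2) orb_mult) simp
  from funpow_mult_ge[OF mono deg this, of q']
  have "x0 + of_int (int q' * (int k * p' + n - m)) \<le> orb ((t + j) * q')" .
  also have "\<dots> = x0 + of_int (int (t + j) * p')" using orb_mult[of 0 "t + j"] by simp
  finally have "int q' * (int k * p' + n - m) \<le> int (t + j) * p'" by linarith
  then have "int k * p' + n * int q' \<le> int j * p' + m * int q'"
    by (simp add: t(1) algebra_simps)
  then have "int j * p' + m * int q' = int k * p' + n * int q'" using assms by simp
  from orb_eq[OF this] gt show False by simp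
qed

end

context bimodal_lift
begin

text \<open>\<open>p / q\<close> is the right Farey neighbour of \<open>p' / q'\<close>. The gap of the orbit to the left of the
  maximum is carried to the gap to its right by \<open>q' - q\<close> iterates, with distortion bounded by
  \<open>exp V\<close> because its images up to then are disjoint from each other and from \<open>{l..r}\<close>.\<close>

lemma equal_rotation_criterion:
  fixes p p' :: int and q q' :: nat and l r \<kappa> \<kappa>' \<mu> V :: real
  assumes det: "p * int q' - int q * p' = 1" and q: "0 < q" "q < q'"
    and per: "(upper_bound F ^^ q') C = C + of_int p'"
    and \<kappa>: "\<kappa> > 0" "(upper_bound F ^^ q) C \<le> C + of_int p - \<kappa>"
    and lr: "l < C" "K < r" "r - 1 \<le> C - \<kappa>" "C - \<kappa> \<le> l" "r \<le> C + \<kappa> / \<Lambda> ^ q"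
    and out: "F l \<le> F K" "F C \<le> F r"
    and V: "V \<ge> 0" "\<And>x y. r \<le> x \<Longrightarrow> x \<le> l + 1 \<Longrightarrow> r \<le> y \<Longrightarrow> y \<le> l + 1 \<Longrightarrow> F1 x \<le> F1 y * exp (V * \<bar>x - y\<bar>)"
    and \<mu>: "\<mu> > 0" "F (C - \<kappa>) + \<mu> \<le> F C"
    and \<kappa>': "\<kappa>' > 0" "\<kappa>' \<le> \<kappa>" "F (C - \<kappa>') \<le> F K" "\<Lambda> ^ q * exp V * (F C - F (C - \<kappa>')) \<le> \<kappa>' * \<mu>"
  shows "rotation (lower_bound F) = rotation (upper_bound F)"
    "real q' * rotation (upper_bound F) = of_int p'"
proof -
  let ?U = "upper_bound F" and ?L = "lower_bound F"
  note Um = mono_upper_bound[OF lift] and Lm = mono_lower_bound[OF lift]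
  note Ud = lip_lift_deg1[OF lip_lift_upper_bound[OF lift]] and Ld = lip_lift_deg1[OF lip_lift_lower_bound[OF lift]]
  have cop: "coprime p' (int q')"
  proof (rule coprimeI)
    fix d assume "d dvd p'" "d dvd int q'"
    then have "d dvd p * int q' - int q * p'" by (intro dvd_diff dvd_mult) auto
    then show "is_unit d" using det by simp
  qed
  interpret periodic_orbit ?U C p' q'
    using Um Ud per cop q by unfold_locales auto
  have lipn: "\<bar>(G ^^ k) x - (G ^^ k) y\<bar> \<le> \<Lambda> ^ k * \<bar>x - y\<bar>" if G: "lip_lift \<Lambda> G" for G k x y
  proof (induction k)
    case (Suc k)
    have "\<bar>G ((G ^^ k) x) - G ((G ^^ k) y)\<bar> \<le> \<Lambda> * \<bar>(G ^^ k) x - (G ^^ k) y\<bar>" by (rule lip_lift_le[OF G])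
    also have "\<dots> \<le> \<Lambda> * (\<Lambda> ^ k * \<bar>x - y\<bar>)" using Suc lip_lift_ge1[OF G] by (intro mult_left_mono) auto
    finally show ?case by (simp add: mult.assoc)
  qed simp
  have Lq: "\<Lambda> ^ q > 0" using lip_lift_ge1[OF lift] by simp
  \<comment> \<open>Outside the critical region, up to integer translation, both bounds agree with
    \<open>F\<close>.\<close>
  define reg where "reg = {x. \<exists>m::int. r \<le> x + of_int m \<and> x + of_int m \<le> l + 1}"
  have regU: "?U x = F x" and regL: "?L x = F x" if "x \<in> reg" for x
  proof -
    obtain m :: int where m: "r \<le> x + of_int m" "x + of_int m \<le> l + 1"
      using \<open>x \<in> reg\<close> by (auto simp: reg_def)
    have "?U (x + of_int m) = F (x + of_int m)"
      using m lr by (intro upper_eq[of r]) (auto simp: out)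
    then show "?U x = F x" using deg1_add_of_int[OF Ud, of x m] by (simp add: F_int)
    have "?L (x + of_int (m - 1)) = F (x + of_int (m - 1))"
      using m lr by (intro lower_eq[of l]) (auto simp: out)
    then show "?L x = F x" using deg1_add_of_int[OF Ld, of x "m - 1"] F_int[of x "m - 1"] by simp
  qed
  \<comment> \<open>By \<open>det\<close> these points have positions -1 and 1: they are the
    neighbours of \<open>C\<close> in the orbit.\<close>
  define P where "P = orb q - of_int p"
  define S where "S = orb (q' - q) + of_int (p - p')"
  have PC: "P \<le> C - \<kappa>" using \<kappa> by (simp add: P_def)
  have q'q: "int (q' - q) = int q' - int q" using q by (simp add: of_nat_diff)
  have CS: "C \<le> S"
  proof -
    have "orb 0 + of_int 0 \<le> orb (q' - q) + of_int (p - p')"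
      by (rule orb_le) (use det in \<open>simp add: q'q algebra_simps\<close>)
    then show ?thesis by (simp add: S_def)
  qed
  have US: "(?U ^^ q) S = C + of_int p"
  proof -
    have "(?U ^^ q) S = orb (q + (q' - q)) + of_int (p - p')" unfolding S_def orb_int orb_add ..
    then show ?thesis using q per by simp
  qed
  \<comment> \<open>After \<open>q\<close> steps the images of \<open>C\<close> and \<open>S\<close>
    are at least \<kappa> apart, and \<open>q\<close> steps stretch by at most
    \<open>\<Lambda> ^ q\<close>.\<close>
  have rS: "r \<le> S"
  proof -
    have "\<kappa> \<le> (?U ^^ q) S - (?U ^^ q) C" using US \<kappa> by simp
    also have "\<dots> \<le> \<Lambda> ^ q * \<bar>S - C\<bar>"
      using lipn[OF lip_lift_upper_bound[OF lift], of q S C] by linarith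
    finally have "\<kappa> \<le> \<Lambda> ^ q * (S - C)" using CS by simp
    then have "\<kappa> / \<Lambda> ^ q \<le> S - C" using Lq by (simp add: pos_divide_le_eq mult.commute)
    then show ?thesis using lr by simp
  qed
  have place: "\<exists>m::int. l < x + of_int m \<and> x + of_int m \<le> l + 1" for x
    by (rule exI[of _ "\<lfloor>l + 1 - x\<rfloor>"]) linarith
  have pos_ge0: "0 \<le> int j * p' + m * int q'" if "l < orb j + of_int m" for j m
  proof (rule ccontr)
    assume "\<not> ?thesis"
    then have "orb j + of_int m \<le> orb q + of_int (- p)" using det by (intro orb_le) (simp add: algebra_simps)
    then show False using that PC lr by (simp add: P_def)
  qed
  have pos_ge1: "r \<le> orb j + of_int m" if "1 \<le> int j * p' + m * int q'" for j m
  proof -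
    have "orb (q' - q) + of_int (p - p') \<le> orb j + of_int m"
      using det that by (intro orb_le) (simp add: q'q algebra_simps)
    then show ?thesis using rS by (simp add: S_def)
  qed
  have dvd_q': "q' dvd j" if "int j * p' + m * int q' = 0" for j :: nat and m
  proof -
    have "p' * int j = int q' * (- m)" using that by (simp add: algebra_simps)
    then have "int q' dvd p' * int j" by (metis dvd_triv_left)
    then have "int q' dvd int j" using cop coprime_commute coprime_dvd_mult_right_iff by blast
    then show ?thesis by (simp only: int_dvd_int_iff)
  qed
  \<comment> \<open>Position 0 belongs to translates of \<open>C\<close> alone. Any other orbit
    point right of \<open>l\<close> has position at least 1, so it is not left of \<open>S\<close>
    and misses the critical region.\<close>
  have point_reg: "orb j \<in> reg" if "\<not> q' dvd j" for j
  proof -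
    obtain m :: int where m: "l < orb j + of_int m" "orb j + of_int m \<le> l + 1" using place by blast
    have "int j * p' + m * int q' \<noteq> 0" using dvd_q' that by blast
    then have "1 \<le> int j * p' + m * int q'" using pos_ge0[OF m(1)] by simp
    then show ?thesis using pos_ge1 m unfolding reg_def by blast
  qed
  define J where "J = q' - q"
  have J: "0 < J" "q' = J + q" using q by (auto simp: J_def)
  \<comment> \<open>The left neighbour of \<open>orb j\<close>, one position lower.\<close>
  define D where "D j = orb (q + j) - of_int p" for j
  have D_le: "D j \<le> orb j" for j
  proof -
    have "orb (q + j) + of_int (- p) \<le> orb j + of_int 0"
      by (rule orb_le) (use det in \<open>simp add: algebra_simps\<close>)
    then show ?thesis by (simp add: D_def)
  qed
  \<comment> \<open>Position 1 would make \<open>C\<close> the left end of the gap. This first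
    happens at \<open>j = J\<close>, so both ends are regular before.\<close>
  have gap_reg: "\<exists>m::int. r \<le> D j + of_int m \<and> orb j + of_int m \<le> l + 1" if j: "0 < j" "j < J" for j
  proof -
    obtain m :: int where m: "l < orb j + of_int m" "orb j + of_int m \<le> l + 1" using place by blast
    have "\<not> q' dvd j" using j J by (auto dest: dvd_imp_le)
    then have n0: "int j * p' + m * int q' \<noteq> 0" using dvd_q' by blast
    have n1: "int j * p' + m * int q' \<noteq> 1"
    proof
      assume "int j * p' + m * int q' = 1"
      then have "int (j + q) * p' + (m - p) * int q' = 0" using det by (simp add: algebra_simps)
      then have "q' dvd j + q" by (rule dvd_q')
      then show False using j J q by (auto dest!: dvd_imp_le)
    qed
    have "1 \<le> int (q + j) * p' + (m - p) * int q'" using n0 n1 pos_ge0[OF m(1)] det by (simp add: algebra_simps)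
    then have "r \<le> D j + of_int m" using pos_ge1[of "q + j" "m - p"] by (simp add: D_def)
    then show ?thesis using m by blast
  qed
  \<comment> \<open>Shifting the index by \<open>q\<close> over a full period adds
    \<open>q * p'\<close> to the sum of the orbit; with the translations by \<open>p\<close> the
    total is the determinant \<open>det\<close>.\<close>
  have sum_D: "(\<Sum>j<q'. orb j - D j) = 1"
  proof -
    have "(\<Sum>j<q'. orb (q + j)) = (\<Sum>j<q'. orb j) + of_int (int q * p')"
    proof (induction q)
      case (Suc q)
      have "(\<Sum>j<q'. orb (Suc q + j)) + orb q = (\<Sum>j<Suc q'. orb (q + j))"
        by (subst sum.lessThan_Suc_shift) simp
      also have "\<dots> = (\<Sum>j<q'. orb (q + j)) + orb (q + q')" by simp
      also have "orb (q + q') = orb q + of_int p'" using orb_mult[of q 1] by simp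
      finally show ?case using Suc by (simp add: algebra_simps)
    qed simp
    moreover have "(\<Sum>j<q'. orb j - D j) = (\<Sum>j<q'. orb j) - (\<Sum>j<q'. orb (q + j)) + real q' * of_int p"
      by (simp add: D_def sum_subtractf)
    moreover have "real q' * of_int p - of_int (int q * p') = of_int (p * int q' - int q * p')"
      by (simp add: algebra_simps)
    ultimately show ?thesis using det by simp
  qed
  have partial: "(\<Sum>j\<in>A. orb j - D j) \<le> 1" if "A \<subseteq> {..<q'}" for A
    using sum_mono2[OF finite_lessThan that, of "\<lambda>j. orb j - D j"] D_le sum_D by simp
  \<comment> \<open>This orbit of the lower bound is to return to at least
    \<open>C - \<kappa>' + p'\<close>. It is followed inside the gaps
    \<open>{D j..orb j}\<close>.\<close>
  define y where "y j = (?L ^^ j) (C - \<kappa>')" for j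
  have y1: "y 1 = F (C - \<kappa>')"
    unfolding y_def using lower_eq[of "C - \<kappa>'" "C - \<kappa>'"] \<kappa>' lr CK by simp
  have DS: "D (Suc j) = ?U (D j)" for j
    using deg1_diff_of_int[OF Ud] by (simp add: D_def)
  have \<mu>D: "\<mu> \<le> orb 1 - D 1"
  proof -
    have "D 1 \<le> ?U (C - \<kappa>)"
      using PC DS[of 0] by (auto intro!: monoD[OF Um] simp: D_def P_def)
    also have "\<dots> = F (C - \<kappa>)"
    proof (rule regU)
      show "C - \<kappa> \<in> reg" using lr unfolding reg_def by (intro CollectI exI[of _ 1]) auto
    qed
    finally show ?thesis using \<mu> by (simp add: upper_C)
  qed
  \<comment> \<open>The fraction of the gap lying above \<open>y j\<close> grows in each step at
    most by the factor \<open>exp (V * (orb j - D j))\<close>, and at \<open>j = 1\<close> it is at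
    most \<open>(F C - F (C - \<kappa>')) / \<mu>\<close>. The inequality is kept free of quotients
    to cover gaps of length 0.\<close>
  have chain: "D j \<le> y j \<and> y j \<le> orb j \<and>
      (orb j - y j) * \<mu> \<le> exp (V * (\<Sum>i\<in>{1..<j}. orb i - D i)) * (F C - F (C - \<kappa>')) * (orb j - D j)"
    if "1 \<le> j" "j \<le> J" for j
    using that
  proof (induction j rule: dec_induct)
    case base
    have "\<not> q' dvd q" using q by (auto dest: dvd_imp_le)
    then have "P \<in> reg"
      using point_reg[of q] unfolding reg_def P_def by (auto intro: exI[of _ "m + p" for m])
    then have "D 1 = ?L P" using DS[of 0] regU regL by (simp add: D_def P_def)
    also have "\<dots> \<le> ?L (C - \<kappa>')" using PC \<kappa>' by (intro monoD[OF Lm]) simp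
    finally have 1: "D 1 \<le> y 1" by (simp add: y_def)
    have 2: "y 1 \<le> orb 1" using y1 F_le_C[of "C - \<kappa>'"] \<kappa>' by (simp add: upper_C)
    have "(orb 1 - y 1) * \<mu> \<le> (orb 1 - y 1) * (orb 1 - D 1)"
      using 2 \<mu>D by (intro mult_left_mono) auto
    then show ?case using 1 2 y1 by (simp add: upper_C)
  next
    case (step j)
    then have j: "0 < j" "j < J" by auto
    have IH: "D j \<le> y j" "y j \<le> orb j" "(orb j - y j) * \<mu> \<le>
        exp (V * (\<Sum>i\<in>{1..<j}. orb i - D i)) * (F C - F (C - \<kappa>')) * (orb j - D j)"
      using step by auto
    obtain m :: int where m: "r \<le> D j + of_int m" "orb j + of_int m \<le> l + 1" using gap_reg[OF j] by blast
    have inreg: "x \<in> reg" if "D j \<le> x" "x \<le> orb j" for x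
      using m that unfolding reg_def by (intro CollectI exI[of _ m]) auto
    have eqs: "D (Suc j) = F (D j)" "y (Suc j) = F (y j)" "orb (Suc j) = F (orb j)"
      using DS[of j] regU[OF inreg] regL[OF inreg] IH D_le[of j] by (auto simp: y_def)
    have "D (Suc j) = ?L (D j)" "orb (Suc j) = ?L (orb j)" "y (Suc j) = ?L (y j)"
      using eqs regL[OF inreg] IH D_le[of j] by auto
    then have ord: "D (Suc j) \<le> y (Suc j)" "y (Suc j) \<le> orb (Suc j)"
      using IH monoD[OF Lm] by auto
    have "(orb (Suc j) - y (Suc j)) * (orb j - D j) \<le>
        exp (V * (orb j - D j)) * (orb j - y j) * (orb (Suc j) - D (Suc j))"
    proof (cases "y j = orb j")
      case True
      then show ?thesis using eqs by simp
    next
      case False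
      then have lt: "y j < orb j" "D j < orb j" using IH by auto
      obtain s where s: "y j < s" "s < orb j" "F (orb j) - F (y j) = (orb j - y j) * F1 s"
        using MVT2[OF lt(1), of F F1] d1 by auto
      obtain t where t: "D j < t" "t < orb j" "F (orb j) - F (D j) = (orb j - D j) * F1 t"
        using MVT2[OF lt(2), of F F1] d1 by auto
      have t0: "F1 t \<ge> 0"
        using pos[of "t + of_int m"] t m lr F1_int[of t m] CK by (auto intro: less_imp_le)
      have "F1 (s + of_int m) \<le> F1 (t + of_int m) * exp (V * \<bar>(s + of_int m) - (t + of_int m)\<bar>)"
        using s t m IH by (intro V) auto
      then have "F1 s \<le> F1 t * exp (V * \<bar>s - t\<bar>)" by (simp add: F1_int)
      also have "\<dots> \<le> F1 t * exp (V * (orb j - D j))"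
        using t0 s t IH V by (intro mult_left_mono) (auto intro!: mult_left_mono)
      finally have "(orb j - y j) * (orb j - D j) * F1 s \<le> (orb j - y j) * (orb j - D j) * (F1 t * exp (V * (orb j - D j)))"
        using lt by (intro mult_left_mono) auto
      moreover have e1: "orb (Suc j) - y (Suc j) = (orb j - y j) * F1 s"
        and e2: "orb (Suc j) - D (Suc j) = (orb j - D j) * F1 t"
        using s t eqs by simp_all
      ultimately show ?thesis unfolding e1 e2 by (simp only: mult_ac)
    qed
    from mult_right_mono[OF this, of \<mu>] \<mu>
    have A: "exp (V * (orb j - D j)) * ((orb j - y j) * \<mu>) * (orb (Suc j) - D (Suc j)) \<ge>
        (orb (Suc j) - y (Suc j)) * (orb j - D j) * \<mu>"
      by (simp only: mult_ac less_imp_le)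
    have sum_Suc: "(\<Sum>i\<in>{1..<Suc j}. orb i - D i) = (\<Sum>i\<in>{1..<j}. orb i - D i) + (orb j - D j)"
      using j by simp
    have "exp (V * (orb j - D j)) * ((orb j - y j) * \<mu>) * (orb (Suc j) - D (Suc j)) \<le>
        exp (V * (orb j - D j)) * (exp (V * (\<Sum>i\<in>{1..<j}. orb i - D i)) * (F C - F (C - \<kappa>')) * (orb j - D j)) *
          (orb (Suc j) - D (Suc j))"
      using IH(3) D_le[of "Suc j"] by (intro mult_right_mono mult_left_mono) auto
    also have "\<dots> = (exp (V * (\<Sum>i\<in>{1..<Suc j}. orb i - D i)) * (F C - F (C - \<kappa>')) * (orb (Suc j) - D (Suc j))) * (orb j - D j)"
      by (simp only: sum_Suc distrib_left exp_add mult_ac)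
    finally have "exp (V * (orb j - D j)) * ((orb j - y j) * \<mu>) * (orb (Suc j) - D (Suc j)) \<le> \<dots>" .
    from order_trans[OF A this] have B: "((orb (Suc j) - y (Suc j)) * \<mu>) * (orb j - D j) \<le>
      (exp (V * (\<Sum>i\<in>{1..<Suc j}. orb i - D i)) * (F C - F (C - \<kappa>')) * (orb (Suc j) - D (Suc j))) * (orb j - D j)"
      by (simp only: mult_ac)
    show ?case
    proof (cases "D j = orb j")
      case True
      then have "orb (Suc j) = y (Suc j)" using eqs IH by simp
      moreover have "F (C - \<kappa>') \<le> F C" using \<kappa>' by (intro F_le_C) simp
      ultimately show ?thesis using ord D_le[of "Suc j"] by simp
    next
      case False
      then have "orb j - D j > 0" using D_le[of j] by simp
      then show ?thesis using mult_right_le_imp_le[OF B] ord by blast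
    qed
  qed
  have "(orb J - y J) * \<mu> \<le> exp V * (F C - F (C - \<kappa>'))"
  proof -
    have FC: "F (C - \<kappa>') \<le> F C" using \<kappa>' by (intro F_le_C) simp
    have "(orb J - y J) * \<mu> \<le> exp (V * (\<Sum>i\<in>{1..<J}. orb i - D i)) * (F C - F (C - \<kappa>')) * (orb J - D J)"
      using chain[of J] J by auto
    also have "\<dots> \<le> exp (V * 1) * (F C - F (C - \<kappa>')) * 1"
    proof (intro mult_mono)
      show "exp (V * (\<Sum>i\<in>{1..<J}. orb i - D i)) \<le> exp (V * 1)"
      proof -
        have "(\<Sum>i\<in>{1..<J}. orb i - D i) \<le> 1" using J by (intro partial) auto
        from mult_left_mono[OF this V(1)] show ?thesis by simp
      qed
      show "orb J - D J \<le> 1" using partial[of "{J}"] J q by simp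
    qed (use FC D_le[of J] in auto)
    finally show ?thesis by simp
  qed
  then have "\<Lambda> ^ q * ((orb J - y J) * \<mu>) \<le> \<Lambda> ^ q * (exp V * (F C - F (C - \<kappa>')))"
    using Lq by (intro mult_left_mono) auto
  also have "\<dots> \<le> \<kappa>' * \<mu>" using \<kappa>' by (simp add: mult.assoc)
  finally have close: "\<Lambda> ^ q * (orb J - y J) \<le> \<kappa>'" using \<mu> by (simp add: mult.assoc[symmetric])
  \<comment> \<open>During the last \<open>q\<close> steps the orbit of \<open>C\<close> is regular,
    hence an orbit of the lower bound as well, and the Lipschitz factor \<open>\<Lambda> ^ q\<close>
    is enough.\<close>
  have track: "(?L ^^ t) (orb J) = orb (J + t)" if "t \<le> q" for t
    using that
  proof (induction t)
    case (Suc t)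
    have "\<not> q' dvd J + t" using J Suc by (auto dest!: dvd_imp_le)
    then have "orb (J + t) \<in> reg" by (rule point_reg)
    then show ?case using Suc regU regL by simp
  qed simp
  have "y q' = (?L ^^ q) (y J)" unfolding y_def J(2) by (simp add: funpow_add add.commute[of J])
  moreover have "(?L ^^ q) (orb J) - (?L ^^ q) (y J) \<le> \<Lambda> ^ q * \<bar>orb J - y J\<bar>"
    using lipn[OF lip_lift_lower_bound[OF lift], of q "orb J" "y J"] by linarith
  moreover have "\<bar>orb J - y J\<bar> = orb J - y J" using chain[of J] J by auto
  ultimately have "orb q' - y q' \<le> \<kappa>'" using track[of q] close J by simp
  then have "C - \<kappa>' + of_int p' \<le> (?L ^^ q') (C - \<kappa>')" using per by (simp add: y_def)
  from rotation_ge[OF Lm Ld this] have 1: "of_int p' \<le> real q' * rotation ?L" .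
  have 2: "rotation ?L \<le> rotation ?U" by (rule rotation_mono[OF Lm Ld Um Ud lower_le_upper[OF lift]])
  have "real q' * rotation ?U \<le> of_int p'" using rotation_le[OF Um Ud, of q' C p'] per by simp
  moreover have "real q' * rotation ?L \<le> real q' * rotation ?U" using 2 by (intro mult_left_mono) auto
  ultimately have 3: "real q' * rotation ?L = of_int p'" "real q' * rotation ?U = of_int p'" using 1 by auto
  then show "real q' * rotation ?U = of_int p'" by simp
  have "real q' > 0" using q by simp
  then show "rotation ?L = rotation ?U" using 3 by (metis less_irrefl mult_cancel_left)
qed

end

section \<open>Families near the critical line\<close>

text \<open>The left end of the tongue at one height, expressed by the upper bound alone: as
  \<open>a\<close> grows, \<omega> enters the rotation set when the upper end of that set reaches
  \<omega>.\<close>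

definition left_end :: "(real \<Rightarrow> real) \<Rightarrow> real \<Rightarrow> real \<Rightarrow> bool" where
  "left_end H \<omega> l \<longleftrightarrow> rotation (\<lambda>x. upper_bound H x + l) = \<omega> \<and>
     (\<forall>a<l. rotation (\<lambda>x. upper_bound H x + a) < \<omega>)"

lemma rotation_upper_add_mono:
  assumes "lip_lift \<Lambda> H" "a \<le> a'"
  shows "rotation (\<lambda>x. upper_bound H x + a) \<le> rotation (\<lambda>x. upper_bound H x + a')"
  using assms by (intro rotation_add_mono mono_upper_bound lip_lift_deg1 lip_lift_upper_bound)

lemma continuous_rotation_upper_add:
  assumes "lip_lift \<Lambda> H"
  shows "continuous_on UNIV (\<lambda>a. rotation (\<lambda>x. upper_bound H x + a))"
  using assms by (intro continuous_on_rotation_add mono_upper_bound lip_lift_deg1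
      lip_lift_upper_bound lip_lift_continuous)

lemma left_end_exists:
  assumes H: "lip_lift \<Lambda> H"
  shows "\<exists>l. left_end H \<omega> l"
proof -
  let ?R = "\<lambda>a. rotation (\<lambda>x. upper_bound H x + a)"
  define S where "S = {a. \<omega> \<le> ?R a}"
  have att: "\<exists>a. ?R a = r" for r
    using H by (intro rotation_attained mono_upper_bound lip_lift_deg1 lip_lift_upper_bound lip_lift_continuous)
  obtain a0 where a0: "?R a0 = \<omega>" using att by blast
  obtain a1 where a1: "?R a1 = \<omega> - 1" using att by blast
  have "closed S" unfolding S_def
    by (intro closed_Collect_le continuous_on_const continuous_rotation_upper_add[OF H])
  moreover have "bdd_below S"
  proof (rule bdd_belowI)
    fix a assume "a \<in> S"
    then show "a1 \<le> a"
      using rotation_upper_add_mono[OF H, of a a1] a1 by (cases "a1 \<le> a") (auto simp: S_def)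
  qed
  moreover have a0S: "a0 \<in> S" using a0 by (simp add: S_def)
  ultimately have l: "Inf S \<in> S" "Inf S \<le> a0" "\<And>a. a \<in> S \<Longrightarrow> Inf S \<le> a"
    by (auto intro: closed_contains_Inf cInf_lower)
  have "?R (Inf S) = \<omega>"
    using l(1) rotation_upper_add_mono[OF H l(2)] a0 by (simp add: S_def)
  moreover have "?R a < \<omega>" if "a < Inf S" for a
    using l(3)[of a] that by (force simp: S_def)
  ultimately show ?thesis unfolding left_end_def by blast
qed

text \<open>Lowering a lift by at most \<open>d\<close> delays its tongue by at most
  \<open>d\<close>. Used in both directions, this makes the side of the tongue continuous in
  \<open>b\<close>.\<close>

lemma left_end_le:
  assumes H: "lip_lift \<Lambda> H" "lip_lift \<Lambda>' H'" and l: "left_end H \<omega> l" "left_end H' \<omega> l'"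
    and d: "\<And>x. H x \<le> H' x + d"
  shows "l' \<le> l + d"
proof (rule ccontr)
  assume "\<not> ?thesis"
  then have "rotation (\<lambda>x. upper_bound H' x + (l + d)) < \<omega>" using l by (auto simp: left_end_def)
  moreover have "rotation (\<lambda>x. upper_bound H x + l) \<le> rotation (\<lambda>x. upper_bound H' x + (l + d))"
    using H upper_bound_close[OF H(2,1) d]
    by (intro rotation_mono mono_add_const deg1_add_const mono_upper_bound lip_lift_deg1 lip_lift_upper_bound)
       (auto simp: algebra_simps)
  ultimately show False using l by (simp add: left_end_def)
qed

lemma (in bimodal_lift) F1_le: "F1 x \<le> \<Lambda>"
proof (rule ccontr)
  assume "\<not> ?thesis"
  moreover have "((\<lambda>y. F y - \<Lambda> * y) has_real_derivative F1 x - \<Lambda>) (at x)"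
    by (auto intro!: derivative_eq_intros d1)
  ultimately obtain h where "h > 0" "F x - \<Lambda> * x < F (x + h) - \<Lambda> * (x + h)"
    using DERIV_pos_inc_right[of "\<lambda>y. F y - \<Lambda> * y" "F1 x - \<Lambda>" x]
    by (auto, metis dense)
  then show False using lip_lift_le[OF lift, of "x + h" x] by (simp add: algebra_simps)
qed

text \<open>The family just above the critical line: as \<open>b\<close> decreases to
  \<open>b0\<close>, the two turning points merge into the single critical point \<open>c\<close> of
  a monotone lift. Convergence is asked of values and first derivatives, which is what Class N
  provides.\<close>

locale bimodal_unfolding =
  fixes G G1 G2 G3 :: "real \<Rightarrow> real \<Rightarrow> real" and C K :: "real \<Rightarrow> real" and b0 b1 c \<Lambda> :: real
  assumes b01: "b0 < b1"
    and bim: "\<And>b. b0 < b \<Longrightarrow> b < b1 \<Longrightarrow> bimodal_lift (G b) (G1 b) (G2 b) (G3 b) (C b) (K b) \<Lambda>"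
    and lift0: "lip_lift \<Lambda> (G b0)"
    and deriv0: "\<And>x. (G b0 has_real_derivative G1 b0 x) (at x)"
    and cont0: "continuous_on UNIV (G1 b0)"
    and crit0: "G1 b0 c = 0"
    and pos0: "\<And>x. c < x \<Longrightarrow> x < c + 1 \<Longrightarrow> 0 < G1 b0 x"
    and conv: "\<And>e. e > 0 \<Longrightarrow> \<exists>d>0. \<forall>b. b0 < b \<and> b < b0 + d \<longrightarrow>
      (\<forall>x. \<bar>G b x - G b0 x\<bar> < e \<and> \<bar>G1 b x - G1 b0 x\<bar> < e) \<and> \<bar>C b - c\<bar> < e \<and> \<bar>K b - c\<bar> < e"
begin

lemma G1_int: "G1 b0 (x + of_int m) = G1 b0 x"
  by (rule deg1_deriv_add_of_int[OF lip_lift_deg1[OF lift0] deriv0])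

lemma G1_nonneg: "0 \<le> G1 b0 x"
proof -
  define m where "m = \<lfloor>x - c\<rfloor>"
  have "c \<le> x - of_int m" "x - of_int m < c + 1" unfolding m_def by linarith+
  then have "0 \<le> G1 b0 (x - of_int m)" using pos0[of "x - of_int m"] crit0 by (cases "c = x - of_int m") auto
  then show ?thesis using G1_int[of "x - of_int m" m] by simp
qed

lemma G0_mono: "mono (G b0)"
  using DERIV_nonneg_imp_nondecreasing[of _ _ "G b0"] deriv0 G1_nonneg by (intro monoI) blast

lemma G0_less:
  assumes "c \<le> x" "x < y" "y \<le> c + 1"
  shows "G b0 x < G b0 y"
  using assms pos0 deriv0
  by (intro DERIV_pos_imp_increasing_open[OF assms(2)] lip_lift_continuous[OF lift0])
     (metis le_less_trans less_le_trans)

lemma G0_less_left: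
  assumes "c - 1 \<le> x" "x < y" "y \<le> c"
  shows "G b0 x < G b0 y"
  using G0_less[of "x + 1" "y + 1"] assms lip_lift_deg1[OF lift0] by (simp add: deg1_def)

lemma upper_G0: "upper_bound (G b0) = G b0"
  using G0_mono by (intro ext upper_bound_eqI[OF lift0]) (auto simp: mono_def)

text \<open>At the left end of the tongue a periodic orbit is only touched from below, whereas a
  periodic critical point would be crossed.\<close>

lemma critical_not_periodic:
  assumes q: "0 < q" "real q * \<omega> = of_int p" and l: "left_end (G b0) \<omega> l"
  shows "((\<lambda>x. G b0 x + l) ^^ q) c < c + of_int p"
proof -
  let ?H = "\<lambda>a x. G b0 x + a"
  have Hm: "mono (?H a)" and Hd: "deg1 (?H a)" for a
    using G0_mono lip_lift_deg1[OF lift0] by (auto intro: mono_add_const deg1_add_const)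
  have le: "(?H l ^^ q) x \<le> x + of_int p" for x
  proof (rule ccontr)
    assume gt: "\<not> ?thesis"
    have "continuous_on UNIV (\<lambda>a. (?H a ^^ q) x)"
      by (intro continuous_on_funpow_translate[of "G b0" "\<lambda>_. x" "\<lambda>a. a"] lip_lift_continuous[OF lift0] continuous_intros)
    then have "isCont (\<lambda>a. (?H a ^^ q) x) l" by (simp add: continuous_on_eq_continuous_at)
    then have "\<forall>\<^sub>F a in at l. x + of_int p < (?H a ^^ q) x"
      using gt by (intro order_tendstoD(1)) (auto simp: isCont_def)
    then obtain d where d: "d > 0" "\<And>a. a \<noteq> l \<Longrightarrow> dist a l < d \<Longrightarrow> x + of_int p < (?H a ^^ q) x"
      by (auto simp: eventually_at)
    have "x + of_int p \<le> (?H (l - d / 2) ^^ q) x" using d by (intro less_imp_le d(2)) (auto simp: dist_real_def)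
    from rotation_ge[OF Hm Hd this] have "real q * \<omega> \<le> real q * rotation (?H (l - d / 2))" using q by simp
    moreover have "rotation (?H (l - d / 2)) < \<omega>" using l d(1) unfolding left_end_def upper_G0 by simp
    ultimately show False using q(1) by simp
  qed
  have "(?H l ^^ q) c \<noteq> c + of_int p"
  proof
    assume eq: "(?H l ^^ q) c = c + of_int p"
    obtain k where k: "q = Suc k" using q by (cases q) auto
    have "\<exists>D. ((?H l ^^ n) has_real_derivative D) (at x)" for n x
    proof (induction n)
      case 0
      then show ?case by (auto simp: id_def intro!: derivative_eq_intros)
    next
      case (Suc n)
      then obtain D where D: "((?H l ^^ n) has_real_derivative D) (at x)" by blast
      have "((\<lambda>x. G b0 ((?H l ^^ n) x) + l) has_real_derivative G1 b0 ((?H l ^^ n) x) * D) (at x)"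
        using DERIV_add[OF DERIV_chain2[OF deriv0 D] DERIV_const[of l]] by simp
      then show ?case by (auto simp: comp_def)
    qed
    then obtain D where D: "((?H l ^^ k) has_real_derivative D) (at (?H l c))" by blast
    have "(?H l has_real_derivative 0) (at c)"
      using DERIV_add[OF deriv0[of c] DERIV_const[of l]] crit0 by simp
    from DERIV_chain2[OF D this] have "((?H l ^^ q) has_real_derivative 0) (at c)"
      unfolding k funpow_Suc_right by (simp add: comp_def)
    then have "((\<lambda>x. (?H l ^^ q) x - x) has_real_derivative - 1) (at c)"
      by (auto intro!: derivative_eq_intros)
    from DERIV_neg_dec_left[OF this] obtain d where
      d: "d > 0" "\<forall>h>0. h < d \<longrightarrow> (?H l ^^ q) c - c < (?H l ^^ q) (c - h) - (c - h)" by auto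
    then have "(?H l ^^ q) c - c < (?H l ^^ q) (c - d / 2) - (c - d / 2)" by auto
    then show False using le[of "c - d / 2"] eq by simp
  qed
  then show ?thesis using le[of c] by simp
qed

text \<open>The strict inequality for \<open>c\<close> at the critical height survives small changes
  of the map, of the critical point and of the left end, with one \<kappa> for all of them.
  Parameters \<open>a \<le> l\<close> are included because the Farey witnesses lie outside the
  tongue.\<close>

lemma uniform_gap:
  assumes q: "0 < q" "real q * \<omega> = of_int p"
  shows "\<exists>\<kappa>>0. \<kappa> \<le> 1 / 4 \<and> (\<exists>d>0. \<forall>b l a. b0 < b \<and> b < b0 + d \<and> left_end (G b) \<omega> l \<and> a \<le> l \<longrightarrow>
    ((\<lambda>x. upper_bound (G b) x + a) ^^ q) (C b) \<le> C b + of_int p - \<kappa>)"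
proof -
  obtain l0 where l0: "left_end (G b0) \<omega> l0" using left_end_exists[OF lift0] by blast
  \<comment> \<open>One \<open>s\<close> moves the starting point; of the \<open>2 * s\<close>, one
    half allows for the change of the upper bound and the other for that of the left end.\<close>
  define T where "T s = ((\<lambda>x. G b0 x + (l0 + 2 * s)) ^^ q) (c + s)" for s
  have "T 0 < c + of_int p" using critical_not_periodic[OF q l0] by (simp add: T_def)
  define \<kappa> where "\<kappa> = min (1 / 4) ((c + of_int p - T 0) / 4)"
  have \<kappa>: "\<kappa> > 0" "\<kappa> \<le> 1 / 4" using \<open>T 0 < c + of_int p\<close> by (auto simp: \<kappa>_def)
  have "\<kappa> \<le> (c + of_int p - T 0) / 4" unfolding \<kappa>_def by (rule min.cobounded2)
  then have \<kappa>T: "T 0 \<le> c + of_int p - 4 * \<kappa>" by (simp add: pos_le_divide_eq algebra_simps)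
  have "continuous_on UNIV T" unfolding T_def[abs_def]
    by (intro continuous_on_funpow_translate lip_lift_continuous[OF lift0] continuous_intros)
  then have "isCont T 0" by (simp add: continuous_on_eq_continuous_at)
  then have "\<forall>\<^sub>F s in at 0. T s < T 0 + \<kappa>"
    using \<kappa> by (intro order_tendstoD(2)) (auto simp: isCont_def)
  then obtain s0 where s0: "s0 > 0" "\<And>s. s \<noteq> 0 \<Longrightarrow> dist s 0 < s0 \<Longrightarrow> T s < T 0 + \<kappa>"
    by (auto simp: eventually_at)
  define s where "s = min (s0 / 2) \<kappa>"
  have s: "s > 0" "s \<le> \<kappa>" "T s < T 0 + \<kappa>" using s0 \<kappa> by (auto simp: s_def intro!: s0(2))
  obtain d where d: "d > 0" "\<And>b. b0 < b \<and> b < b0 + d \<Longrightarrow>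
      (\<forall>x. \<bar>G b x - G b0 x\<bar> < s \<and> \<bar>G1 b x - G1 b0 x\<bar> < s) \<and> \<bar>C b - c\<bar> < s \<and> \<bar>K b - c\<bar> < s"
    using conv[OF s(1)] by blast
  have "((\<lambda>x. upper_bound (G b) x + a) ^^ q) (C b) \<le> C b + of_int p - \<kappa>"
    if b: "b0 < b" "b < b0 + min d (b1 - b0)" and l: "left_end (G b) \<omega> l" and a: "a \<le> l" for b l a
  proof -
    interpret bimodal_lift "G b" "G1 b" "G2 b" "G3 b" "C b" "K b" \<Lambda> using bim b by simp
    have close: "\<And>x. \<bar>G b x - G b0 x\<bar> < s" "\<bar>C b - c\<bar> < s" using d(2)[of b] b by auto
    have "l \<le> l0 + s"
    proof (rule left_end_le[OF lift0 lift l0 l])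
      show "G b0 x \<le> G b x + s" for x using close(1)[of x] by linarith
    qed
    have "upper_bound (G b) x \<le> upper_bound (G b0) x + s" for x
    proof (rule upper_bound_close[OF lift0 lift])
      show "G b x \<le> G b0 x + s" for x using close(1)[of x] by linarith
    qed
    then have le: "upper_bound (G b) x + a \<le> G b0 x + (l0 + 2 * s)" for x
      using \<open>l \<le> l0 + s\<close> a unfolding upper_G0 by (smt (verit))
    have "((\<lambda>x. upper_bound (G b) x + a) ^^ q) (C b) \<le> ((\<lambda>x. G b0 x + (l0 + 2 * s)) ^^ q) (C b)"
      by (rule mono_le_funpow[OF mono_add_const[OF G0_mono] le])
    also have "\<dots> \<le> T s"
      unfolding T_def using close(2) by (intro monoD[OF mono_funpow'[OF mono_add_const[OF G0_mono]]]) simp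
    also have "\<dots> \<le> C b + of_int p - \<kappa>" using close(2) s \<kappa> \<kappa>T by linarith
    finally show ?thesis .
  qed
  then show ?thesis using \<kappa> d(1) b01 by (intro exI[of _ \<kappa>] conjI exI[of _ "min d (b1 - b0)"]) auto
qed

text \<open>The witnesses are parameters at which the maximum is periodic with rotation number a left
  Farey neighbour \<open>p' / q'\<close> of \<open>\<omega>\<close>.\<close>

theorem equal_rotation_accumulates:
  assumes \<omega>: "\<omega> \<in> \<rat>"
  shows "\<exists>d>0. \<forall>b l e. b0 < b \<and> b < b0 + d \<and> left_end (G b) \<omega> l \<and> e > 0 \<longrightarrow>
    (\<exists>a. l - e < a \<and> a < l \<and>
      rotation (\<lambda>x. lower_bound (G b) x + a) = rotation (\<lambda>x. upper_bound (G b) x + a))"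
proof -
  obtain p qi :: int where "qi > 0" "coprime p qi" "\<omega> = of_int p / of_int qi"
    using Rats_cases'[OF \<omega>] by metis
  then obtain q where q: "0 < q" "coprime p (int q)" "\<omega> = of_int p / real q"
    by (metis of_nat_0_less_iff of_int_of_nat_eq zero_less_imp_eq_int)
  have qw: "real q * \<omega> = of_int p" using q by simp
  have \<Lambda>1: "\<Lambda> \<ge> 1" by (rule lip_lift_ge1[OF lift0])
  obtain \<kappa> d1 where \<kappa>: "\<kappa> > 0" "\<kappa> \<le> 1 / 4" and d1: "d1 > 0" and
    gap: "\<And>b l a. b0 < b \<Longrightarrow> b < b0 + d1 \<Longrightarrow> left_end (G b) \<omega> l \<Longrightarrow> a \<le> l \<Longrightarrow>
      ((\<lambda>x. upper_bound (G b) x + a) ^^ q) (C b) \<le> C b + of_int p - \<kappa>"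
    using uniform_gap[OF q(1) qw] by blast
  \<comment> \<open>The criterion is applied with \<open>l = c - 2 * \<delta>\<close> and
    \<open>r = c + 2 * \<delta>\<close>. The factor 8 leaves room in
    \<open>r \<le> C + \<kappa> / \<Lambda> ^ q\<close> for \<open>C b\<close> being only within
    \<delta> of \<open>c\<close>.\<close>
  define \<delta> where "\<delta> = \<kappa> / (8 * \<Lambda> ^ q)"
  have Lq: "\<Lambda> ^ q \<ge> 1" using \<Lambda>1 by (simp add: one_le_power)
  have \<delta>: "\<delta> > 0" "\<delta> \<le> \<kappa> / 8" "8 * \<delta> = \<kappa> / \<Lambda> ^ q"
  proof -
    have "\<kappa> / \<Lambda> ^ q \<le> \<kappa> / 1" using \<kappa> Lq by (intro divide_left_mono) auto
    then show "\<delta> > 0" "\<delta> \<le> \<kappa> / 8" "8 * \<delta> = \<kappa> / \<Lambda> ^ q" using \<kappa> Lq by (simp_all add: \<delta>_def)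
  qed
  have "\<exists>x\<in>{c + \<delta>..c + 1 - \<delta>}. \<forall>y\<in>{c + \<delta>..c + 1 - \<delta>}. G1 b0 x \<le> G1 b0 y"
    using \<delta> \<kappa> continuous_on_subset[OF cont0] by (intro continuous_attains_inf) auto
  then obtain xm where xm: "c + \<delta> \<le> xm" "xm \<le> c + 1 - \<delta>"
    "\<And>y. c + \<delta> \<le> y \<Longrightarrow> y \<le> c + 1 - \<delta> \<Longrightarrow> G1 b0 xm \<le> G1 b0 y" by auto
  \<comment> \<open>Half the minimum, so that \<open>m\<close> still bounds the derivative from
    below after a perturbation of size \<open>m\<close>.\<close>
  define m where "m = G1 b0 xm / 2"
  have m: "m > 0" using pos0[of xm] xm \<delta> by (simp add: m_def)
  define V where "V = 2 * (sqrt \<Lambda> / (sqrt m * \<delta>))"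
  have V: "V \<ge> 0" using m \<delta> \<Lambda>1 by (simp add: V_def)
  define \<mu> where "\<mu> = m * (\<kappa> / 2)"
  have \<mu>: "\<mu> > 0" using m \<kappa> by (simp add: \<mu>_def)
  \<comment> \<open>A slope near \<open>c\<close> so small that starting \<open>\<kappa>'\<close>
    below the maximum meets the last hypothesis of the criterion; the factor 2 allows for the
    perturbation of the derivative.\<close>
  define e1 where "e1 = \<mu> / (2 * (\<Lambda> ^ q * exp V))"
  have e1: "e1 > 0" "2 * e1 * (\<Lambda> ^ q * exp V) = \<mu>" using \<mu> Lq \<Lambda>1 by (auto simp: e1_def)
  have "isCont (G1 b0) c" using cont0 by (simp add: continuous_on_eq_continuous_at)
  then have "\<forall>\<^sub>F x in at c. G1 b0 x < e1" using crit0 e1 by (intro order_tendstoD(2)) (auto simp: isCont_def)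
  then obtain \<eta> where \<eta>: "\<eta> > 0" "\<And>x. x \<noteq> c \<Longrightarrow> dist x c < \<eta> \<Longrightarrow> G1 b0 x < e1" by (auto simp: eventually_at)
  define \<kappa>' where "\<kappa>' = min (\<eta> / 2) \<kappa>"
  have \<kappa>': "\<kappa>' > 0" "\<kappa>' \<le> \<kappa>" using \<eta> \<kappa> by (auto simp: \<kappa>'_def)
  have flat: "G1 b0 x < e1" if "\<bar>x - c\<bar> < 2 * \<kappa>'" for x
    using \<eta>(2)[of x] that crit0 e1 by (cases "x = c") (auto simp: \<kappa>'_def dist_real_def)
  \<comment> \<open>Half the least of three rises of \<open>G b0\<close>, so that the comparisons of
    values survive an error \<open>e2\<close> at both points.\<close>
  define e2 where "e2 = Min {G b0 (c - \<kappa>' / 4) - G b0 (c - \<kappa>' / 2), G b0 (c - \<delta>) - G b0 (c - 2 * \<delta>),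
    G b0 (c + 2 * \<delta>) - G b0 (c + \<delta>)} / 2"
  have "G b0 (c - \<kappa>' / 2) < G b0 (c - \<kappa>' / 4)" "G b0 (c - 2 * \<delta>) < G b0 (c - \<delta>)"
    by (rule G0_less_left; use \<kappa> \<delta> \<kappa>' in simp)+
  moreover have "G b0 (c + \<delta>) < G b0 (c + 2 * \<delta>)"
    by (rule G0_less; use \<kappa> \<delta> in simp)
  ultimately have e2: "e2 > 0" unfolding e2_def by simp
  have "2 * e2 \<le> G b0 (c - \<kappa>' / 4) - G b0 (c - \<kappa>' / 2)" "2 * e2 \<le> G b0 (c - \<delta>) - G b0 (c - 2 * \<delta>)"
    "2 * e2 \<le> G b0 (c + 2 * \<delta>) - G b0 (c + \<delta>)"
    unfolding e2_def by (simp_all add: min_le_iff_disj)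
  note gaps = this
  define e where "e = Min {\<delta>, \<kappa>' / 4, m, e1, e2}"
  have e: "e > 0" "e \<le> \<delta>" "e \<le> \<kappa>' / 4" "e \<le> m" "e \<le> e1" "e \<le> e2"
    unfolding e_def using \<delta> \<kappa>' m e1 e2 by auto
  obtain d2 where d2: "d2 > 0" "\<And>b. b0 < b \<and> b < b0 + d2 \<Longrightarrow>
      (\<forall>x. \<bar>G b x - G b0 x\<bar> < e \<and> \<bar>G1 b x - G1 b0 x\<bar> < e) \<and> \<bar>C b - c\<bar> < e \<and> \<bar>K b - c\<bar> < e"
    using conv[OF e(1)] by blast
  define d where "d = min d1 (min d2 (b1 - b0))"
  have d: "d > 0" using d1 d2 b01 by (simp add: d_def)
  have "\<exists>a. l - \<epsilon> < a \<and> a < l \<and>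
      rotation (\<lambda>x. lower_bound (G b) x + a) = rotation (\<lambda>x. upper_bound (G b) x + a)"
    if b: "b0 < b" "b < b0 + d" and l: "left_end (G b) \<omega> l" and \<epsilon>: "\<epsilon> > 0" for b l \<epsilon>
  proof -
    interpret b: bimodal_lift "G b" "G1 b" "G2 b" "G3 b" "C b" "K b" \<Lambda> using bim b by (simp add: d_def)
    let ?C = "C b" and ?U = "upper_bound (G b)"
    have close: "\<bar>G b x - G b0 x\<bar> < e" "\<bar>G1 b x - G1 b0 x\<bar> < e" "\<bar>C b - c\<bar> < e" "\<bar>K b - c\<bar> < e" for x
      using d2(2)[of b] b by (auto simp: d_def)
    have Ck: "c - \<delta> < ?C" "?C < c + \<delta>" "c - \<delta> < K b" "K b < c + \<delta>" "\<bar>?C - c\<bar> < \<kappa>' / 4" "\<bar>K b - c\<bar> < \<kappa>' / 4"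
      using close(3,4) e by linarith+
    have mF: "m \<le> G1 b x" if "c + \<delta> \<le> x" "x \<le> c + 1 - \<delta>" for x
      using close(2)[of x] xm(3)[OF that] e by (simp add: m_def)
    have FK: "G b (?C - \<kappa>') \<le> G b (K b)"
    proof -
      have "G b0 (?C - \<kappa>') \<le> G b0 (c - \<kappa>' / 2)" "G b0 (c - \<kappa>' / 4) \<le> G b0 (K b)"
        by (rule monoD[OF G0_mono]; use Ck(5,6) \<kappa>'(1) in linarith)+
      then show ?thesis using close(1)[of "?C - \<kappa>'"] close(1)[of "K b"] gaps(1) e by linarith
    qed
    have outl: "G b (c - 2 * \<delta>) \<le> G b (K b)"
    proof -
      have "G b0 (c - \<delta>) \<le> G b0 (K b)" using Ck by (intro monoD[OF G0_mono]) simp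
      then show ?thesis using close(1)[of "c - 2 * \<delta>"] close(1)[of "K b"] gaps(2) e by linarith
    qed
    have outr: "G b ?C \<le> G b (c + 2 * \<delta>)"
    proof -
      have "G b0 ?C \<le> G b0 (c + \<delta>)" using Ck by (intro monoD[OF G0_mono]) simp
      then show ?thesis using close(1)[of "c + 2 * \<delta>"] close(1)[of ?C] gaps(3) e by linarith
    qed
    have \<mu>F: "G b (?C - \<kappa>) + \<mu> \<le> G b ?C"
    proof -
      have lt: "c + \<delta> - \<kappa> < c - \<delta>" using \<delta> \<kappa> by simp
      obtain s where s: "c + \<delta> - \<kappa> < s" "s < c - \<delta>" "G b (c - \<delta>) - G b (c + \<delta> - \<kappa>) = (c - \<delta> - (c + \<delta> - \<kappa>)) * G1 b s"
        using MVT2[OF lt, of "G b" "G1 b"] b.d1 by auto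
      have "m \<le> G1 b s" using mF[of "s + 1"] b.F1_int[of s 1] s \<kappa> by simp
      then have "(\<kappa> / 2) * m \<le> (c - \<delta> - (c + \<delta> - \<kappa>)) * G1 b s"
        using \<delta> \<kappa> m by (intro mult_mono) auto
      moreover have "G b (?C - \<kappa>) < G b (c + \<delta> - \<kappa>)"
        using Ck \<delta> \<kappa> by (intro b.F_increasing_left) auto
      moreover have "G b (c - \<delta>) \<le> G b ?C" using Ck by (intro b.F_le_C) simp
      ultimately show ?thesis using s by (simp add: \<mu>_def mult.commute)
    qed
    have \<kappa>F: "\<Lambda> ^ q * exp V * (G b ?C - G b (?C - \<kappa>')) \<le> \<kappa>' * \<mu>"
    proof -
      have lt: "?C - \<kappa>' < ?C" using \<kappa>' by simp
      obtain s where s: "?C - \<kappa>' < s" "s < ?C" "G b ?C - G b (?C - \<kappa>') = (?C - (?C - \<kappa>')) * G1 b s"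
        using MVT2[OF lt, of "G b" "G1 b"] b.d1 by auto
      have "\<bar>s - c\<bar> < 2 * \<kappa>'" using s Ck \<kappa>' by linarith
      then have "G1 b s \<le> 2 * e1" using flat[of s] close(2)[of s] e by linarith
      then have "G b ?C - G b (?C - \<kappa>') \<le> \<kappa>' * (2 * e1)" using s \<kappa>' by simp
      then have "\<Lambda> ^ q * exp V * (G b ?C - G b (?C - \<kappa>')) \<le> \<Lambda> ^ q * exp V * (\<kappa>' * (2 * e1))"
        using Lq by (intro mult_left_mono) auto
      also have "\<dots> = \<kappa>' * (2 * e1 * (\<Lambda> ^ q * exp V))" by (simp only: mult_ac)
      finally show ?thesis using e1(2) by simp
    qed
    have VF: "G1 b x \<le> G1 b y * exp (V * \<bar>x - y\<bar>)"
      if "c + 2 * \<delta> \<le> x" "x \<le> c - 2 * \<delta> + 1" "c + 2 * \<delta> \<le> y" "y \<le> c - 2 * \<delta> + 1" for x y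
      unfolding V_def
    proof (rule b.log_lipschitz[OF \<delta>(1) _ _ m _ that])
      show "K b < c + 2 * \<delta> - \<delta>" "c - 2 * \<delta> + 1 + \<delta> < C b + 1" using Ck by auto
      show "m \<le> G1 b x \<and> G1 b x \<le> \<Lambda>" if "c + 2 * \<delta> - \<delta> \<le> x" "x \<le> c - 2 * \<delta> + 1 + \<delta>" for x
        using mF[of x] b.F1_le[of x] that by simp
    qed
    have Um: "mono (\<lambda>x. ?U x + a)" and Ud: "deg1 (\<lambda>x. ?U x + a)" for a
      by (intro mono_add_const deg1_add_const mono_upper_bound[OF b.lift]
          lip_lift_deg1[OF lip_lift_upper_bound[OF b.lift]])+
    define \<rho> where "\<rho> = rotation (\<lambda>x. ?U x + (l - \<epsilon>))"
    have \<rho>: "\<rho> < \<omega>" using l \<epsilon> by (simp add: left_end_def \<rho>_def)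
    obtain u v :: int where "u * p + v * int q = gcd p (int q)" using bezout_int by blast
    then have uv: "u * p + v * int q = 1" using q by simp
    obtain N :: nat where N: "1 / (\<omega> - \<rho>) < real N" using reals_Archimedean2 by blast
    \<comment> \<open>Bezout gives one Farey pair, and adding \<open>t * q\<close> and
      \<open>t * p\<close> runs through others: \<open>p * q' - q * p' = u * p + v * q = 1\<close>.
      A large \<open>t\<close> ensures \<open>q < q'\<close> and lifts
      \<open>p' / q' = \<omega> - 1 / (q * q')\<close> above the rotation number \<rho> at
      \<open>l - \<epsilon>\<close>.\<close>
    define t where "t = \<bar>u\<bar> + int N + int q + 1"
    define q' where "q' = nat (u + t * int q)"
    define p' where "p' = t * p - v"
    have "t * 1 \<le> t * int q" using q by (intro mult_left_mono) (auto simp: t_def)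
    then have tq: "t \<le> t * int q" by simp
    have t: "\<bar>u\<bar> + int N + int q < t" by (simp add: t_def)
    then have "0 \<le> u + t * int q" using tq by linarith
    then have q'1: "int q' = u + t * int q" by (simp add: q'_def)
    then have q'2: "q < q'" "N < q'" using tq t by linarith+
    have det: "p * int q' - int q * p' = 1" using uv by (simp add: q'1 p'_def algebra_simps)
    have q'0: "real q' > 0" using q'2 by simp
    have w': "of_int p' / real q' = \<omega> - 1 / (real q * real q')"
    proof -
      have "of_int (p * int q' - int q * p') = (1::real)" using det by simp
      then have "of_int p * real q' - real q * of_int p' = 1" by simp
      then show ?thesis unfolding q(3) using q(1) q'0 by (simp add: field_simps)
    qed
    have "\<rho> < of_int p' / real q'"
    proof -
      have "1 / (\<omega> - \<rho>) < real q * real q'"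
      proof -
        have "1 * real q' \<le> real q * real q'" using q by (intro mult_right_mono) auto
        then show ?thesis using N q'2 by linarith
      qed
      then have "1 < (real q * real q') * (\<omega> - \<rho>)" using \<rho> by (simp only: pos_divide_less_eq diff_gt_0_iff_gt)
      then have "1 / (real q * real q') < \<omega> - \<rho>"
        using q(1) q'0 by (simp add: pos_divide_less_eq mult.commute)
      then show ?thesis using w' by linarith
    qed
    \<comment> \<open>Taking \<open>a\<close> to be an integer \<open>k\<close> shifts the
      \<open>q'\<close>-th image by \<open>q' * k\<close>, so by continuity the image of the maximum
      takes every value.\<close>
    moreover have "\<exists>a. ((\<lambda>x. ?U x + a) ^^ q') ?C = ?C + of_int p'"
    proof -
      define f where "f a = ((\<lambda>x. ?U x + a) ^^ q') ?C" for a
      have fi: "f (of_int k) = f 0 + real q' * of_int k" for k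
        unfolding f_def using funpow_add_of_int[OF lip_lift_deg1[OF lip_lift_upper_bound[OF b.lift]], where k = k and n = q' and x = ?C] by simp
      define k where "k = \<lceil>\<bar>?C + of_int p' - f 0\<bar>\<rceil>"
      have k: "\<bar>?C + of_int p' - f 0\<bar> \<le> of_int k" "0 \<le> k" unfolding k_def by (linarith, simp)
      have "1 * of_int k \<le> real q' * of_int k" using q'2 k by (intro mult_right_mono) auto
      then have "f (of_int (- k)) \<le> ?C + of_int p'" "?C + of_int p' \<le> f (of_int k)"
        unfolding fi using k(1) by auto
      moreover have "continuous_on {of_int (- k)..of_int k} f"
        unfolding f_def using lip_lift_continuous[OF lip_lift_upper_bound[OF b.lift]]
        by (intro continuous_on_subset[OF continuous_on_funpow_translate]) (auto intro: continuous_intros)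
      ultimately show ?thesis using IVT'[of f "of_int (- k)" "?C + of_int p'" "of_int k"] k(2) unfolding f_def by auto
    qed
    then obtain a where a: "((\<lambda>x. ?U x + a) ^^ q') ?C = ?C + of_int p'" by blast
    have "real q' * rotation (\<lambda>x. ?U x + a) = of_int p'"
      using rotation_le[OF Um Ud, where k = q' and x = ?C and m = p']
        rotation_ge[OF Um Ud, where k = q' and x = ?C and m = p'] a by (intro order_antisym) auto
    then have ra: "rotation (\<lambda>x. ?U x + a) = of_int p' / real q'" using q'0 by (simp add: field_simps)
    ultimately have "\<rho> < rotation (\<lambda>x. ?U x + a)" by simp
    then have a1: "l - \<epsilon> < a"
      using rotation_upper_add_mono[OF b.lift, of a "l - \<epsilon>"] unfolding \<rho>_def by linarith
    have "rotation (\<lambda>x. ?U x + a) < \<omega>" using ra w' q q'0 by simp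
    then have a2: "a < l"
      using rotation_upper_add_mono[OF b.lift, of l a] l unfolding left_end_def by linarith
    interpret F: bimodal_lift "\<lambda>x. G b x + a" "G1 b" "G2 b" "G3 b" "C b" "K b" \<Lambda> by (rule b.add_bimodal)
    note ub = upper_bound_add[OF b.lift, of a] and lb = lower_bound_add[OF b.lift, of a]
    have "rotation (lower_bound (\<lambda>x. G b x + a)) = rotation (upper_bound (\<lambda>x. G b x + a))"
    proof (rule F.equal_rotation_criterion(1)[where p = p and q = q and p' = p' and q' = q' and
          l = "c - 2 * \<delta>" and r = "c + 2 * \<delta>" and \<kappa> = \<kappa> and \<kappa>' = \<kappa>' and \<mu> = \<mu> and V = V])
      show "(upper_bound (\<lambda>x. G b x + a) ^^ q') (C b) = C b + of_int p'" unfolding ub by (rule a)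
      show "(upper_bound (\<lambda>x. G b x + a) ^^ q) (C b) \<le> C b + of_int p - \<kappa>"
        unfolding ub using gap[of b l a] b l a2 by (simp add: d_def)
      show "c - 2 * \<delta> < C b" "K b < c + 2 * \<delta>" "c + 2 * \<delta> - 1 \<le> C b - \<kappa>" "C b - \<kappa> \<le> c - 2 * \<delta>"
        "c + 2 * \<delta> \<le> C b + \<kappa> / \<Lambda> ^ q"
        using Ck \<delta> \<kappa> by linarith+
    qed (use det q q'2 \<kappa> outl outr V VF \<mu> \<mu>F \<kappa>' FK \<kappa>F in auto)
    then show ?thesis using a1 a2 unfolding ub lb by blast
  qed
  then show ?thesis using d by (intro exI[of _ d]) blast
qed

end

section \<open>Local connectivity\<close>

text \<open>Each \<open>S\<close> crosses the frontier near \<open>p\<close> at a point where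
  \<open>R\<close> differs from \<open>R p\<close>; in particular \<open>p\<close> is itself a
  frontier point. A connected neighbourhood of \<open>p\<close> in the frontier would contain such a
  crossing, so its image under \<open>R\<close> would be uncountable, although frontier points in
  \<open>W\<close> belong to \<open>Z\<close> and have rational values.\<close>

lemma not_locally_connected_atI:
  fixes Z :: "(real \<times> real) set" and R :: "real \<times> real \<Rightarrow> real"
  assumes W: "open W" "p \<in> W" and R: "continuous_on W R"
    and closed: "\<And>x. x \<in> W \<Longrightarrow> x \<in> closure Z \<Longrightarrow> x \<in> Z"
    and rat: "\<And>x. x \<in> W \<Longrightarrow> x \<in> Z \<Longrightarrow> R x \<in> \<rat>"
    and acc: "\<And>e. e > 0 \<Longrightarrow> \<exists>S. connected S \<and> S \<subseteq> ball p e \<and> S \<inter> Z \<noteq> {} \<and> S - Z \<noteq> {} \<and> (\<forall>x\<in>S. R x \<noteq> R p)"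
  shows "not_locally_connected_at (frontier Z) p"
proof -
  have near: "\<exists>x. x \<in> frontier Z \<and> dist x p < e \<and> R x \<noteq> R p" if "e > 0" for e
  proof -
    obtain S where S: "connected S" "S \<subseteq> ball p e" "S \<inter> Z \<noteq> {}" "S - Z \<noteq> {}" "\<forall>x\<in>S. R x \<noteq> R p"
      using acc[OF \<open>e > 0\<close>] by blast
    then obtain x where "x \<in> S" "x \<in> frontier Z" using connected_Int_frontier[of S Z] by blast
    then show ?thesis using S by (intro exI[of _ x]) (auto simp: dist_commute)
  qed
  have "p \<in> closure (frontier Z)"
    unfolding closure_approachable using near by blast
  then have p: "p \<in> frontier Z" by (simp add: closure_closed)
  have "\<not> locally_connected_at p (top_of_set (frontier Z))"
  proof
    assume "locally_connected_at p (top_of_set (frontier Z))"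
    moreover have "openin (top_of_set (frontier Z)) (frontier Z \<inter> W)"
      using W by (simp add: openin_open_Int)
    moreover have "p \<in> frontier Z \<inter> W" using p W by simp
    ultimately obtain U V where UV: "openin (top_of_set (frontier Z)) U" "connectedin (top_of_set (frontier Z)) V"
        "p \<in> U" "U \<subseteq> V" "V \<subseteq> frontier Z \<inter> W"
      unfolding locally_connected_at_def neighbourhood_base_at_def by meson
    obtain T where T: "open T" "U = frontier Z \<inter> T" using UV(1) by (auto simp: openin_open)
    then obtain e where e: "e > 0" "ball p e \<subseteq> T" using UV(3) openE by blast
    obtain x where x: "x \<in> frontier Z" "dist x p < e" "R x \<noteq> R p" using near[OF e(1)] by blast
    have "x \<in> ball p e" using x(2) by (simp add: dist_commute)
    then have xV: "x \<in> V" using x(1) e(2) T(2) UV(4) by blast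
    have "connected (R ` V)"
      using UV(2,5) by (intro connected_continuous_image continuous_on_subset[OF R])
        (auto simp: connectedin_subtopology)
    moreover have "R x \<in> R ` V" "R p \<in> R ` V" using xV UV by auto
    ultimately have "uncountable (R ` V)" using x(3) by (intro connected_uncountable) auto
    moreover have "R ` V \<subseteq> \<rat>"
    proof
      fix r assume "r \<in> R ` V"
      then obtain v where "v \<in> V" "r = R v" by blast
      then have "v \<in> W" "v \<in> closure Z" using UV(5) by (auto simp: frontier_def)
      then show "r \<in> \<rat>" using closed rat \<open>r = R v\<close> by blast
    qed
    ultimately show False using countable_rat countable_subset by blast
  qed
  then show ?thesis using p by (simp add: not_locally_connected_at_def)
qed

section \<open>Arcs and joint continuity in the parameters\<close>

lemma graph_arc:
  fixes g :: "real \<Rightarrow> real"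
  assumes "b < b'" "continuous_on {b..b'} g" "\<And>t. b \<le> t \<Longrightarrow> t \<le> b' \<Longrightarrow> Q (g t, t)"
  shows "\<exists>\<gamma>. arc \<gamma> \<and> (\<forall>p\<in>path_image \<gamma>. Q p)"
proof -
  define s where "s t = b + t * (b' - b)" for t
  define \<gamma> where "\<gamma> t = (g (s t), s t)" for t
  have s: "b \<le> s t" "s t \<le> b'" if "0 \<le> t" "t \<le> 1" for t
  proof -
    define w where "w = t * (b' - b)"
    have "w \<le> 1 * (b' - b)" "0 \<le> w" unfolding w_def
      using that assms(1) by (intro mult_right_mono mult_nonneg_nonneg; simp)+
    then have "b \<le> s t \<and> s t \<le> b'" by (simp add: s_def flip: w_def)
    then show "b \<le> s t" "s t \<le> b'" by auto
  qed
  have "continuous_on {0..1} s" unfolding s_def by (intro continuous_intros)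
  moreover have "continuous_on {0..1} (\<lambda>t. g (s t))"
    using s by (intro continuous_on_compose2[OF assms(2) calculation]) auto
  ultimately have "path \<gamma>" unfolding path_def \<gamma>_def by (intro continuous_on_Pair)
  moreover have "inj_on \<gamma> {0..1}" using assms(1) by (auto simp: inj_on_def \<gamma>_def s_def)
  ultimately have "arc \<gamma>" by (simp add: arc_def)
  moreover have "\<forall>p\<in>path_image \<gamma>. Q p" using assms(3) s by (auto simp: path_image_def \<gamma>_def)
  ultimately show ?thesis by blast
qed

text \<open>A change of the map by less than \<open>d / 2\<close> is absorbed in a translation by
  \<open>d / 2\<close>, which reduces joint continuity to continuity in \<open>a\<close>
  alone.\<close>

lemma continuous_rotation_upper_family:
  fixes G :: "real \<Rightarrow> real \<Rightarrow> real"
  assumes lift: "\<And>b. b0 < b \<Longrightarrow> b < b1 \<Longrightarrow> lip_lift \<Lambda> (G b)"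
    and cont: "\<And>b e. b0 < b \<Longrightarrow> b < b1 \<Longrightarrow> e > 0 \<Longrightarrow> \<exists>d>0. \<forall>b'. \<bar>b' - b\<bar> < d \<longrightarrow> (\<forall>x. \<bar>G b' x - G b x\<bar> < e)"
  shows "continuous_on (UNIV \<times> {b0<..<b1}) (\<lambda>(a, b). rotation (\<lambda>x. upper_bound (G b) x + a))"
proof -
  let ?R = "\<lambda>a b. rotation (\<lambda>x. upper_bound (G b) x + a)"
  have "\<exists>d>0. \<forall>p'\<in>UNIV \<times> {b0<..<b1}. dist p' (a, b) < d \<longrightarrow> dist (?R (fst p') (snd p')) (?R a b) < e"
    if b: "b0 < b" "b < b1" and e: "e > 0" for a b e
  proof -
    have "continuous_on UNIV (\<lambda>a. ?R a b)" by (rule continuous_rotation_upper_add[OF lift[OF b]])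
    then obtain d where d: "d > 0" "\<And>t. dist t a < d \<Longrightarrow> dist (?R t b) (?R a b) < e"
      unfolding continuous_on_iff using e by (metis UNIV_I)
    obtain d' where d': "d' > 0" "\<And>b' x. \<bar>b' - b\<bar> < d' \<Longrightarrow> \<bar>G b' x - G b x\<bar> < d / 2"
      using cont[OF b, of "d / 2"] d by auto
    have "dist (?R a' b') (?R a b) < e" if p: "b0 < b'" "b' < b1" "dist (a', b') (a, b) < min (d / 2) d'" for a' b'
    proof -
      have ab: "\<bar>a' - a\<bar> < d / 2" "\<bar>b' - b\<bar> < d'"
        using dist_fst_le[of "(a', b')" "(a, b)"] dist_snd_le[of "(a', b')" "(a, b)"] p
        by (auto simp: dist_real_def)
      have c: "\<bar>G b' x - G b x\<bar> < d / 2" for x using d'(2)[OF ab(2)] .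
      have u1: "upper_bound (G b') x \<le> upper_bound (G b) x + d / 2" for x
      proof (rule upper_bound_close[OF lift[OF b] lift[OF p(1,2)]])
        show "G b' x \<le> G b x + d / 2" for x using c[of x] by linarith
      qed
      have u2: "upper_bound (G b) x \<le> upper_bound (G b') x + d / 2" for x
      proof (rule upper_bound_close[OF lift[OF p(1,2)] lift[OF b]])
        show "G b x \<le> G b' x + d / 2" for x using c[of x] by linarith
      qed
      have "?R a' b' \<le> ?R (a' + d / 2) b"
        using u1 lift[OF b] lift[OF p(1,2)]
        by (intro rotation_mono mono_add_const deg1_add_const mono_upper_bound lip_lift_deg1 lip_lift_upper_bound)
           (auto simp: algebra_simps)
      moreover have "?R (a' - d / 2) b \<le> ?R a' b'"
        using u2 lift[OF b] lift[OF p(1,2)]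
        by (intro rotation_mono mono_add_const deg1_add_const mono_upper_bound lip_lift_deg1 lip_lift_upper_bound)
           (auto simp: algebra_simps)
      moreover have "dist (?R (a' + d / 2) b) (?R a b) < e" "dist (?R (a' - d / 2) b) (?R a b) < e"
        by (rule d(2), subst dist_real_def, use ab(1) in linarith)+
      ultimately show ?thesis by (simp add: dist_real_def)
    qed
    then show ?thesis using d d' by (intro exI[of _ "min (d / 2) d'"]) auto
  qed
  then show ?thesis unfolding continuous_on_iff by (auto simp: case_prod_beta)
qed

lemma rotation_lower_add_flip:
  assumes "lip_lift \<Lambda> F"
  shows "rotation (\<lambda>x. lower_bound F x + a) = - rotation (\<lambda>x. upper_bound (flip F) x - a)"
proof -
  note U = mono_upper_bound[OF lip_lift_flip[OF assms]]
    lip_lift_deg1[OF lip_lift_upper_bound[OF lip_lift_flip[OF assms]]]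
  have "(\<lambda>x. lower_bound F x + a) = flip (\<lambda>x. upper_bound (flip F) x + (- a))"
    unfolding lower_bound_flip by (simp add: flip_def fun_eq_iff)
  then show ?thesis
    using rotation_flip[OF mono_add_const[OF U(1)] deg1_add_const[OF U(2)], of "- a"] by simp
qed

context bimodal_unfolding
begin

lemma lift: "b0 < b \<Longrightarrow> b < b1 \<Longrightarrow> lip_lift \<Lambda> (G b)"
  using bim bimodal_lift.lift by blast

lemma flip_unfolding:
  "bimodal_unfolding (\<lambda>b. flip (G b)) (\<lambda>b x. G1 b (- x)) (\<lambda>b x. - G2 b (- x)) (\<lambda>b x. G3 b (- x))
     (\<lambda>b. - K b) (\<lambda>b. - C b) b0 b1 (- c) \<Lambda>"
proof (rule bimodal_unfolding.intro)
  have m: "(uminus has_real_derivative - 1) (at x)" for x :: real by (auto intro!: derivative_eq_intros)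
  show "bimodal_lift (flip (G b)) (\<lambda>x. G1 b (- x)) (\<lambda>x. - G2 b (- x)) (\<lambda>x. G3 b (- x)) (- K b) (- C b) \<Lambda>"
    if "b0 < b" "b < b1" for b
    by (rule bimodal_lift.flip_bimodal[OF bim[OF that]])
  show "(flip (G b0) has_real_derivative G1 b0 (- x)) (at x)" for x
    using DERIV_minus[OF DERIV_chain2[OF deriv0 m]] by (simp add: flip_def[abs_def])
  show "continuous_on UNIV (\<lambda>x. G1 b0 (- x))"
    by (intro continuous_on_compose2[OF cont0] continuous_intros) auto
  show "0 < G1 b0 (- x)" if "- c < x" "x < - c + 1" for x
    using pos0[of "- x + 1"] G1_int[of "- x" 1] that by simp
  show "\<exists>d>0. \<forall>b. b0 < b \<and> b < b0 + d \<longrightarrow>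
      (\<forall>x. \<bar>flip (G b) x - flip (G b0) x\<bar> < e \<and> \<bar>G1 b (- x) - G1 b0 (- x)\<bar> < e) \<and>
      \<bar>- K b - - c\<bar> < e \<and> \<bar>- C b - - c\<bar> < e" if "e > 0" for e
  proof -
    obtain d where d: "d > 0" "\<And>b. b0 < b \<and> b < b0 + d \<Longrightarrow>
      (\<forall>x. \<bar>G b x - G b0 x\<bar> < e \<and> \<bar>G1 b x - G1 b0 x\<bar> < e) \<and> \<bar>C b - c\<bar> < e \<and> \<bar>K b - c\<bar> < e"
      using conv[OF \<open>e > 0\<close>] by blast
    then show ?thesis by (intro exI[of _ d]) (auto simp: flip_def abs_minus_commute)
  qed
qed (use b01 crit0 lip_lift_flip[OF lift0] in auto)

text \<open>The sign \<open>\<sigma>\<close> lets the same statement serve for both sides of the tongue: the right side of the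
  family is the left side of the flipped family, with \<open>a\<close> replaced by \<open>- a\<close>.\<close>

theorem tongue_side_not_locally_connected:
  fixes Z :: "(real \<times> real) set" and \<sigma> :: real
  assumes \<omega>: "\<omega> \<in> \<rat>" and \<sigma>: "\<bar>\<sigma>\<bar> = 1"
    and cont: "\<And>b e. b0 < b \<Longrightarrow> b < b1 \<Longrightarrow> e > 0 \<Longrightarrow> \<exists>d>0. \<forall>b'. \<bar>b' - b\<bar> < d \<longrightarrow> (\<forall>x. \<bar>G b' x - G b x\<bar> < e)"
    and Z: "\<And>a b. b0 < b \<Longrightarrow> b < b1 \<Longrightarrow> (\<sigma> * a, b) \<in> Z \<longleftrightarrow>
      rotation (\<lambda>x. lower_bound (G b) x + a) = rotation (\<lambda>x. upper_bound (G b) x + a)"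
  shows "\<exists>\<gamma>. arc \<gamma> \<and> (\<forall>p\<in>path_image \<gamma>. b0 < snd p \<and> snd p < b1 \<and>
      left_end (G (snd p)) \<omega> (\<sigma> * fst p) \<and> not_locally_connected_at (frontier Z) p)"
proof -
  have ss: "\<sigma> * (\<sigma> * a) = a" for a
    using \<sigma> by (metis abs_mult_self_eq mult.assoc mult_1)
  define ru where "ru a b = rotation (\<lambda>x. upper_bound (G b) x + a)" for a b
  define rl where "rl a b = rotation (\<lambda>x. lower_bound (G b) x + a)" for a b
  define W where "W = (UNIV :: real set) \<times> {b0<..<b1}"
  have W: "open W" by (simp add: W_def open_Times)
  have cu: "continuous_on W (\<lambda>(a, b). ru a b)"
    unfolding W_def ru_def by (rule continuous_rotation_upper_family[OF lift cont])
  interpret fl: bimodal_unfolding "\<lambda>b. flip (G b)" "\<lambda>b x. G1 b (- x)" "\<lambda>b x. - G2 b (- x)" "\<lambda>b x. G3 b (- x)"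
    "\<lambda>b. - K b" "\<lambda>b. - C b" b0 b1 "- c" \<Lambda> by (rule flip_unfolding)
  have cfl: "continuous_on W (\<lambda>(a, b). rotation (\<lambda>x. upper_bound (flip (G b)) x + a))"
    unfolding W_def
  proof (rule continuous_rotation_upper_family[OF fl.lift])
    fix b e :: real assume "b0 < b" "b < b1" "e > 0"
    then obtain d where "d > 0" "\<And>b' x. \<bar>b' - b\<bar> < d \<Longrightarrow> \<bar>G b' x - G b x\<bar> < e" using cont by blast
    then show "\<exists>d>0. \<forall>b'. \<bar>b' - b\<bar> < d \<longrightarrow> (\<forall>x. \<bar>flip (G b') x - flip (G b) x\<bar> < e)"
      by (intro exI[of _ d]) (auto simp: flip_def abs_minus_commute)
  qed
  have cl: "continuous_on W (\<lambda>(a, b). rl a b)"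
  proof -
    have "continuous_on W (\<lambda>p. - ((\<lambda>(a, b). rotation (\<lambda>x. upper_bound (flip (G b)) x + a)) (- fst p, snd p)))"
      by (intro continuous_intros continuous_on_compose2[OF cfl]) (auto simp: W_def)
    then show ?thesis
      by (rule continuous_on_eq) (auto simp: W_def rl_def rotation_lower_add_flip[OF lift])
  qed
  define R where "R p = ru (\<sigma> * fst p) (snd p)" for p
  have cR: "continuous_on W R"
  proof -
    have "continuous_on W (\<lambda>p. (\<lambda>(a, b). ru a b) (\<sigma> * fst p, snd p))"
      by (intro continuous_on_compose2[OF cu] continuous_intros) (auto simp: W_def)
    then show ?thesis by (simp add: R_def[abs_def])
  qed
  define R' where "R' p = rl (\<sigma> * fst p) (snd p)" for p
  have cR': "continuous_on W R'"
  proof -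
    have "continuous_on W (\<lambda>p. (\<lambda>(a, b). rl a b) (\<sigma> * fst p, snd p))"
      by (intro continuous_on_compose2[OF cl] continuous_intros) (auto simp: W_def)
    then show ?thesis by (simp add: R'_def[abs_def])
  qed
  have ZW: "p \<in> Z \<longleftrightarrow> R' p = R p" if "p \<in> W" for p
    using that Z[of "snd p" "\<sigma> * fst p"] by (cases p) (auto simp: W_def R_def R'_def ru_def rl_def ss)
  have rat: "R p \<in> \<rat>" if "p \<in> W" "p \<in> Z" for p
  proof (rule ccontr)
    assume irr: "R p \<notin> \<rat>"
    have b: "b0 < snd p" "snd p < b1" using that by (auto simp: W_def)
    interpret b: bimodal_lift "G (snd p)" "G1 (snd p)" "G2 (snd p)" "G3 (snd p)" "C (snd p)" "K (snd p)" \<Lambda>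
      using bim b by simp
    interpret a: bimodal_lift "\<lambda>x. G (snd p) x + \<sigma> * fst p" "G1 (snd p)" "G2 (snd p)" "G3 (snd p)" "C (snd p)" "K (snd p)" \<Lambda>
      by (rule b.add_bimodal)
    show False
      using a.rotation_bounds_distinct irr ZW[OF that(1)] that(2)
      unfolding upper_bound_add[OF b.lift] lower_bound_add[OF b.lift] by (simp add: R_def R'_def ru_def rl_def)
  qed
  \<comment> \<open>Within \<open>W\<close> the set is where two continuous functions agree.\<close>
  have closedZ: "p \<in> Z" if "p \<in> W" "p \<in> closure Z" for p
  proof -
    have "closedin (top_of_set W) {x \<in> W. R' x - R x = 0}"
      by (intro continuous_closedin_preimage_constant continuous_intros cR cR')
    then obtain T where T: "closed T" "{x \<in> W. R' x - R x = 0} = W \<inter> T" by (auto simp: closedin_closed)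
    have "p \<in> closure (W \<inter> Z)"
      using that W open_Int_closure_subset[of W Z] by blast
    moreover have "W \<inter> Z \<subseteq> T" using T ZW by auto
    ultimately have "p \<in> T" using T(1) closure_minimal by blast
    then show ?thesis using T(2) that ZW by auto
  qed
  obtain d where d: "d > 0" and acc: "\<And>b l e. b0 < b \<Longrightarrow> b < b0 + d \<Longrightarrow> left_end (G b) \<omega> l \<Longrightarrow> e > 0 \<Longrightarrow>
    \<exists>a. l - e < a \<and> a < l \<and> rotation (\<lambda>x. lower_bound (G b) x + a) = rotation (\<lambda>x. upper_bound (G b) x + a)"
    using equal_rotation_accumulates[OF \<omega>] by metis
  \<comment> \<open>Both heights lie strictly between \<open>b0\<close> and \<open>b0 + d\<close>,
    where the accumulation of witnesses is available.\<close>
  define b3 where "b3 = b0 + min d (b1 - b0) / 2"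
  define b2 where "b2 = b0 + min d (b1 - b0) / 4"
  have b23: "b0 < b2" "b2 < b3" "b3 < b0 + d" "b3 < b1" using d b01 by (auto simp: b2_def b3_def min_def field_simps)
  define l where "l b = (SOME l. left_end (G b) \<omega> l)" for b
  have l: "left_end (G b) \<omega> (l b)" if "b0 < b" "b < b1" for b
    unfolding l_def by (rule someI_ex) (rule left_end_exists[OF lift[OF that]])
  have contl: "continuous_on {b2..b3} l"
    unfolding continuous_on_iff
  proof (intro ballI allI impI)
    fix b e :: real assume b: "b \<in> {b2..b3}" and e: "e > 0"
    then have bb: "b0 < b" "b < b1" using b23 by auto
    obtain d where d: "d > 0" "\<And>b' x. \<bar>b' - b\<bar> < d \<Longrightarrow> \<bar>G b' x - G b x\<bar> < e / 2"
      using cont[OF bb, of "e / 2"] e by auto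
    show "\<exists>d>0. \<forall>b'\<in>{b2..b3}. dist b' b < d \<longrightarrow> dist (l b') (l b) < e"
    proof (intro exI[of _ d] conjI ballI impI)
      fix b' assume b': "b' \<in> {b2..b3}" "dist b' b < d"
      then have bb': "b0 < b'" "b' < b1" using b23 by auto
      have c: "\<bar>G b' x - G b x\<bar> < e / 2" for x using d(2)[of b' x] b' by (simp add: dist_real_def)
      have "l b' \<le> l b + e / 2"
      proof (rule left_end_le[OF lift[OF bb] lift[OF bb'] l[OF bb] l[OF bb']])
        show "G b x \<le> G b' x + e / 2" for x using c[of x] by linarith
      qed
      moreover have "l b \<le> l b' + e / 2"
      proof (rule left_end_le[OF lift[OF bb'] lift[OF bb] l[OF bb'] l[OF bb]])
        show "G b' x \<le> G b x + e / 2" for x using c[of x] by linarith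
      qed
      ultimately show "dist (l b') (l b) < e" using e by (simp add: dist_real_def)
    qed (rule d(1))
  qed
  have bad: "not_locally_connected_at (frontier Z) (\<sigma> * l b, b)" if b: "b2 \<le> b" "b \<le> b3" for b
  proof (rule not_locally_connected_atI[OF W _ cR])
    have bb: "b0 < b" "b < b1" "b < b0 + d" using b b23 by auto
    have Rl: "R (\<sigma> * l b, b) = \<omega>" using l[OF bb(1,2)] by (simp add: R_def ru_def ss left_end_def)
    show "(\<sigma> * l b, b) \<in> W" using bb by (simp add: W_def)
    fix e :: real assume e: "e > 0"
    obtain a where a: "l b - e < a" "a < l b" "rl a b = ru a b"
      using acc[OF bb(1,3) l[OF bb(1,2)] e] unfolding rl_def ru_def by blast
    have mono: "ru s b \<le> ru t b" if "s \<le> t" for s t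
      unfolding ru_def by (rule rotation_upper_add_mono[OF lift[OF bb(1,2)] that])
    have ra: "ru a b < \<omega>" and rlb: "ru (l b) b = \<omega>" using l[OF bb(1,2)] a by (auto simp: left_end_def ru_def)
    \<comment> \<open>An irrational value strictly between those at the witness and at the side. The
      segment stops where it is taken, so it has left \<open>Z\<close> at its end while its rotation
      numbers are still below \<omega>.\<close>
    have "uncountable {ru a b<..<\<omega>}" using ra uncountable_open_interval by blast
    then have "\<not> {ru a b<..<\<omega>} \<subseteq> \<rat>" using countable_rat countable_subset by blast
    then obtain \<theta> where "\<theta> \<in> {ru a b<..<\<omega>}" and irr: "\<theta> \<notin> \<rat>" by blast
    then have \<theta>: "ru a b < \<theta>" "\<theta> < \<omega>" by auto
    have "continuous_on {a..l b} (\<lambda>t. ru t b)"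
      unfolding ru_def using continuous_rotation_upper_add[OF lift[OF bb(1,2)]] continuous_on_subset by blast
    then obtain a' where a': "a \<le> a'" "a' \<le> l b" "ru a' b = \<theta>"
      using IVT'[of "\<lambda>t. ru t b" a \<theta> "l b"] \<theta> rlb a by auto
    define S where "S = (\<lambda>t. (\<sigma> * t, b)) ` {a..a'}"
    show "\<exists>S. connected S \<and> S \<subseteq> ball (\<sigma> * l b, b) e \<and> S \<inter> Z \<noteq> {} \<and> S - Z \<noteq> {} \<and>
        (\<forall>x\<in>S. R x \<noteq> R (\<sigma> * l b, b))"
    proof (intro exI[of _ S] conjI)
      show "connected S" unfolding S_def
        by (intro connected_continuous_image continuous_intros) simp
      show "S \<subseteq> ball (\<sigma> * l b, b) e"
      proof
        fix x assume "x \<in> S"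
        then obtain t where t: "x = (\<sigma> * t, b)" "a \<le> t" "t \<le> a'" unfolding S_def by fastforce
        have "dist (\<sigma> * l b, b) x = \<bar>\<sigma> * (l b - t)\<bar>" by (simp add: t dist_Pair_Pair dist_real_def algebra_simps)
        also have "\<dots> = \<bar>l b - t\<bar>" using \<sigma> by (simp add: abs_mult)
        finally show "x \<in> ball (\<sigma> * l b, b) e" using t a a' by simp
      qed
      have "(\<sigma> * a, b) \<in> S" using a' by (auto simp: S_def)
      moreover have "(\<sigma> * a, b) \<in> Z" using ZW[of "(\<sigma> * a, b)"] a bb by (simp add: W_def R_def R'_def ss)
      ultimately show "S \<inter> Z \<noteq> {}" by blast
      have "(\<sigma> * a', b) \<in> S" using a' by (auto simp: S_def)
      moreover have "(\<sigma> * a', b) \<notin> Z"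
        using rat[of "(\<sigma> * a', b)"] a' irr bb by (auto simp: W_def R_def ss)
      ultimately show "S - Z \<noteq> {}" by blast
      show "\<forall>x\<in>S. R x \<noteq> R (\<sigma> * l b, b)"
        unfolding Rl using mono a' \<theta> by (force simp: S_def R_def ss)
    qed
  qed (fact closedZ rat)+
  have "continuous_on {b2..b3} (\<lambda>b. \<sigma> * l b)" by (intro continuous_intros contl)
  from graph_arc[OF b23(2) this, where Q = "\<lambda>p. b0 < snd p \<and> snd p < b1 \<and>
      left_end (G (snd p)) \<omega> (\<sigma> * fst p) \<and> not_locally_connected_at (frontier Z) p"]
  show ?thesis using bad l b23 by (auto simp: ss)
qed

end

section \<open>Class N\<close>

lemma nonzero_continuous_sign:
  fixes g :: "real \<Rightarrow> real"
  assumes "continuous_on UNIV g" "\<And>x. s < x \<Longrightarrow> x < t \<Longrightarrow> g x \<noteq> 0"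
    and x: "s < x" "x < t" "g x > 0" and y: "s < y" "y < t"
  shows "g y > 0"
proof (rule ccontr)
  assume neg: "\<not> g y > 0"
  have "\<exists>z. s < z \<and> z < t \<and> g z = 0"
  proof (cases "x \<le> y")
    case True
    then obtain z where "x \<le> z" "z \<le> y" "g z = 0"
      using IVT2'[of g y 0 x] neg x continuous_on_subset[OF assms(1)] by fastforce
    then show ?thesis using x y by (intro exI[of _ z]) auto
  next
    case False
    then obtain z where "y \<le> z" "z \<le> x" "g z = 0"
      using IVT'[of g y 0 x] neg x continuous_on_subset[OF assms(1)] by fastforce
    then show ?thesis using x y by (intro exI[of _ z]) auto
  qed
  then show False using assms(2) by blast
qed

lemma C3_derivs:
  assumes "C3 F"
  shows "(F has_real_derivative deriv F x) (at x)"
    and "(deriv F has_real_derivative (deriv ^^ 2) F x) (at x)"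
    and "((deriv ^^ 2) F has_real_derivative (deriv ^^ 3) F x) (at x)"
proof -
  have "((deriv ^^ k) F has_real_derivative (deriv ^^ Suc k) F x) (at x)" if "k < 3" for k
  proof -
    have "(deriv ^^ k) F differentiable (at x)"
      using assms that by (auto simp: C3_def differentiable_on_def)
    then show ?thesis by (simp add: DERIV_deriv_iff_real_differentiable)
  qed
  from this[of 0] this[of 1] this[of 2]
  show "(F has_real_derivative deriv F x) (at x)"
    "(deriv F has_real_derivative (deriv ^^ 2) F x) (at x)"
    "((deriv ^^ 2) F has_real_derivative (deriv ^^ 3) F x) (at x)"
    by (simp_all add: numeral_2_eq_2 numeral_3_eq_3)
qed

lemma lip_liftI:
  assumes "deg1 F" "\<And>x. (F has_real_derivative F1 x) (at x)" "\<And>x. \<bar>F1 x\<bar> \<le> \<Lambda>"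
  shows "lip_lift \<Lambda> F"
proof -
  have *: "\<bar>F x - F y\<bar> \<le> \<Lambda> * \<bar>x - y\<bar>" if "x < y" for x y
  proof -
    obtain z where "F y - F x = (y - x) * F1 z" using MVT2[OF \<open>x < y\<close>, of F F1] assms(2) by auto
    then have "\<bar>F x - F y\<bar> = \<bar>x - y\<bar> * \<bar>F1 z\<bar>" by (metis abs_minus_commute abs_mult)
    also have "\<dots> \<le> \<bar>x - y\<bar> * \<Lambda>" using assms(3) by (intro mult_left_mono) auto
    finally show ?thesis by (simp add: mult.commute)
  qed
  have "\<bar>F x - F y\<bar> \<le> \<Lambda> * \<bar>x - y\<bar>" for x y
    using *[of x y] *[of y x] by (cases x y rule: linorder_cases) (auto simp: abs_minus_commute)
  then show ?thesis using assms(1) by (simp add: lip_lift_def)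
qed

lemma uniform_limit_line:
  fixes \<Phi> :: "real \<Rightarrow> real \<Rightarrow> real \<Rightarrow> real"
  assumes "uniform_limit UNIV (\<lambda>p. \<Phi> (fst p) (snd p)) (\<Phi> a b) (at (a, b))" "e > 0"
  shows "\<exists>d>0. \<forall>b'. \<bar>b' - b\<bar> < d \<longrightarrow> (\<forall>x. \<bar>\<Phi> a b' x - \<Phi> a b x\<bar> < e)"
proof -
  obtain d where d: "d > 0" "\<And>p x. p \<noteq> (a, b) \<Longrightarrow> dist p (a, b) < d \<Longrightarrow> dist (\<Phi> (fst p) (snd p) x) (\<Phi> a b x) < e"
    using uniform_limitD[OF assms] by (auto simp: eventually_at)
  have "\<bar>\<Phi> a b' x - \<Phi> a b x\<bar> < e" if "\<bar>b' - b\<bar> < d" for b' x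
    using d(2)[of "(a, b')" x] that assms(2)
    by (cases "b' = b") (auto simp: dist_Pair_Pair dist_real_def)
  then show ?thesis using d(1) by blast
qed

text \<open>The critical points cut a period into two arcs on which the derivative has constant
  sign. Decrease right of \<open>C\<close> settles the first sign; increase right of
  \<open>K\<close>, through the mean value theorem, settles the second.\<close>

lemma class_N_bimodal:
  assumes cB: "class_B H" and crit: "critical_points H = {C, K}" and CK: "0 \<le> C" "C < K" "K < 1"
    and turn: "turning_max H C" "turning_min H K" and lift: "lip_lift \<Lambda> H"
  shows "bimodal_lift H (deriv H) ((deriv ^^ 2) H) ((deriv ^^ 3) H) C K \<Lambda>"
proof (rule bimodal_lift.intro)
  have c3: "C3 H" using cB by (simp add: class_B_def)
  note d = C3_derivs[OF c3]
  have cont: "continuous_on UNIV (deriv H)"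
    using d(2) by (intro DERIV_continuous_on) (auto intro: has_field_derivative_at_within)
  have per: "deriv H (x + of_int m) = deriv H x" for x m
    by (rule deg1_deriv_add_of_int[OF lip_lift_deg1[OF lift] d(1)])
  have zero: "deriv H x = 0 \<longleftrightarrow> x = C \<or> x = K" if "0 \<le> x" "x < 1" for x
    using crit that unfolding critical_points_def by auto
  show zC: "deriv H C = 0" and zK: "deriv H K = 0" using zero CK by auto
  have nz1: "deriv H x \<noteq> 0" if "C < x" "x < K" for x
    using zero[of x] that CK by auto
  have nz2: "deriv H x \<noteq> 0" if "K < x" "x < C + 1" for x
  proof (cases "x < 1")
    case True
    then show ?thesis using zero[of x] that CK by auto
  next
    case False
    then show ?thesis using zero[of "x - 1"] per[of "x - 1" 1] that CK by auto
  qed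
  have nonpos1: "\<not> deriv H x > 0" if x: "C < x" "x < K" for x
  proof
    assume px: "deriv H x > 0"
    obtain e where e: "e > 0" "strict_antimono_on {C..C + e} H"
      using turn(1) unfolding turning_max_def by blast
    define y where "y = C + min e ((K - C) / 2)"
    have y: "C < y" "y \<le> C + e" "y < K" using e CK by (auto simp: y_def min_def field_simps)
    have "H C < H y"
    proof (rule DERIV_pos_imp_increasing_open[OF y(1)])
      fix z assume z: "C < z" "z < y"
      then have "deriv H z > 0" using nonzero_continuous_sign[OF cont nz1 x px, of z] y by simp
      then show "\<exists>D. (H has_real_derivative D) (at z) \<and> 0 < D" using d(1) by blast
    qed (rule lip_lift_continuous[OF lift])
    moreover have "H y < H C" using e(2) y by (auto simp: monotone_on_def)
    ultimately show False by simp
  qed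
  show "deriv H x < 0" if "C < x" "x < K" for x using nz1[OF that] nonpos1[OF that] by simp
  have "\<exists>x. K < x \<and> x < C + 1 \<and> deriv H x > 0"
  proof -
    obtain e where e: "e > 0" "strict_mono_on {K..K + e} H"
      using turn(2) unfolding turning_min_def by blast
    define y where "y = K + min e ((C + 1 - K) / 2)"
    have y: "K < y" "y \<le> K + e" "y < C + 1" using e CK by (auto simp: y_def min_def field_simps)
    have "H K < H y" using e(2) y by (auto simp: monotone_on_def)
    moreover obtain z where z: "K < z" "z < y" "H y - H K = (y - K) * deriv H z"
      using MVT2[OF y(1), of H "deriv H"] d(1) by auto
    ultimately have "0 < (y - K) * deriv H z" by simp
    then have "deriv H z > 0" using y by (simp add: zero_less_mult_iff)
    then show ?thesis using z y by auto
  qed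
  then obtain x where x: "K < x" "x < C + 1" "deriv H x > 0" by blast
  show "0 < deriv H y" if "K < y" "y < C + 1" for y
    using nonzero_continuous_sign[OF cont nz2 x that] .
  have "card (critical_points H) = 2" using crit CK by simp
  then have "\<forall>x. deriv H x \<noteq> 0 \<longrightarrow> schwarzian H x < 0" using cB by (simp add: class_B_def)
  then show "(deriv ^^ 3) H x / deriv H x - 3 / 2 * ((deriv ^^ 2) H x / deriv H x)\<^sup>2 < 0" if "deriv H x \<noteq> 0" for x
    using that by (simp add: schwarzian_def)
qed (use assms C3_derivs cB class_B_def in auto)

text \<open>At the critical height the derivative vanishes only at \<open>c\<close> modulo 1, and
  the rise by 1 over a period makes it positive elsewhere. Uniform convergence of the derivatives
  then drives both turning points to \<open>c\<close>.\<close>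

lemma class_N_unfolding:
  assumes N: "class_N f F"
  shows "\<exists>C K b1 c \<Lambda>. bimodal_unfolding (F 0) (\<lambda>b. deriv (F 0 b)) (\<lambda>b. (deriv ^^ 2) (F 0 b))
    (\<lambda>b. (deriv ^^ 3) (F 0 b)) C K (critical_height F) b1 c \<Lambda>"
proof -
  define b0 where "b0 = critical_height F"
  let ?H = "F 0 b0"
  have cB: "class_B (F 0 b)" for b using N unfolding class_N_def by blast
  have deg: "deg1 (F 0 b)" for b
    using cB[of b] by (simp add: class_B_def degree_one_lift_def deg1_def)
  have c3: "C3 (F 0 b)" for b using cB by (simp add: class_B_def)
  note d = C3_derivs[OF c3]
  have per: "deriv (F 0 b) (x + of_int m) = deriv (F 0 b) x" for b x m
    by (rule deg1_deriv_add_of_int[OF deg d(1)])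
  have cont: "continuous_on UNIV (deriv ?H)"
    using d(2) by (intro DERIV_continuous_on) (auto intro: has_field_derivative_at_within)
  have u1: "\<exists>d>0. \<forall>b'. \<bar>b' - b\<bar> < d \<longrightarrow> (\<forall>x. \<bar>F 0 b' x - F 0 b x\<bar> < e)" if "e > 0" for b e
    by (rule uniform_limit_line[OF _ that]) (use N in \<open>unfold class_N_def, blast\<close>)
  have u2: "\<exists>d>0. \<forall>b'. \<bar>b' - b\<bar> < d \<longrightarrow> (\<forall>x. \<bar>deriv (F 0 b') x - deriv (F 0 b) x\<bar> < e)" if "e > 0" for b e
    by (rule uniform_limit_line[where \<Phi> = "\<lambda>a b. deriv (F a b)", OF _ that])
      (use N in \<open>unfold class_N_def, blast\<close>)
  have norm: "normalized_origin F" using N unfolding class_N_def by blast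
  then obtain c where c: "critical_points ?H = {c}" "0 < c" unfolding normalized_origin_def b0_def by blast
  have zero: "deriv ?H x = 0 \<longleftrightarrow> x = c" if "0 \<le> x" "x < 1" for x
    using c that unfolding critical_points_def by auto
  have c1: "c < 1" "deriv ?H c = 0" using c unfolding critical_points_def by auto
  have nz: "deriv ?H x \<noteq> 0" if "c < x" "x < c + 1" for x
  proof (cases "x < 1")
    case True
    then show ?thesis using zero[of x] that c by auto
  next
    case False
    then show ?thesis using zero[of "x - 1"] per[of b0 "x - 1" 1] that c1 by auto
  qed
  have pos0: "deriv ?H y > 0" if "c < y" "y < c + 1" for y
  proof -
    have lt: "c < c + 1" by simp
    obtain z where z: "c < z" "z < c + 1" "?H (c + 1) - ?H c = (c + 1 - c) * deriv ?H z"
      using MVT2[OF lt, of ?H "deriv ?H"] d(1) by auto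
    have "deriv ?H z > 0" using z(3) deg[of b0] by (simp add: deg1_def)
    then show ?thesis using nonzero_continuous_sign[OF cont nz z(1,2) _ that] by blast
  qed
  \<comment> \<open>The turning points are chosen as a pair, since the conditions tie them
    together.\<close>
  define CK where "CK b = (SOME p. critical_points (F 0 b) = {fst p, snd p} \<and> 0 \<le> fst p \<and> fst p < snd p \<and> snd p < 1 \<and>
        turning_max (F 0 b) (fst p) \<and> turning_min (F 0 b) (snd p))" for b
  define C where "C b = fst (CK b)" for b
  define K where "K b = snd (CK b)" for b
  have CK: "critical_points (F 0 b) = {C b, K b} \<and> 0 \<le> C b \<and> C b < K b \<and> K b < 1 \<and>
        turning_max (F 0 b) (C b) \<and> turning_min (F 0 b) (K b)" if "b0 < b" for b
    unfolding C_def K_def CK_def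
  proof (rule someI_ex)
    obtain C' K' where "critical_points (F 0 b) = {C', K'} \<and> 0 \<le> C' \<and> C' < K' \<and> K' < 1 \<and>
        turning_max (F 0 b) C' \<and> turning_min (F 0 b) K'"
      using norm \<open>b0 < b\<close> unfolding normalized_origin_def b0_def by meson
    then show "\<exists>p. critical_points (F 0 b) = {fst p, snd p} \<and> 0 \<le> fst p \<and> fst p < snd p \<and> snd p < 1 \<and>
        turning_max (F 0 b) (fst p) \<and> turning_min (F 0 b) (snd p)"
      by (intro exI[of _ "(C', K')"]) simp
  qed
  have localize: "\<exists>\<delta>>0. \<forall>b. b0 < b \<and> b < b0 + \<delta> \<longrightarrow> \<bar>C b - c\<bar> < e \<and> \<bar>K b - c\<bar> < e" if e: "e > 0" for e
  proof (cases "{0..1} - {c - e<..<c + e} = {}")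
    case True
    have "\<bar>x - c\<bar> < e" if "0 \<le> x" "x < 1" for x
    proof -
      have "x \<in> {0..1}" using that by simp
      then have "x \<in> {c - e<..<c + e}" using True by blast
      then show ?thesis by (auto simp: abs_less_iff)
    qed
    then have "\<bar>C b - c\<bar> < e \<and> \<bar>K b - c\<bar> < e" if "b0 < b" for b using CK[OF that] by auto
    then show ?thesis by (intro exI[of _ 1]) simp
  next
    case False
    define S where "S = {0..1} - {c - e<..<c + e}"
    have S: "compact S" "S \<noteq> {}" unfolding S_def using False by (auto intro: compact_diff)
    obtain x0 where x0: "x0 \<in> S" "\<And>x. x \<in> S \<Longrightarrow> \<bar>deriv ?H x0\<bar> \<le> \<bar>deriv ?H x\<bar>"
      using continuous_attains_inf[OF S, of "\<lambda>x. \<bar>deriv ?H x\<bar>"] continuous_on_subset[OF cont]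
      by (metis continuous_on_rabs subset_UNIV)
    \<comment> \<open>The point 1 lies outside the fundamental domain; periodicity moves it to 0,
      which is not critical because \<open>0 < c\<close>.\<close>
    have "deriv ?H x0 \<noteq> 0"
    proof (cases "x0 = 1")
      case True
      then show ?thesis using zero[of 0] per[of b0 0 1] c by auto
    next
      case False
      then show ?thesis using zero[of x0] x0(1) e by (auto simp: S_def)
    qed
    then have "\<bar>deriv ?H x0\<bar> > 0" by simp
    then obtain \<delta> where \<delta>: "\<delta> > 0" "\<And>b x. \<bar>b - b0\<bar> < \<delta> \<Longrightarrow> \<bar>deriv (F 0 b) x - deriv ?H x\<bar> < \<bar>deriv ?H x0\<bar>"
      using u2 by blast
    have "\<bar>x - c\<bar> < e" if b: "b0 < b" "b < b0 + \<delta>" and x: "x \<in> critical_points (F 0 b)" for b x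
    proof (rule ccontr)
      assume "\<not> ?thesis"
      then have "x \<in> S" using x by (auto simp: S_def critical_points_def)
      then have "\<bar>deriv ?H x0\<bar> \<le> \<bar>deriv ?H x\<bar>" by (rule x0)
      moreover have "\<bar>deriv (F 0 b) x - deriv ?H x\<bar> < \<bar>deriv ?H x0\<bar>" using b by (intro \<delta>(2)) simp
      moreover have "deriv (F 0 b) x = 0" using x by (simp add: critical_points_def)
      ultimately show False by simp
    qed
    then show ?thesis using \<delta>(1) CK by (intro exI[of _ \<delta>]) auto
  qed
  obtain M where M: "\<And>x. \<bar>deriv ?H x\<bar> \<le> M"
  proof -
    obtain x0 where x0: "\<forall>x\<in>{0..1}. \<bar>deriv ?H x\<bar> \<le> \<bar>deriv ?H x0\<bar>"
      using continuous_attains_sup[of "{0..1::real}" "\<lambda>x. \<bar>deriv ?H x\<bar>"] continuous_on_subset[OF cont]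
      by (metis atLeastAtMost_iff compact_Icc continuous_on_rabs empty_iff le_numeral_extra(1,3) subset_UNIV)
    have "\<bar>deriv ?H x\<bar> \<le> \<bar>deriv ?H x0\<bar>" for x
    proof -
      have "x - of_int \<lfloor>x\<rfloor> \<in> {0..1}" by (auto, linarith)
      then show ?thesis using x0 per[of b0 "x - of_int \<lfloor>x\<rfloor>" "\<lfloor>x\<rfloor>"] by auto
    qed
    then show ?thesis using that by blast
  qed
  obtain \<delta> where \<delta>: "\<delta> > 0" "\<And>b x. \<bar>b - b0\<bar> < \<delta> \<Longrightarrow> \<bar>deriv (F 0 b) x - deriv ?H x\<bar> < 1"
    using u2[of 1 b0] by auto
  \<comment> \<open>The bound at the critical height plus the perturbation 1: one Lipschitz constant
    for the whole slab.\<close>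
  define \<Lambda> where "\<Lambda> = M + 1"
  have lift: "lip_lift \<Lambda> (F 0 b)" if "\<bar>b - b0\<bar> < \<delta>" for b
  proof (rule lip_liftI[OF deg d(1)])
    show "\<bar>deriv (F 0 b) x\<bar> \<le> \<Lambda>" for x using M[of x] \<delta>(2)[OF that, of x] unfolding \<Lambda>_def by linarith
  qed
  have "bimodal_unfolding (F 0) (\<lambda>b. deriv (F 0 b)) (\<lambda>b. (deriv ^^ 2) (F 0 b))
    (\<lambda>b. (deriv ^^ 3) (F 0 b)) C K b0 (b0 + \<delta>) c \<Lambda>"
  proof (rule bimodal_unfolding.intro)
    show "bimodal_lift (F 0 b) (deriv (F 0 b)) ((deriv ^^ 2) (F 0 b)) ((deriv ^^ 3) (F 0 b)) (C b) (K b) \<Lambda>"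
      if "b0 < b" "b < b0 + \<delta>" for b
      using CK[OF that(1)] that by (intro class_N_bimodal cB lift) auto
    show "\<exists>d>0. \<forall>b. b0 < b \<and> b < b0 + d \<longrightarrow>
      (\<forall>x. \<bar>F 0 b x - F 0 b0 x\<bar> < e \<and> \<bar>deriv (F 0 b) x - deriv (F 0 b0) x\<bar> < e) \<and> \<bar>C b - c\<bar> < e \<and> \<bar>K b - c\<bar> < e"
      if e: "e > 0" for e
    proof -
      obtain d1 where d1: "d1 > 0" "\<And>b x. \<bar>b - b0\<bar> < d1 \<Longrightarrow> \<bar>F 0 b x - F 0 b0 x\<bar> < e" using u1[OF e] by blast
      obtain d2 where d2: "d2 > 0" "\<And>b x. \<bar>b - b0\<bar> < d2 \<Longrightarrow> \<bar>deriv (F 0 b) x - deriv (F 0 b0) x\<bar> < e" using u2[OF e] by blast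
      obtain d3 where d3: "d3 > 0" "\<And>b. b0 < b \<and> b < b0 + d3 \<Longrightarrow> \<bar>C b - c\<bar> < e \<and> \<bar>K b - c\<bar> < e" using localize[OF e] by blast
      show ?thesis using d1 d2 d3 by (intro exI[of _ "min d1 (min d2 d3)"]) auto
    qed
  qed (use \<delta>(1) lift d(1) cont c1 pos0 in auto)
  then show ?thesis unfolding b0_def by blast
qed

theorem corollary2:
  fixes f :: "real \<Rightarrow> real \<Rightarrow> complex \<Rightarrow> complex"
    and F :: "real \<Rightarrow> real \<Rightarrow> real \<Rightarrow> real"
    and \<omega> :: real
  assumes "class_N f F"
    and "\<omega> \<in> \<rat>"
  shows "(\<exists>\<gamma>. arc \<gamma> \<and> path_image \<gamma> \<subseteq> tongue_left_side F \<omega> \<and>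
            (\<forall>p\<in>path_image \<gamma>. not_locally_connected_at (frontier (zero_width_set F)) p)) \<and>
         (\<exists>\<gamma>. arc \<gamma> \<and> path_image \<gamma> \<subseteq> tongue_right_side F \<omega> \<and>
            (\<forall>p\<in>path_image \<gamma>. not_locally_connected_at (frontier (zero_width_set F)) p))"
proof -
  let ?b0 = "critical_height F"
  obtain C K b1 c \<Lambda> where bu: "bimodal_unfolding (F 0) (\<lambda>b. deriv (F 0 b)) (\<lambda>b. (deriv ^^ 2) (F 0 b))
    (\<lambda>b. (deriv ^^ 3) (F 0 b)) C K ?b0 b1 c \<Lambda>" using class_N_unfolding[OF assms(1)] by blast
  interpret bimodal_unfolding "F 0" "\<lambda>b. deriv (F 0 b)" "\<lambda>b. (deriv ^^ 2) (F 0 b)"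
    "\<lambda>b. (deriv ^^ 3) (F 0 b)" C K ?b0 b1 c \<Lambda> by (rule bu)
  interpret fl: bimodal_unfolding "\<lambda>b. flip (F 0 b)" "\<lambda>b x. deriv (F 0 b) (- x)" "\<lambda>b x. - (deriv ^^ 2) (F 0 b) (- x)"
    "\<lambda>b x. (deriv ^^ 3) (F 0 b) (- x)" "\<lambda>b. - K b" "\<lambda>b. - C b" ?b0 b1 "- c" \<Lambda> by (rule flip_unfolding)
  have Fa: "F a b = (\<lambda>x. F 0 b x + a)" for a b
  proof
    show "F a b x = F 0 b x + a" for x using assms(1) unfolding class_N_def by blast
  qed
  have cont: "\<exists>d>0. \<forall>b'. \<bar>b' - b\<bar> < d \<longrightarrow> (\<forall>x. \<bar>F 0 b' x - F 0 b x\<bar> < e)" if "e > 0" for b e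
    by (rule uniform_limit_line[OF _ that]) (use assms(1) in \<open>unfold class_N_def, blast\<close>)
  have contf: "\<exists>d>0. \<forall>b'. \<bar>b' - b\<bar> < d \<longrightarrow> (\<forall>x. \<bar>flip (F 0 b') x - flip (F 0 b) x\<bar> < e)" if e: "e > 0" for b e
  proof -
    obtain d where "d > 0" "\<And>b' x. \<bar>b' - b\<bar> < d \<Longrightarrow> \<bar>F 0 b' x - F 0 b x\<bar> < e" using cont[OF e] by blast
    then show ?thesis by (intro exI[of _ d]) (auto simp: flip_def abs_minus_commute)
  qed
  have lifta: "lip_lift \<Lambda> (F a b)" if "?b0 < b" "b < b1" for a b
    unfolding Fa[of a b] by (rule lip_lift_add[OF lift[OF that]])
  have ra: "rotation (upper_bound (F a b)) = rotation (\<lambda>x. upper_bound (F 0 b) x + a)"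
    "rotation (lower_bound (F a b)) = rotation (\<lambda>x. lower_bound (F 0 b) x + a)"
    "rotation (lower_bound (F a b)) = - rotation (\<lambda>x. upper_bound (flip (F 0 b)) x - a)"
    "rotation (upper_bound (F a b)) = - rotation (\<lambda>x. lower_bound (flip (F 0 b)) x - a)"
    if b: "?b0 < b" "b < b1" for a b
  proof -
    show u: "rotation (upper_bound (F a b)) = rotation (\<lambda>x. upper_bound (F 0 b) x + a)"
      and l: "rotation (lower_bound (F a b)) = rotation (\<lambda>x. lower_bound (F 0 b) x + a)"
      unfolding Fa[of a b] by (simp_all add: upper_bound_add[OF lift[OF b]] lower_bound_add[OF lift[OF b]])
    show "rotation (lower_bound (F a b)) = - rotation (\<lambda>x. upper_bound (flip (F 0 b)) x - a)"
      unfolding l by (rule rotation_lower_add_flip[OF lift[OF b]])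
    show "rotation (upper_bound (F a b)) = - rotation (\<lambda>x. lower_bound (flip (F 0 b)) x - a)"
      unfolding u using rotation_lower_add_flip[OF fl.lift[OF b], of "- a"] by simp
  qed
  have Z: "(a, b) \<in> zero_width_set F \<longleftrightarrow> rotation (lower_bound (F a b)) = rotation (upper_bound (F a b))"
    if "?b0 < b" "b < b1" for a b
    using Rot_singleton_iff[OF lifta[OF that]] by (simp add: zero_width_set_def)
  have left: "(a, b) \<in> tongue_left_side F \<omega>" if b: "?b0 < b" "b < b1" and e: "left_end (F 0 b) \<omega> a" for a b
  proof -
    have "\<omega> \<in> Rot (F a b)"
      using rotation_upper_in_Rot[OF lifta[OF b], of a] e ra(1)[OF b] by (simp add: left_end_def)
    moreover have "a \<le> a'" if "\<omega> \<in> Rot (F a' b)" for a'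
    proof (rule ccontr)
      assume "\<not> a \<le> a'"
      then have "rotation (upper_bound (F a' b)) < \<omega>" using e ra(1)[OF b] by (simp add: left_end_def)
      then show False using Rot_le_upper[OF lifta[OF b] that] by simp
    qed
    ultimately show ?thesis by (simp add: tongue_left_side_def arnold_tongue_def)
  qed
  \<comment> \<open>When \<open>- a\<close> is a left end for \<open>- \<omega>\<close> in the
    reflected family, the lower end of the rotation set equals \<omega> at \<open>a\<close> and
    exceeds it beyond.\<close>
  have right: "(a, b) \<in> tongue_right_side F \<omega>" if b: "?b0 < b" "b < b1" and e: "left_end (flip (F 0 b)) (- \<omega>) (- a)" for a b
  proof -
    have "\<omega> \<in> Rot (F a b)"
      using rotation_lower_in_Rot[OF lifta[OF b], of a] e ra(3)[OF b] by (simp add: left_end_def)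
    moreover have "a' \<le> a" if "\<omega> \<in> Rot (F a' b)" for a'
    proof (rule ccontr)
      assume "\<not> a' \<le> a"
      then have "- a' < - a" by simp
      then have "rotation (\<lambda>x. upper_bound (flip (F 0 b)) x + (- a')) < - \<omega>" using e unfolding left_end_def by blast
      then have "\<omega> < rotation (lower_bound (F a' b))" using ra(3)[OF b] by simp
      then show False using Rot_ge_lower[OF lifta[OF b] that] by simp
    qed
    ultimately show ?thesis by (simp add: tongue_right_side_def arnold_tongue_def)
  qed
  have "\<exists>\<gamma>. arc \<gamma> \<and> (\<forall>p\<in>path_image \<gamma>. ?b0 < snd p \<and> snd p < b1 \<and> left_end (F 0 (snd p)) \<omega> (1 * fst p) \<and>
      not_locally_connected_at (frontier (zero_width_set F)) p)"
    by (rule tongue_side_not_locally_connected[OF assms(2)]) (auto simp: cont Z ra(1,2))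
  \<comment> \<open>The reflected family with sign -1 yields the right side. Its zero-width
    parameters are the same ones, because reflection merely exchanges the two bounds.\<close>
  moreover have "\<exists>\<gamma>. arc \<gamma> \<and> (\<forall>p\<in>path_image \<gamma>. ?b0 < snd p \<and> snd p < b1 \<and>
      left_end (flip (F 0 (snd p))) (- \<omega>) (- 1 * fst p) \<and>
      not_locally_connected_at (frontier (zero_width_set F)) p)"
    by (rule fl.tongue_side_not_locally_connected) (use assms(2) in \<open>auto simp: contf Z ra(3,4)\<close>)
  ultimately show ?thesis
    using left right by (metis (no_types, lifting) mult_1 mult_minus1 prod.collapse subsetI)
qed

end
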